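(* For every integer $r\geq 3$ and every real $\gamma>0$ there exists $\varepsilon>0$ such that the following holds for every $(\varepsilon,p)$-pseudorandom $r$-uniform hypergraph $\mathcal H$ on $n$ vertices with $\Delta_2(\mathcal H)\leq 2\ln n$, $p=\frac{(\ln n)^{17r}}{n^{r-1}}$ and $n$ sufficiently large: every spanning subgraph $H\subseteq\mathcal H$ with $\delta_1(H)\geq\left(\frac{1}{2^{r-1}}+\gamma\right)p\binom{n}{r-1}$ contains a Hamilton Berge cycle.
   Context: $\delta_1(H)$ is the minimum number of edges containing a vertex; $\Delta_2(H)$ is the maximum number of edges containing a fixed pair of vertices. For disjoint $T,U$, $e_H(T,\binom{U}{r-1})$ is the number of edges $e$ with $|e\cap T|=1$, $|e\cap U|=r-1$. Given $p>0$ and $\varepsilon\in(0,3/2)$, an $r$-uniform hypergraph $\mathcal H$ on vertex set $[n]$ is $(\varepsilon,p)$-pseudorandom if (i) for all disjoint $T,U\subseteq[n]$ with $|U|\leq|T|$: $e_{\mathcal H}(T,\binom{U}{r-1})\leq(1+\varepsilon)p|T|\binom{|U|}{r-1}+|T|(\ln n)^{1+\varepsilon}$; and (ii) for all disjoint $T,U$ with $\varepsilon|U|\leq|T|\leq|U|\leq n/2$ and $|U|\geq\left(\frac{13(r-1)!\ln n}{\varepsilon^3p}\right)^{1/(r-1)}$: $e_{\mathcal H}(T,\binom{U}{r-1})\leq(1+\varepsilon)p|T|\binom{|U|}{r-1}$. A Hamilton Berge cycle of a hypergraph on $n$ vertices is an alternating sequence $(v_1,e_1,\ldots,v_n,e_n)$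 of distinct vertices (all vertices) and distinct hyperedges with $\{v_1,v_n\}\subseteq e_n$ and $\{v_i,v_{i+1}\}\subseteq e_i$ for $i\in[n-1]$. *)

theory Defs
  imports Complex_Main
begin

text \<open>
  A hypergraph is given by its vertex set \<open>V\<close> and its edge set \<open>E\<close>. Edges are sets, so there are
  no parallel edges. A spanning subgraph of \<open>(V, E)\<close> is \<open>(V, H)\<close> with \<open>H \<subseteq> E\<close>.
\<close>

definition uniform_hypergraph :: "nat \<Rightarrow> 'a set \<Rightarrow> 'a set set \<Rightarrow> bool" where
  "uniform_hypergraph r V E \<longleftrightarrow> finite V \<and> (\<forall>e\<in>E. e \<subseteq> V \<and> card e = r)"

text \<open>\<open>\<delta>\<^sub>1\<close>; only meaningful for \<open>V\<close> finite and nonempty.\<close>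

definition min_degree :: "'a set \<Rightarrow> 'a set set \<Rightarrow> nat" where
  "min_degree V E = Min ((\<lambda>v. card {e \<in> E. v \<in> e}) ` V)"

text \<open>\<open>\<Delta>\<^sub>2\<close>; only meaningful for \<open>V\<close> finite with at least two elements.\<close>

definition max_codegree :: "'a set \<Rightarrow> 'a set set \<Rightarrow> nat" where
  "max_codegree V E = Max ((\<lambda>P. card {e \<in> E. P \<subseteq> e}) ` {P. P \<subseteq> V \<and> card P = 2})"

text \<open>\<open>e\<^sub>E(T, binom(U, r - 1))\<close>\<close>

definition cross_edges :: "nat \<Rightarrow> 'a set set \<Rightarrow> 'a set \<Rightarrow> 'a set \<Rightarrow> nat" where
  "cross_edges r E T U = card {e \<in> E. card (e \<inter> T) = 1 \<and> card (e \<inter> U) = r - 1}"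

text \<open>
  \<open>(\<epsilon>, p)\<close>-pseudorandomness is meant for \<open>p > 0\<close> and \<open>0 < \<epsilon> < 3/2\<close>. These ranges are not part of
  the predicate: a claim \<open>\<exists>\<epsilon>. \<dots>\<close> about pseudorandom hypergraphs has to bound \<open>\<epsilon>\<close> explicitly and
  cannot become vacuous by choosing \<open>\<epsilon>\<close> too large.
\<close>

definition pseudorandom :: "nat \<Rightarrow> real \<Rightarrow> real \<Rightarrow> 'a set \<Rightarrow> 'a set set \<Rightarrow> bool" where
  "pseudorandom r \<epsilon> p V E \<longleftrightarrow>
     uniform_hypergraph r V E \<and>
     (\<forall>T U. T \<subseteq> V \<and> U \<subseteq> V \<and> T \<inter> U = {} \<and> card U \<le> card T \<longrightarrow>
        real (cross_edges r E T U)
          \<le> (1 + \<epsilon>) * p * real (card T) * real (card U choose (r - 1))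
            + real (card T) * ln (real (card V)) powr (1 + \<epsilon>)) \<and>
     (\<forall>T U. T \<subseteq> V \<and> U \<subseteq> V \<and> T \<inter> U = {} \<and>
        \<epsilon> * real (card U) \<le> real (card T) \<and> card T \<le> card U \<and>
        real (card U) \<le> real (card V) / 2 \<and>
        real (card U) \<ge> (13 * fact (r - 1) * ln (real (card V)) / (\<epsilon> ^ 3 * p))
                          powr (1 / real (r - 1)) \<longrightarrow>
        real (cross_edges r E T U)
          \<le> (1 + \<epsilon>) * p * real (card T) * real (card U choose (r - 1)))"

text \<open>
  The sequence \<open>(v\<^sub>1, e\<^sub>1, \<dots>, v\<^sub>n, e\<^sub>n)\<close> is represented by the lists of the \<open>v\<^sub>i\<close> and of the \<open>e\<^sub>i\<close>,
  indexed from \<open>0\<close>.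
\<close>

definition hamilton_berge_cycle ::
  "'a set \<Rightarrow> 'a set set \<Rightarrow> 'a list \<Rightarrow> 'a set list \<Rightarrow> bool" where
  "hamilton_berge_cycle V E vs es \<longleftrightarrow>
     vs \<noteq> [] \<and> length es = length vs \<and>
     distinct vs \<and> set vs = V \<and>
     distinct es \<and> set es \<subseteq> E \<and>
     (\<forall>i. i + 1 < length vs \<longrightarrow> {vs ! i, vs ! (i + 1)} \<subseteq> es ! i) \<and>
     {hd vs, last vs} \<subseteq> last es"

end

theory Submission imports Defs "HOL-Probability.Probability"
begin

text \<open>
  Pick in every hyperedge a uniformly random pair. The pairs form a graph \<open>G\<close>, and a Hamilton cycle of
  \<open>G\<close> is a Hamilton Berge cycle, since distinct pairs come from distinct hyperedges. By
  pseudorandomness, averaged over random subsets of the two sides, few edges at \<open>T\<close> stay inside a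
  set \<open>W\<close> of size slightly above \<open>n/2\<close>; the degree condition then sends many edges out of \<open>W\<close>, so that
  with positive probability small sets expand in \<open>G\<close> by a polylogarithmic factor and sets of
  size \<open>n / (ln n)\<^sup>1\<^sup>5\<close> have more than \<open>(1/2 + c) n\<close> neighbours.

  The vertices are coloured at random with about \<open>(ln n)\<^sup>6\<close> colours; all colour classes inherit the
  expansion. Some classes form reservoirs through which many prescribed pairs can be joined by
  disjoint paths of equal length. One reservoir \<open>R\<close> is made absorbable: a path \<open>A\<close> outside \<open>R\<close> is built
  that can be extended by any subset of \<open>R\<close> without changing its ends. Hall's theorem between
  consecutive colour classes covers everything outside \<open>R\<close> and \<open>A\<close> by few paths. These and \<open>A\<close> are
  closed up to a cycle through \<open>R\<close>, and \<open>A\<close> absorbs what is left of \<open>R\<close>.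
\<close>

subsection \<open>Linking pairs of vertices in an expanding graph\<close>

text \<open>The constant \<open>1 / 2 ^ (r - 1)\<close> is the share of edges at a vertex whose
  other vertices fall into a set of half the vertices. The surplus \<open>\<gamma>\<close> therefore
  pushes neighbourhoods past one half, and this is what linking and matching live on: searches from
  both ends of a path meet, and Hall's condition can be tested from both sides.

  The obstacle is that pseudorandomness compares disjoint \<open>T\<close>, \<open>U\<close> with
  \<open>card U \<le> card T\<close>, while here \<open>T\<close> is a small part of a large
  \<open>W\<close>. Sampling both sides repairs this but multiplies the additive error by a power of
  \<open>card W / card T\<close>. With \<open>x = ln n\<close>, that ratio is allowed up to order
  \<open>x ^ 15\<close>; the error \<open>x ^ (15 * (r - 1) + 2)\<close> is still below the degree
  scale \<open>x ^ (17 * r)\<close>.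

  The other exponents follow. The reservoirs have order \<open>x ^ 2\<close> layers of at most order
  \<open>x ^ 3\<close> classes, hence take \<open>x ^ 5\<close> of the \<open>x ^ 6\<close> classes.
  Hoeffding's inequality with \<open>x ^ 6\<close> colours needs order \<open>x ^ 13\<close>
  neighbours per vertex of a small set and a threshold size below order \<open>n / x ^ 13\<close>;
  \<open>x ^ 14\<close> and \<open>x ^ 15\<close> leave room for constants.\<close>

lemma hall_marriage:
  fixes A :: "'i \<Rightarrow> 'a set"
  assumes "finite I" "\<And>i. i \<in> I \<Longrightarrow> finite (A i)"
    and "\<And>J. J \<subseteq> I \<Longrightarrow> card J \<le> card (\<Union>(A ` J))"
  shows "\<exists>f. inj_on f I \<and> (\<forall>i\<in>I. f i \<in> A i)"
  using assms
proof (induction "card I" arbitrary: I A rule: less_induct)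
  case less
  have finU: "finite (\<Union>(A ` J))" if "J \<subseteq> I" for J
    using less.prems(1,2) that by (meson finite_UN_I finite_subset subsetD)
  \<comment> \<open>Either every proper nonempty subfamily has a surplus, and any choice for one
    index keeps Hall's condition, or some \<open>J\<close> is tight, and \<open>J\<close> and the
    rest (with the union over \<open>J\<close> removed) are matched separately.\<close>
  consider "I = {}"
    | "I \<noteq> {}" "\<forall>J. J \<noteq> {} \<and> J \<subset> I \<longrightarrow> card J < card (\<Union>(A ` J))"
    | J where "J \<noteq> {}" "J \<subset> I" "card (\<Union>(A ` J)) \<le> card J"
    by (meson not_le)
  then show ?case
  proof cases
    case 1
    then show ?thesis by auto
  next
    case 2
    then obtain i where i: "i \<in> I" by auto
    have "card {i} \<le> card (\<Union>(A ` {i}))" using less.prems(3)[of "{i}"] i by simp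
    then have "A i \<noteq> {}" by auto
    then obtain a where a: "a \<in> A i" by auto
    let ?A = "\<lambda>j. A j - {a}"
    have "\<exists>f. inj_on f (I - {i}) \<and> (\<forall>j\<in>I - {i}. f j \<in> ?A j)"
    proof (rule less.hyps)
      show "card (I - {i}) < card I" using i less.prems(1) by (meson card_Diff1_less)
      fix J assume J: "J \<subseteq> I - {i}"
      show "card J \<le> card (\<Union>(?A ` J))"
      proof (cases "J = {}")
        case False
        then have "card J < card (\<Union>(A ` J))" using 2 J i by blast
        moreover have "\<Union>(?A ` J) = \<Union>(A ` J) - {a}" by auto
        moreover have "card (\<Union>(A ` J)) - 1 \<le> card (\<Union>(A ` J) - {a})"
          by (metis card_Diff_singleton card_Diff_singleton_if diff_le_self order_refl)
        ultimately show ?thesis by simp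
      qed auto
    qed (use less.prems in auto)
    then obtain f where f: "inj_on f (I - {i})" "\<forall>j\<in>I - {i}. f j \<in> ?A j" by auto
    have "inj_on (f(i := a)) I" using f i by (auto simp: inj_on_def)
    moreover have "\<forall>j\<in>I. (f(i := a)) j \<in> A j" using f a by auto
    ultimately show ?thesis by blast
  next
    case 3
    let ?B = "\<Union>(A ` J)"
    have finJ: "finite J" using 3 less.prems(1) finite_subset by blast
    have "\<exists>f. inj_on f J \<and> (\<forall>j\<in>J. f j \<in> A j)"
    proof (rule less.hyps)
      show "card J < card I" using 3 less.prems(1) psubset_card_mono by blast
    qed (use less.prems 3 finJ in auto)
    then obtain f where f: "inj_on f J" "\<forall>j\<in>J. f j \<in> A j" by auto
    have "\<exists>g. inj_on g (I - J) \<and> (\<forall>j\<in>I - J. g j \<in> A j - ?B)"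
    proof (rule less.hyps)
      have "J \<inter> I \<noteq> {}" using 3 by auto
      then show "card (I - J) < card I" using less.prems(1)
        by (metis "3"(1,2) Diff_subset card_mono card_Diff_subset card_gt_0_iff diff_less finJ
            finite_subset psubset_imp_subset subset_empty)
      fix K assume K: "K \<subseteq> I - J"
      have "finite K" using K less.prems(1) by (meson finite_Diff finite_subset)
      have "K \<union> J \<subseteq> I" using K 3 by auto
      then have "card (K \<union> J) \<le> card (\<Union>(A ` (K \<union> J)))" by (rule less.prems(3))
      moreover have "card (K \<union> J) = card K + card J" using K finJ \<open>finite K\<close>
        by (intro card_Un_disjoint) auto
      moreover have eq: "\<Union>((\<lambda>j. A j - ?B) ` K) = \<Union>(A ` (K \<union> J)) - ?B" by auto
      moreover have "card (\<Union>(A ` (K \<union> J)) - ?B) = card (\<Union>(A ` (K \<union> J))) - card ?B"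
        by (rule card_Diff_subset) (use 3 finU[of J] in auto)
      ultimately show "card K \<le> card (\<Union>((\<lambda>j. A j - ?B) ` K))" using 3(3) unfolding eq by linarith
    next
      show "finite (I - J)" using less.prems(1) by simp
      show "finite (A i - ?B)" if "i \<in> I - J" for i using less.prems(2)[of i] that by simp
    qed
    then obtain g where g: "inj_on g (I - J)" "\<forall>j\<in>I - J. g j \<in> A j - ?B" by (elim exE conjE)
    let ?h = "\<lambda>i. if i \<in> J then f i else g i"
    have ne: "f i \<noteq> g j" if "i \<in> J" "j \<in> I - J" for i j
      using bspec[OF f(2) that(1)] bspec[OF g(2) that(2)] that(1) by auto
    have "inj_on ?h I"
    proof (rule inj_onI)
      fix i j assume ij: "i \<in> I" "j \<in> I" "?h i = ?h j"
      show "i = j"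
        using ij ne[of i j] ne[of j i] inj_onD[OF f(1), of i j] inj_onD[OF g(1), of i j]
        by (auto split: if_splits)
    qed
    moreover have "?h j \<in> A j" if "j \<in> I" for j
      using bspec[OF f(2), of j] bspec[OF g(2), of j] that by simp
    ultimately show ?thesis by (intro exI[of _ ?h] conjI ballI)
  qed
qed

locale fin_graph =
  fixes V :: "'a set" and adj :: "'a \<Rightarrow> 'a \<Rightarrow> bool"
  assumes fin: "finite V" and sym: "adj u v \<Longrightarrow> adj v u" and adj_V: "adj u v \<Longrightarrow> v \<in> V"
begin

definition nb :: "'a set \<Rightarrow> 'a set" where
  "nb T = {v. \<exists>u\<in>T. adj u v}"

lemma nb_subset: "nb T \<subseteq> V"
  using adj_V by (auto simp: nb_def)

lemma nb_mono: "S \<subseteq> T \<Longrightarrow> nb S \<subseteq> nb T"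
  by (auto simp: nb_def)

lemma finite_nb [simp]: "finite (nb T)"
  using nb_subset fin finite_subset by blast

lemma successively_rev_adj: "successively adj (rev xs) = successively adj xs"
proof -
  have "(\<lambda>x y. adj y x) = adj" using sym by (intro ext) auto
  then show ?thesis by (metis successively_rev)
qed

text \<open>\<open>T\<close> ranges over all vertex sets, not only subsets of \<open>S\<close>,
  because paths enter \<open>S\<close> from outside. The slack \<open>2 * M\<close> keeps more than
  half of \<open>S\<close> reachable after a loss of up to \<open>M\<close> vertices.\<close>

definition expands :: "nat \<Rightarrow> 'a set \<Rightarrow> bool" where
  "expands M S \<longleftrightarrow> S \<subseteq> V \<and> (\<forall>T\<subseteq>V. card T \<le> M \<longrightarrow> 6 * card T \<le> card (nb T \<inter> S)) \<and>
     (\<forall>T\<subseteq>V. M \<le> card T \<longrightarrow> card S + 2 * M < 2 * card (nb T \<inter> S))"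

lemma expandsD:
  assumes "expands M S" "T \<subseteq> V"
  shows "card T \<le> M \<Longrightarrow> 6 * card T \<le> card (nb T \<inter> S)"
    and "M \<le> card T \<Longrightarrow> card S + 2 * M < 2 * card (nb T \<inter> S)"
  using assms by (simp_all add: expands_def)

text \<open>Walks with prescribed layers, repetitions allowed: this makes \<open>reach\<close>
  additive in the starting set, which halving needs. Disjoint layers later turn the walks into
  paths.\<close>

fun reach :: "(nat \<Rightarrow> 'a set) \<Rightarrow> 'a set \<Rightarrow> nat \<Rightarrow> 'a set" where
  "reach D Z 0 = Z"
| "reach D Z (Suc j) = nb (reach D Z j) \<inter> D j"

lemma reach_Un: "reach D (Y \<union> Z) j = reach D Y j \<union> reach D Z j"
  by (induction j) (auto simp: nb_def)

lemma reach_subset: "Z \<subseteq> V \<Longrightarrow> reach D Z j \<subseteq> V"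
  using nb_subset by (cases j) auto

lemma reach_path:
  "v \<in> reach D {x} j \<Longrightarrow>
    \<exists>p. length p = j \<and> (\<forall>i<j. p ! i \<in> D i) \<and> successively adj (x # p) \<and> last (x # p) = v"
proof (induction j arbitrary: v)
  case (Suc j)
  then obtain u where u: "u \<in> reach D {x} j" "adj u v" "v \<in> D j"
    by (auto simp: nb_def)
  from Suc.IH[OF u(1)] obtain p where p: "length p = j" "\<forall>i<j. p ! i \<in> D i"
    "successively adj (x # p)" "last (x # p) = u" by blast
  have "successively adj ((x # p) @ [v])"
    using p u by (subst successively_append_iff) auto
  moreover have "\<forall>i<Suc j. (p @ [v]) ! i \<in> D i"
    using p(1,2) u(3) by (auto simp: nth_append less_Suc_eq)
  ultimately show ?case using p(1) by (intro exI[of _ "p @ [v]"]) auto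
qed auto

text \<open>Halving the starting set at every step costs less than the expansion gains, so after
  logarithmically many steps a single starting vertex reaches many vertices.\<close>

lemma reach_growth:
  assumes X: "X \<subseteq> V" and z0: "1 \<le> z0" "z0 \<le> card X" "z0 \<le> M"
    and grow: "\<And>j T. j < h \<Longrightarrow> T \<subseteq> V \<Longrightarrow> z0 \<le> card T \<Longrightarrow> card T \<le> M \<Longrightarrow>
                 4 * card T \<le> card (nb T \<inter> D j)"
  shows "j \<le> h \<Longrightarrow>
    \<exists>Z\<subseteq>X. Z \<noteq> {} \<and> (card Z - 1) * 2 ^ j < card X \<and> min M (z0 * 2 ^ j) \<le> card (reach D Z j)"
proof (induction j)
  case 0
  have "X \<noteq> {}" using z0 by auto
  then show ?case using z0 by (intro exI[of _ X]) auto
next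
  case (Suc j)
  then obtain Z where Z: "Z \<subseteq> X" "Z \<noteq> {}" "(card Z - 1) * 2 ^ j < card X"
    "min M (z0 * 2 ^ j) \<le> card (reach D Z j)" by auto
  have finZ: "finite Z" using Z(1) X fin by (meson finite_subset)
  obtain T where T: "T \<subseteq> reach D Z j" "card T = min M (z0 * 2 ^ j)"
    using Z(4) by (meson obtain_subset_with_card_n)
  have TV: "T \<subseteq> V" using T(1) reach_subset[of Z] Z(1) X by blast
  have "z0 \<le> z0 * 2 ^ j" by simp
  then have big: "4 * card T \<le> card (nb T \<inter> D j)"
    using grow[of j T] Suc.prems TV T(2) z0 by simp
  have T_ge: "min M (z0 * 2 ^ Suc j) \<le> 2 * card T"
    using T(2) by simp
  have nbT: "nb T \<inter> D j \<subseteq> reach D Z (Suc j)"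
    using nb_mono[OF T(1)] by auto
  have frs: "finite (reach D Y (Suc j))" for Y by simp
  obtain Z1 where Z1: "Z1 \<subseteq> Z" "card Z1 = card Z div 2"
    by (meson obtain_subset_with_card_n div_le_dividend)
  define Z2 where "Z2 = Z - Z1"
  have card2: "card Z2 = card Z - card Z div 2"
    using Z1 finZ by (simp add: Z2_def card_Diff_subset finite_subset)
  have un: "reach D Z (Suc j) = reach D Z1 (Suc j) \<union> reach D Z2 (Suc j)"
    using Z1(1) by (subst reach_Un[symmetric]) (simp add: Z2_def Un_absorb1)
  have "4 * card T \<le> card (reach D Z (Suc j))"
    using big card_mono[OF frs nbT] by linarith
  also have "\<dots> \<le> card (reach D Z1 (Suc j)) + card (reach D Z2 (Suc j))"
    unfolding un by (rule card_Un_le)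
  finally consider "2 * card T \<le> card (reach D Z1 (Suc j))" | "2 * card T \<le> card (reach D Z2 (Suc j))"
    by linarith
  \<comment> \<open>Subtracting one absorbs the rounding: even the larger half \<open>Y\<close> of
    \<open>Z\<close> satisfies \<open>2 * (card Y - 1) \<le> card Z - 1\<close>, so \<open>h\<close>
    halvings of at most \<open>2 ^ h\<close> vertices end at a single one.\<close>
  then obtain Y where Y: "Y \<subseteq> Z" "2 * card T \<le> card (reach D Y (Suc j))" "2 * (card Y - 1) \<le> card Z - 1"
  proof cases
    case 1
    then show ?thesis using that[of Z1] Z1 by auto
  next
    case 2
    then show ?thesis using that[of Z2] card2 by (auto simp: Z2_def)
  qed
  have rem: "reach D {} i = {}" for i by (induction i) (auto simp: nb_def)
  have "1 \<le> card T" using T(2) z0 by simp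
  then have "Y \<noteq> {}" using Y(2) rem[of "Suc j"] by (cases "Y = {}") auto
  moreover have "(card Y - 1) * 2 ^ Suc j \<le> (card Z - 1) * 2 ^ j"
    using mult_right_mono[OF Y(3), of "2 ^ j"] by (simp add: ac_simps)
  ultimately show ?case
    by (intro exI[of _ Y] conjI order.trans[OF Y(1) Z(1)] le_less_trans[OF _ Z(3)]
        order.trans[OF T_ge Y(2)])
qed

lemma reach_half:
  assumes X: "X \<subseteq> V" and z0: "1 \<le> z0" "z0 \<le> card X" "z0 \<le> M" and h: "card X \<le> 2 ^ h" "M \<le> 2 ^ h"
    and grow: "\<And>j T. j < h \<Longrightarrow> T \<subseteq> V \<Longrightarrow> z0 \<le> card T \<Longrightarrow> card T \<le> M \<Longrightarrow>
                 4 * card T \<le> card (nb T \<inter> D j)"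
    and half: "\<And>T. T \<subseteq> V \<Longrightarrow> M \<le> card T \<Longrightarrow> s < 2 * card (nb T \<inter> D h)"
  shows "\<exists>x\<in>X. s < 2 * card (reach D {x} (Suc h))"
proof -
  have "\<exists>Z\<subseteq>X. Z \<noteq> {} \<and> (card Z - 1) * 2 ^ h < card X \<and> min M (z0 * 2 ^ h) \<le> card (reach D Z h)"
    by (rule reach_growth[where h = h]) (use X z0 grow in blast)+
  then obtain Z where Z: "Z \<subseteq> X" "Z \<noteq> {}"
    "(card Z - 1) * 2 ^ h < card X" "min M (z0 * 2 ^ h) \<le> card (reach D Z h)" by blast
  have "(card Z - 1) * 2 ^ h < 2 ^ h" by (rule less_le_trans[OF Z(3) h(1)])
  then have "card Z - 1 < 1" by (metis mult_less_cancel2 mult_1)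
  moreover have "card Z \<noteq> 0" using Z X fin by (meson card_0_eq finite_subset)
  ultimately have "card Z = 1" by simp
  then obtain x where x: "Z = {x}" by (meson card_1_singletonE)
  have "1 * 2 ^ h \<le> z0 * 2 ^ h" using z0(1) by (intro mult_right_mono) auto
  then have "M \<le> z0 * 2 ^ h" using h(2) by linarith
  then have "M \<le> card (reach D {x} h)" using Z(4) x by simp
  then have "s < 2 * card (reach D {x} (Suc h))"
    using half[of "reach D {x} h"] reach_subset[of "{x}" D h] Z(1) x X by auto
  then show ?thesis using Z(1) x by blast
qed

text \<open>The \<open>j\<close>-th inner vertex is confined to the \<open>j\<close>-th layer, so
  disjointness of the paths need only be asked level by level.\<close>

definition linked :: "(nat \<Rightarrow> 'a set) \<Rightarrow> nat \<Rightarrow> 'i set \<Rightarrow> ('i \<Rightarrow> 'a) \<Rightarrow> ('i \<Rightarrow> 'a) \<Rightarrow> ('i \<Rightarrow> 'a list) \<Rightarrow> bool" where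
  "linked S L J x y P \<longleftrightarrow>
     (\<forall>i\<in>J. length (P i) = L \<and> (\<forall>j<L. P i ! j \<in> S j) \<and> successively adj (x i # P i @ [y i])) \<and>
     (\<forall>i\<in>J. \<forall>i'\<in>J. i \<noteq> i' \<longrightarrow> (\<forall>j<L. P i ! j \<noteq> P i' ! j))"

text \<open>\<open>B\<close> collects the vertices already used. Among any \<open>z0\<close>
  starting points \<open>reach_half\<close> finds one that reaches more than half of the last layer
  while avoiding \<open>B\<close>, so fewer than \<open>z0\<close> points can fail.\<close>

lemma few_bad_starts:
  assumes I: "finite I" and x: "inj_on x I" "x ` I \<subseteq> V" and M: "card I \<le> M"
    and h: "card V \<le> 2 ^ h" "M \<le> card V"
    and S: "\<And>j. j \<le> h \<Longrightarrow> expands M (S j)"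
    and B: "\<And>j. j \<le> h \<Longrightarrow> card (B \<inter> S j) < card I" "finite B"
    and z0: "1 \<le> z0" "card I \<le> 2 * z0" "z0 \<le> M"
  shows "card {i \<in> I. 2 * card (reach (\<lambda>j. S j - B) {x i} (Suc h)) \<le> card (S h)} < z0"
proof (rule ccontr)
  define K where "K = {i \<in> I. 2 * card (reach (\<lambda>j. S j - B) {x i} (Suc h)) \<le> card (S h)}"
  assume "\<not> card {i \<in> I. 2 * card (reach (\<lambda>j. S j - B) {x i} (Suc h)) \<le> card (S h)} < z0"
  then have K: "z0 \<le> card K" by (simp add: K_def)
  have KI: "K \<subseteq> I" by (auto simp: K_def)
  have card_x: "card (x ` K) = card K"
    using x(1) KI by (meson card_image inj_on_subset)
  have lose: "card (nb T \<inter> S j) \<le> card (nb T \<inter> (S j - B)) + card I" if "j \<le> h" for T j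
  proof -
    have "nb T \<inter> S j \<subseteq> (nb T \<inter> (S j - B)) \<union> (B \<inter> S j)" by auto
    then have "card (nb T \<inter> S j) \<le> card ((nb T \<inter> (S j - B)) \<union> (B \<inter> S j))"
      by (rule card_mono[rotated]) (use B(2) in auto)
    also have "\<dots> \<le> card (nb T \<inter> (S j - B)) + card (B \<inter> S j)" by (rule card_Un_le)
    finally show ?thesis using B(1)[OF that] by linarith
  qed
  have "\<exists>v\<in>x ` K. card (S h) < 2 * card (reach (\<lambda>j. S j - B) {v} (Suc h))"
  proof (rule reach_half)
    show "x ` K \<subseteq> V" using x(2) KI by auto
    show "z0 \<le> card (x ` K)" using K card_x by simp
    show "card (x ` K) \<le> 2 ^ h" using x(2) KI h(1) fin
      by (meson card_mono image_mono order_trans)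
    show "M \<le> 2 ^ h" using h by simp
    \<comment> \<open>Sets with at least \<open>z0\<close> vertices lose at most
      \<open>card I \<le> 2 * z0\<close> neighbours to \<open>B\<close>; this is the gap between the
      factors 6 and 4.\<close>
    fix j T assume "j < h" "T \<subseteq> V" "z0 \<le> card T" "card T \<le> M"
    then show "4 * card T \<le> card (nb T \<inter> (S j - B))"
      using expandsD(1)[OF S[of j], of T] lose[of j T] z0(2) by linarith
  next
    fix T assume "T \<subseteq> V" "M \<le> card T"
    then have "card (S h) + 2 * M < 2 * card (nb T \<inter> S h)" by (rule expandsD(2)[OF S[OF order_refl]])
    then show "card (S h) < 2 * card (nb T \<inter> (S h - B))" using lose[of h T] M by linarith
  qed (use z0 in \<open>simp_all\<close>)
  then show False unfolding K_def by (elim bexE imageE) (simp del: reach.simps)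
qed

text \<open>A largest linked subfamily \<open>J\<close> uses at most \<open>card J\<close> vertices
  of each layer. If it covered less than half of the pairs, the open pairs would outnumber the
  blocked vertices in every layer, and one more pair could be linked.\<close>

lemma link_half:
  fixes x y :: "'i \<Rightarrow> 'a"
  assumes I: "finite I" "card I \<le> M"
    and x: "inj_on x I" "x ` I \<subseteq> V" and y: "inj_on y I" "y ` I \<subseteq> V"
    and h: "card V \<le> 2 ^ h" "M \<le> card V"
    and S: "\<And>j. j < 2 * h + 2 \<Longrightarrow> expands M (S j)"
    and disj: "\<And>i j. i < 2 * h + 2 \<Longrightarrow> j < 2 * h + 2 \<Longrightarrow> i \<noteq> j \<Longrightarrow> S i \<inter> S j = {}"
  shows "\<exists>J P. J \<subseteq> I \<and> card I \<le> 2 * card J \<and> linked S (2 * h + 2) J x y P"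
proof -

  define L where "L = 2 * h + 2"
  define good where "good J \<longleftrightarrow> J \<subseteq> I \<and> (\<exists>P. linked S L J x y P)" for J
  have g0: "good {}" by (auto simp: good_def linked_def)
  have le: "card J \<le> card I" if "good J" for J
    using that card_mono[OF I(1)] by (auto simp: good_def)
  have "\<exists>J. good J \<and> (\<forall>J'. good J' \<longrightarrow> card J' \<le> card J)"
    by (rule ex_has_greatest_nat[of good "{}" card "Suc (card I)"]) (use g0 le in \<open>auto simp: less_Suc_eq_le\<close>)
  then obtain J where J: "good J" and maxJ: "\<And>J'. good J' \<Longrightarrow> card J' \<le> card J"
    by blast
  from J obtain P where P: "linked S L J x y P" and JI: "J \<subseteq> I" by (auto simp: good_def)
  have finJ: "finite J" using JI I(1) finite_subset by blast
  have "card I \<le> 2 * card J"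
  proof (rule ccontr)
    assume "\<not> card I \<le> 2 * card J"
    then have less: "2 * card J < card I" by simp
    define I' where "I' = I - J"
    have card_I': "card I' = card I - card J" using JI finJ by (simp add: I'_def card_Diff_subset)
    have finI': "finite I'" using I(1) by (simp add: I'_def)
    \<comment> \<open>Half of \<open>card I'\<close>, rounded up: fewer than \<open>z0\<close> bad
      starts on each side are together fewer than \<open>card I'\<close>, so some pair is good on
      both sides.\<close>
    define z0 where "z0 = (card I' + 1) div 2"
    have z0: "1 \<le> z0" "card I' \<le> 2 * z0" "z0 \<le> M" "2 * z0 \<le> card I' + 1"
      using less card_I' I(2) by (auto simp: z0_def)
    define B where "B = (\<Union>i\<in>J. set (P i))"
    have finB: "finite B" using finJ by (simp add: B_def)
    have B_le: "card (B \<inter> S j) < card I'" if "j < L" for j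
    proof -
      have "B \<inter> S j \<subseteq> (\<lambda>i. P i ! j) ` J"
      proof
        fix v assume "v \<in> B \<inter> S j"
        then obtain i where i: "i \<in> J" "v \<in> set (P i)" "v \<in> S j" by (auto simp: B_def)
        then obtain j' where j': "j' < L" "v = P i ! j'"
          using P by (auto simp: linked_def in_set_conv_nth)
        then have "v \<in> S j'" using P i(1) by (auto simp: linked_def)
        then have "j' = j" using disj[of j' j] i(3) that j'(1) by (auto simp: L_def)
        then show "v \<in> (\<lambda>i. P i ! j) ` J" using j' i(1) by auto
      qed
      then have "card (B \<inter> S j) \<le> card J"
        using finJ by (meson card_image_le card_mono finite_imageI order_trans)
      then show ?thesis using less card_I' by simp
    qed
    let ?F = "\<lambda>j. S j - B"
    \<comment> \<open>From \<open>x i\<close> the search runs forward through the layers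
      \<open>0\<close> to \<open>h\<close>, from \<open>y i\<close> backward through
      \<open>L - 1\<close> down to \<open>h\<close>. The backward search makes one step more, so
      that both end in layer \<open>h\<close>.\<close>
    let ?S' = "\<lambda>j. S (L - 1 - j)"
    let ?G = "\<lambda>j. ?S' j - B"
    define bx where "bx = {i \<in> I'. 2 * card (reach ?F {x i} (Suc h)) \<le> card (S h)}"
    define bY where "bY = {i \<in> I'. 2 * card (reach ?G {y i} (Suc (Suc h))) \<le> card (?S' (Suc h))}"
    have I'M: "card I' \<le> M" using card_I' I(2) by simp
    have "card bx < z0" unfolding bx_def
    proof (rule few_bad_starts[OF finI' _ _ I'M h])
      show "inj_on x I'" "x ` I' \<subseteq> V" using x by (auto simp: I'_def inj_on_def)
      show "expands M (S j)" "card (B \<inter> S j) < card I'" if "j \<le> h" for j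
        using that S B_le by (simp_all add: L_def)
    qed (use z0 finB in simp_all)
    moreover have "card bY < z0" unfolding bY_def
    proof (rule few_bad_starts[OF finI' _ _ I'M _ h(2)])
      show "inj_on y I'" "y ` I' \<subseteq> V" using y by (auto simp: I'_def inj_on_def)
      show "card V \<le> 2 ^ Suc h" using h(1) by simp
      show "expands M (?S' j)" "card (B \<inter> ?S' j) < card I'" if "j \<le> Suc h" for j
        using that S B_le by (simp_all add: L_def)
    qed (use z0 finB in simp_all)
    ultimately have "card (bx \<union> bY) < card I'"
      using card_Un_le[of bx bY] z0(4) by linarith
    moreover have "card I' \<le> card (bx \<union> bY)" if "I' \<subseteq> bx \<union> bY"
      by (rule card_mono[OF _ that]) (use finI' in \<open>auto simp: bx_def bY_def\<close>)
    ultimately have "\<not> I' \<subseteq> bx \<union> bY" by linarith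
    then obtain i where i: "i \<in> I'" "i \<notin> bx" "i \<notin> bY" by auto
    have idx: "L - 1 - Suc h = h" by (simp add: L_def)
    define RX where "RX = reach ?F {x i} (Suc h)"
    define RY where "RY = reach ?G {y i} (Suc (Suc h))"
    have RX: "card (S h) < 2 * card RX" "RX \<subseteq> S h" using i(1,2) by (auto simp: bx_def RX_def)
    have RY: "card (S h) < 2 * card RY" "RY \<subseteq> S h"
      using i(1,3) idx by (auto simp: bY_def RY_def)
    have "RX \<inter> RY \<noteq> {}"
    proof
      assume e: "RX \<inter> RY = {}"
      have "finite (S h)" using S[of h] finite_subset[OF _ fin] by (auto simp: expands_def)
      then have "card (RX \<union> RY) \<le> card (S h)" using RX(2) RY(2) by (intro card_mono) auto
      moreover have "card (RX \<union> RY) = card RX + card RY"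
        using e by (intro card_Un_disjoint) (auto simp: RX_def RY_def)
      ultimately show False using RX(1) RY(1) by linarith
    qed
    then obtain w where w: "w \<in> RX" "w \<in> RY" by auto
    from reach_path[OF w(1)[unfolded RX_def]] obtain p where p: "length p = Suc h"
      "\<forall>j<Suc h. p ! j \<in> ?F j" "successively adj (x i # p)" "last (x i # p) = w" by blast
    from reach_path[OF w(2)[unfolded RY_def]] obtain q where q: "length q = Suc (Suc h)"
      "\<forall>j<Suc (Suc h). q ! j \<in> ?G j" "successively adj (y i # q)" "last (y i # q) = w" by blast
    \<comment> \<open>The meeting vertex \<open>w\<close> ends both walks and is kept once.\<close>
    define Q where "Q = p @ rev (butlast q)"
    have "q \<noteq> []" using q(1) by auto
    then have "q = butlast q @ [w]" using q(4) append_butlast_last_id[of q] by simp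
    then have "successively adj ((y i # butlast q) @ [w])" using q(3) by simp
    then have "successively adj (rev ((y i # butlast q) @ [w]))" unfolding successively_rev_adj .
    then have s2: "successively adj (w # rev (butlast q) @ [y i])" by simp
    have "p \<noteq> []" using p(1) by auto
    then have pw: "p = butlast p @ [w]" using p(4) append_butlast_last_id[of p] by simp
    have s1: "successively adj (x i # butlast p @ [w])" using p(3) pw by simp
    have sQ: "successively adj (x i # Q @ [y i])"
    proof -
      have "x i # Q @ [y i] = (x i # butlast p) @ (w # rev (butlast q) @ [y i])"
        unfolding Q_def by (subst pw) simp
      moreover have "successively adj ((x i # butlast p) @ (w # rev (butlast q) @ [y i]))"
        using s1[folded append_Cons] s2 unfolding successively_append_iff by simp
      ultimately show ?thesis by simp
    qed
    have lenQ: "length Q = L" using p(1) q(1) by (simp add: Q_def L_def)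
    have Qj: "Q ! j \<in> S j - B" if "j < L" for j
    proof (cases "j < Suc h")
      case True
      then show ?thesis using p(1,2) by (auto simp: Q_def nth_append)
    next
      case False
      have lb: "length (butlast q) = Suc h" using q(1) by simp
      have "Q ! j = rev (butlast q) ! (j - Suc h)" using False p(1) by (simp add: Q_def nth_append)
      also have "\<dots> = butlast q ! (Suc h - Suc (j - Suc h))"
        using lb that False by (subst rev_nth) (auto simp: L_def)
      also have "\<dots> = q ! (Suc h - Suc (j - Suc h))"
        using lb that False by (intro nth_butlast) (auto simp: L_def)
      also have "Suc h - Suc (j - Suc h) = L - 1 - j"
        using that False by (auto simp: L_def)
      finally have "Q ! j = q ! (L - 1 - j)" .
      moreover have "L - 1 - j < Suc (Suc h)" using False by (auto simp: L_def)
      moreover have "L - 1 - (L - 1 - j) = j" using that by simp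
      ultimately show ?thesis using q(2)[rule_format, of "L - 1 - j"] by simp
    qed
    have iJ: "i \<notin> J" "i \<in> I" using i(1) by (auto simp: I'_def)
    have notB: "P i' ! j \<in> B" if "i' \<in> J" "j < L" for i' j
      using that P unfolding B_def linked_def by (metis UN_I nth_mem)
    have "linked S L (insert i J) x y (P(i := Q))"
    proof -
      have "(P(i := Q)) i' ! j \<noteq> (P(i := Q)) i'' ! j"
        if a: "i' \<in> insert i J" "i'' \<in> insert i J" "i' \<noteq> i''" "j < L" for i' i'' j
      proof -
        consider "i' = i" "i'' \<in> J" | "i'' = i" "i' \<in> J" | "i' \<in> J" "i'' \<in> J" "i' \<noteq> i" "i'' \<noteq> i"
          using a iJ(1) by auto
        then show ?thesis
        proof cases
          case 1
          then show ?thesis using Qj[OF a(4)] notB[of i'' j] a by auto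
        next
          case 2
          then show ?thesis using Qj[OF a(4)] notB[of i' j] a by auto
        next
          case 3
          then show ?thesis using P a by (auto simp: linked_def)
        qed
      qed
      moreover have "length ((P(i := Q)) i') = L \<and> (\<forall>j<L. (P(i := Q)) i' ! j \<in> S j) \<and>
          successively adj (x i' # (P(i := Q)) i' @ [y i'])" if "i' \<in> insert i J" for i'
        using that P lenQ Qj sQ iJ(1) by (cases "i' = i") (auto simp: linked_def)
      ultimately show ?thesis unfolding linked_def by blast
    qed
    then have "good (insert i J)" using JI iJ(2) by (auto simp: good_def)
    then have "card (insert i J) \<le> card J" by (rule maxJ)
    then show False using iJ(1) finJ by simp
  qed
  then show ?thesis using JI P by (auto simp: L_def)
qed

end

lemma distinct_concat_map:
  assumes "distinct us" "\<And>u. u \<in> set us \<Longrightarrow> distinct (P u)"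
    and "\<And>u u'. u \<in> set us \<Longrightarrow> u' \<in> set us \<Longrightarrow> u \<noteq> u' \<Longrightarrow> set (P u) \<inter> set (P u') = {}"
  shows "distinct (concat (map P us))"
  using assms
proof (induction us)
  case (Cons a us)
  have "distinct (concat (map P us))" by (rule Cons.IH) (use Cons.prems in auto)
  moreover have "set (P a) \<inter> set (P u) = {}" if "u \<in> set us" for u
    by (rule Cons.prems(3)) (use that Cons.prems(1) in auto)
  ultimately show ?case using Cons.prems(2)[of a] by auto
qed simp

context fin_graph
begin

definition links :: "'a set \<Rightarrow> nat \<Rightarrow> 'i set \<Rightarrow> ('i \<Rightarrow> 'a) \<Rightarrow> ('i \<Rightarrow> 'a) \<Rightarrow> ('i \<Rightarrow> 'a list) \<Rightarrow> bool" where
  "links R L I x y P \<longleftrightarrow>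
     (\<forall>i\<in>I. length (P i) = L \<and> distinct (P i) \<and> set (P i) \<subseteq> R \<and> successively adj (x i # P i @ [y i])) \<and>
     (\<forall>i\<in>I. \<forall>i'\<in>I. i \<noteq> i' \<longrightarrow> set (P i) \<inter> set (P i') = {})"

lemma linked_links:
  assumes P: "linked S L I x y P"
    and disj: "\<And>i j. i < L \<Longrightarrow> j < L \<Longrightarrow> i \<noteq> j \<Longrightarrow> S i \<inter> S j = {}"
  shows "links (\<Union>j<L. S j) L I x y P"
proof -
  have len: "length (P i) = L" and inS: "j < L \<Longrightarrow> P i ! j \<in> S j" if "i \<in> I" for i j
    using P that by (auto simp: linked_def)
  have eq: "j = j' \<and> i = i'"
    if "i \<in> I" "i' \<in> I" "j < L" "j' < L" "P i ! j = P i' ! j'" for i i' j j'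
  proof -
    have "j = j'" using inS[of i j] inS[of i' j'] disj[of j j'] that by auto
    then show ?thesis using P that unfolding linked_def by blast
  qed
  have "distinct (P i)" if "i \<in> I" for i
    unfolding distinct_conv_nth using eq[OF that that] len[OF that] by blast
  moreover have "set (P i) \<subseteq> (\<Union>j<L. S j)" if "i \<in> I" for i
    using inS[OF that] len[OF that] by (fastforce simp: in_set_conv_nth)
  moreover have "set (P i) \<inter> set (P i') = {}" if "i \<in> I" "i' \<in> I" "i \<noteq> i'" for i i'
    using eq[OF that(1,2)] len[OF that(1)] len[OF that(2)] that(3)
    by (metis disjoint_iff in_set_conv_nth)
  ultimately show ?thesis using P by (auto simp: links_def linked_def)
qed

text \<open>There are \<open>h + 1\<close> rounds \<open>r\<close>, each with its own
  \<open>2 * h + 2\<close> layers. A round links at least half of the pairs still open, and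
  \<open>h + 1\<close> halvings exhaust up to \<open>2 ^ h\<close> pairs.\<close>

definition reservoir :: "nat \<Rightarrow> nat \<Rightarrow> 'a set \<Rightarrow> bool" where
  "reservoir M h R \<longleftrightarrow> (\<exists>S. (\<forall>r\<le>h. \<forall>j<2 * h + 2. S r j \<subseteq> R \<and> expands M (S r j)) \<and>
     (\<forall>r\<le>h. \<forall>j<2 * h + 2. \<forall>r'\<le>h. \<forall>j'<2 * h + 2. (r, j) \<noteq> (r', j') \<longrightarrow> S r j \<inter> S r' j' = {}))"

lemma connect:
  fixes x y :: "'i \<Rightarrow> 'a"
  assumes R: "reservoir M h R" and h: "card V \<le> 2 ^ h" "M \<le> card V"
    and I: "finite I" "card I \<le> M"
    and x: "inj_on x I" "x ` I \<subseteq> V" and y: "inj_on y I" "y ` I \<subseteq> V"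
  shows "\<exists>P. links R (2 * h + 2) I x y P"
proof -
  define L where "L = 2 * h + 2"
  from R obtain S where S0: "\<forall>r\<le>h. \<forall>j<L. S r j \<subseteq> R \<and> expands M (S r j)"
    "\<forall>r\<le>h. \<forall>j<L. \<forall>r'\<le>h. \<forall>j'<L. (r, j) \<noteq> (r', j') \<longrightarrow> S r j \<inter> S r' j' = {}"
    unfolding reservoir_def L_def by (elim exE conjE)
  have S: "S r j \<subseteq> R" "expands M (S r j)" if "r \<le> h" "j < L" for r j
    using S0(1) that by simp_all
  have disj: "S r j \<inter> S r' j' = {}"
    if "r \<le> h" "j < L" "r' \<le> h" "j' < L" "(r, j) \<noteq> (r', j')" for r j r' j'
    using S0(2)[rule_format, OF that] .
  \<comment> \<open>Induction on the number \<open>n\<close> of available rounds: round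
    \<open>n\<close> links at least half of fewer than \<open>2 ^ Suc n\<close> pairs and leaves
    fewer than \<open>2 ^ n\<close> to the earlier rounds.\<close>
  have "\<exists>P. links (\<Union>r<n. \<Union>j<L. S r j) L I x y P"
    if "n \<le> Suc h" "card I < 2 ^ n" "finite I" "card I \<le> M"
      "inj_on x I" "x ` I \<subseteq> V" "inj_on y I" "y ` I \<subseteq> V" for n and I :: "'i set"
    using that
  proof (induction n arbitrary: I)
    case 0
    then show ?case by (auto simp: links_def)
  next
    case (Suc n)
    have nh: "n \<le> h" using Suc.prems(1) by simp
    have "\<exists>J P. J \<subseteq> I \<and> card I \<le> 2 * card J \<and> linked (S n) (2 * h + 2) J x y P"
    proof (rule link_half)
      show "expands M (S n j)" if "j < 2 * h + 2" for j using S(2) nh that by (simp add: L_def)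
      show "S n i \<inter> S n j = {}" if "i < 2 * h + 2" "j < 2 * h + 2" "i \<noteq> j" for i j
        using disj[of n i n j] nh that by (simp add: L_def)
    qed (use Suc.prems h in auto)
    then obtain J P where J: "J \<subseteq> I" "card I \<le> 2 * card J" "linked (S n) L J x y P"
      by (auto simp: L_def)
    have "links (\<Union>j<L. S n j) L J x y P"
      by (rule linked_links[OF J(3)]) (use disj[of n _ n] nh in auto)
    note P = this
    have finJ: "finite J" using J(1) Suc.prems(3) finite_subset by blast
    have cIJ: "card (I - J) = card I - card J" using J(1) finJ by (simp add: card_Diff_subset)
    have "\<exists>P. links (\<Union>r<n. \<Union>j<L. S r j) L (I - J) x y P"
    proof (rule Suc.IH)
      show "inj_on x (I - J)" "inj_on y (I - J)" using Suc.prems by (auto simp: inj_on_def)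
    qed (use Suc.prems J(2) cIJ in auto)
    then obtain P' where P': "links (\<Union>r<n. \<Union>j<L. S r j) L (I - J) x y P'" by blast
    have dd: "(\<Union>j<L. S n j) \<inter> (\<Union>r<n. \<Union>j<L. S r j) = {}"
    proof -
      have "S n j \<inter> S r j' = {}" if "j < L" "r < n" "j' < L" for j r j'
        using disj[of n j r j'] nh that by auto
      then show ?thesis by blast
    qed
    let ?Q = "\<lambda>i. if i \<in> J then P i else P' i"
    have "links (\<Union>r<Suc n. \<Union>j<L. S r j) L I x y ?Q"
      unfolding links_def
    proof (intro conjI ballI impI)
      fix i assume i: "i \<in> I"
      show "length (?Q i) = L" "distinct (?Q i)" "successively adj (x i # ?Q i @ [y i])"
        using i P P' by (cases "i \<in> J"; auto simp: links_def)+
      show "set (?Q i) \<subseteq> (\<Union>r<Suc n. \<Union>j<L. S r j)"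
        using i P P' unfolding lessThan_Suc by (cases "i \<in> J") (auto simp: links_def)
    next
      fix i i' assume i: "i \<in> I" "i' \<in> I" "i \<noteq> i'"
      have a: "set (P i) \<subseteq> (\<Union>j<L. S n j)" if "i \<in> J" for i using P that by (auto simp: links_def)
      have b: "set (P' i) \<subseteq> (\<Union>r<n. \<Union>j<L. S r j)" if "i \<in> I" "i \<notin> J" for i
        using P' that by (auto simp: links_def)
      consider "i \<in> J" "i' \<in> J" | "i \<in> J" "i' \<notin> J" | "i \<notin> J" "i' \<in> J" | "i \<notin> J" "i' \<notin> J" by blast
      then show "set (?Q i) \<inter> set (?Q i') = {}"
      proof cases
        case 1
        then show ?thesis using P i by (simp add: links_def)
      next
        case 2
        then show ?thesis using a[of i] b[of i'] dd i by simp blast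
      next
        case 3
        then show ?thesis using a[of i'] b[of i] dd i by simp blast
      next
        case 4
        then show ?thesis using P' i by (simp add: links_def)
      qed
    qed
    then show ?case by blast
  qed
  note * = this
  have "card I \<le> 2 ^ h" using I(2) h by linarith
  also have "(2::nat) ^ h < 2 ^ Suc h" by simp
  finally have "card I < 2 ^ Suc h" .
  then obtain P where P: "links (\<Union>r<Suc h. \<Union>j<L. S r j) L I x y P"
    using *[of "Suc h" I] I x y by blast
  have "(\<Union>r<Suc h. \<Union>j<L. S r j) \<subseteq> R" using S(1) unfolding lessThan_Suc_atMost by blast
  then have "links R L I x y P" using P unfolding links_def by blast
  then show ?thesis by (auto simp: L_def)
qed

lemma successively_append_last:
  "p \<noteq> [] \<Longrightarrow> successively adj p \<Longrightarrow> successively adj (last p # q) \<Longrightarrow> successively adj (p @ q)"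
  by (cases q) (auto simp: successively_append_iff)

text \<open>The ladder with rails \<open>a\<close>, \<open>b\<close>, closed at one end by \<open>v\<close> and at the other by an edge, is an odd
  cycle. Its two near-perfect matchings (with and without \<open>v\<close>) are each completed by the connectors
  \<open>C i\<close> from \<open>b i\<close> to \<open>a (i + 1)\<close> to a single path from \<open>a 0\<close> to the last vertex of \<open>b\<close>.\<close>

lemma ladder_absorber:
  fixes a b :: "nat \<Rightarrow> 'a" and C :: "nat \<Rightarrow> 'a list"
  assumes g: "1 \<le> g"
    and a: "\<And>i. Suc i < 2 * g \<Longrightarrow> adj (a i) (a (Suc i))"
    and b: "\<And>i. Suc i < 2 * g \<Longrightarrow> adj (b i) (b (Suc i))"
    and ab: "adj (a (2 * g - 1)) (b (2 * g - 1))"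
    and v: "adj (a 0) v" "adj v (b 0)"
    and C: "\<And>i. Suc i < 2 * g \<Longrightarrow> successively adj (b i # C i @ [a (Suc i)])"
  defines "W \<equiv> mset (map a [0..<2 * g]) + mset (map b [0..<2 * g]) + mset (concat (map C [0..<2 * g - 1]))"
  shows "\<exists>p. p \<noteq> [] \<and> successively adj p \<and> hd p = a 0 \<and> last p = b (2 * g - 1) \<and> mset p = W"
    and "\<exists>p. p \<noteq> [] \<and> successively adj p \<and> hd p = a 0 \<and> last p = b (2 * g - 1) \<and> mset p = add_mset v W"
proof -
  \<comment> \<open>\<open>M n\<close> is what a path on the rungs \<open>0\<close> to
    \<open>n\<close> has to cover, including the connectors between them.\<close>
  define M where "M n = mset (map a [0..<Suc n]) + mset (map b [0..<Suc n]) + mset (concat (map C [0..<n]))" for n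
  have W: "W = M (2 * g - 1)" using g by (simp add: W_def M_def)
  have Cr: "successively adj (a (Suc i) # rev (C i) @ [b i])" if "Suc i < 2 * g" for i
    using C[OF that] successively_rev_adj[of "b i # C i @ [a (Suc i)]"] by simp
  \<comment> \<open>Two rungs at a time: connector \<open>C i\<close>, an edge of rail
    \<open>a\<close>, connector \<open>C (i + 1)\<close> backwards, an edge of rail
    \<open>b\<close>. \<open>X\<close> is \<open>{#}\<close> or \<open>{#v#}\<close>, so that both
    matchings share this step.\<close>
  have step: "\<exists>p'. p' \<noteq> [] \<and> successively adj p' \<and> hd p' = a 0 \<and> last p' = b (Suc (Suc i)) \<and>
      mset p' = X + M (Suc (Suc i))"
    if p: "p \<noteq> []" "successively adj p" "hd p = a 0" "last p = b i" "mset p = X + M i" and i: "Suc (Suc i) < 2 * g"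
    for p i X
  proof -
    let ?p = "((((p @ (C i @ [a (Suc i)])) @ [a (Suc (Suc i))]) @ (rev (C (Suc i)) @ [b (Suc i)])) @ [b (Suc (Suc i))])"
    have "successively adj ?p"
      using p C[of i] Cr[of "Suc i"] a[of "Suc i"] b[of "Suc i"] i by (intro successively_append_last) auto
    moreover have "mset ?p = X + M (Suc (Suc i))" using p(5) by (simp add: M_def)
    ultimately show ?thesis using p by (intro exI[of _ ?p]) auto
  qed
  have iter: "\<exists>p. p \<noteq> [] \<and> successively adj p \<and> hd p = a 0 \<and> last p = b (i + 2 * n) \<and> mset p = X + M (i + 2 * n)"
    if "i + 2 * n < 2 * g" "\<exists>p. p \<noteq> [] \<and> successively adj p \<and> hd p = a 0 \<and> last p = b i \<and> mset p = X + M i"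
    for i n X
    using that(1)
  proof (induction n)
    case 0
    then show ?case using that(2) by simp
  next
    case (Suc n)
    then obtain p where "p \<noteq> []" "successively adj p" "hd p = a 0" "last p = b (i + 2 * n)" "mset p = X + M (i + 2 * n)"
      by auto
    from step[OF this] show ?case using Suc.prems by simp
  qed
  \<comment> \<open>Without \<open>v\<close> the path begins with the rungs \<open>0\<close> and
    \<open>1\<close>, and the double steps run through odd indices up to
    \<open>2 * g - 1\<close>.\<close>
  have "\<exists>p. p \<noteq> [] \<and> successively adj p \<and> hd p = a 0 \<and> last p = b 1 \<and> mset p = {#} + M 1"
  proof -
    let ?p = "(([a 0] @ [a 1]) @ (rev (C 0) @ [b 0])) @ [b 1]"
    have "successively adj ?p"
      using a[of 0] b[of 0] Cr[of 0] g by (intro successively_append_last) auto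
    moreover have "mset ?p = {#} + M 1" by (simp add: M_def upt_rec)
    ultimately show ?thesis by (intro exI[of _ ?p]) auto
  qed
  moreover have e: "1 + 2 * (g - 1) = 2 * g - 1" "1 + 2 * (g - 1) < 2 * g" using g by auto
  ultimately show "\<exists>p. p \<noteq> [] \<and> successively adj p \<and> hd p = a 0 \<and> last p = b (2 * g - 1) \<and> mset p = W"
    using iter[of 1 "g - 1" "{#}"] unfolding e(1) W by simp
  \<comment> \<open>With \<open>v\<close> it begins \<open>a 0\<close>, \<open>v\<close>,
    \<open>b 0\<close> and runs through even indices; the last rung is then crossed by its own edge
    \<open>ab\<close>.\<close>
  have "\<exists>p. p \<noteq> [] \<and> successively adj p \<and> hd p = a 0 \<and> last p = b 0 \<and> mset p = {#v#} + M 0"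
    using v by (intro exI[of _ "[a 0, v, b 0]"]) (auto simp: M_def)
  from iter[OF _ this, of "g - 1"] obtain p where p: "p \<noteq> []" "successively adj p" "hd p = a 0"
    "last p = b (2 * (g - 1))" "mset p = {#v#} + M (2 * (g - 1))" using g by auto
  define i where "i = 2 * (g - 1)"
  have i: "Suc i < 2 * g" "2 * g - 1 = Suc i" using g by (auto simp: i_def)
  let ?p = "(p @ (C i @ [a (Suc i)])) @ [b (Suc i)]"
  have "successively adj ?p"
    using p(1,2,4) C[OF i(1)] ab i unfolding i_def[symmetric] by (intro successively_append_last) auto
  moreover have "mset ?p = add_mset v (M (Suc i))" using p(5) unfolding i_def[symmetric] by (simp add: M_def)
  ultimately show "\<exists>p. p \<noteq> [] \<and> successively adj p \<and> hd p = a 0 \<and> last p = b (2 * g - 1) \<and> mset p = add_mset v W"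
    using p(1,3) unfolding W i(2) by (intro exI[of _ ?p]) auto
qed

lemma successively_concat_chain:
  fixes B E :: "nat \<Rightarrow> 'a list"
  assumes "\<And>i. i \<le> n \<Longrightarrow> B i \<noteq> [] \<and> successively adj (B i)"
    and "\<And>i. i < n \<Longrightarrow> successively adj (last (B i) # E i @ [hd (B (Suc i))])"
  shows "successively adj (concat (map (\<lambda>i. B i @ E i) [0..<n]) @ B n) \<and>
    hd (concat (map (\<lambda>i. B i @ E i) [0..<n]) @ B n) = hd (B 0)"
  using assms
proof (induction n)
  case (Suc n)
  let ?c = "concat (map (\<lambda>i. B i @ E i) [0..<n]) @ B n"
  have IH: "successively adj ?c" "hd ?c = hd (B 0)" using Suc by auto
  have ne: "B n \<noteq> []" "B (Suc n) \<noteq> []" using Suc.prems(1) by auto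
  have lc: "?c \<noteq> []" "last ?c = last (B n)" using ne by auto
  have "successively adj (?c @ (E n @ [hd (B (Suc n))]))"
    by (rule successively_append_last[OF lc(1) IH(1)]) (use lc Suc.prems(2)[of n] in simp)
  then have "successively adj ((?c @ (E n @ [hd (B (Suc n))])) @ tl (B (Suc n)))"
    by (rule successively_append_last[rotated]) (use ne Suc.prems(1)[of "Suc n"] in simp_all)
  moreover have "[hd (B (Suc n))] @ tl (B (Suc n)) = B (Suc n)" using ne by simp
  ultimately have "successively adj (?c @ E n @ B (Suc n))" by (metis append.assoc)
  moreover have "hd (?c @ E n @ B (Suc n)) = hd (B 0)" using IH(2) lc(1) by (metis hd_append2)
  ultimately show ?case by simp
qed auto

end

section \<open>Covering a vertex set by few paths\<close>

lemma pad_disjoint_sets: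
  fixes W :: "nat \<Rightarrow> 'a set"
  assumes U: "finite U" "k * q \<le> card U" and W: "\<And>i. i < k \<Longrightarrow> W i \<subseteq> U" "\<And>i. i < k \<Longrightarrow> card (W i) \<le> q"
    and disj: "\<And>i j. i < k \<Longrightarrow> j < k \<Longrightarrow> i \<noteq> j \<Longrightarrow> W i \<inter> W j = {}"
  shows "\<exists>X. (\<forall>i<k. W i \<subseteq> X i \<and> X i \<subseteq> U \<and> card (X i) = q) \<and> (\<forall>i<k. \<forall>j<k. i \<noteq> j \<longrightarrow> X i \<inter> X j = {})"
proof -
  have "\<exists>X. (\<forall>i<n. W i \<subseteq> X i \<and> X i \<subseteq> U \<and> card (X i) = q) \<and>
      (\<forall>i<n. \<forall>j<n. i \<noteq> j \<longrightarrow> X i \<inter> X j = {}) \<and> (\<forall>i<n. \<forall>j. n \<le> j \<and> j < k \<longrightarrow> X i \<inter> W j = {})" if "n \<le> k" for n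
    using that
  proof (induction n)
    case 0
    then show ?case by simp
  next
    case (Suc n)
    then obtain X where X: "\<forall>i<n. W i \<subseteq> X i \<and> X i \<subseteq> U \<and> card (X i) = q"
      "\<forall>i<n. \<forall>j<n. i \<noteq> j \<longrightarrow> X i \<inter> X j = {}" "\<forall>i<n. \<forall>j. n \<le> j \<and> j < k \<longrightarrow> X i \<inter> W j = {}" by auto
    have nk: "n < k" using Suc.prems by simp
    \<comment> \<open>Greedy padding: the sets already padded and the \<open>W i\<close> still to
      come occupy at most \<open>(k - 1) * q\<close> vertices, so \<open>q\<close> are left for the
      current set.\<close>
    define A where "A = (\<Union>i<n. X i)"
    define B where "B = (\<Union>i\<in>{Suc n..<k}. W i)"
    have "card A \<le> (\<Sum>i<n. card (X i))" unfolding A_def by (rule card_UN_le) simp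
    also have "\<dots> = n * q" using X(1) by simp
    finally have cA: "card A \<le> n * q" .
    have "card B \<le> (\<Sum>i\<in>{Suc n..<k}. card (W i))" unfolding B_def by (rule card_UN_le) simp
    also have "\<dots> \<le> (\<Sum>i\<in>{Suc n..<k}. q)" by (rule sum_mono) (use W(2) in auto)
    finally have cB: "card B \<le> (k - Suc n) * q" by simp
    have "A \<union> B \<subseteq> U" using X(1) W(1) by (fastforce simp: A_def B_def)
    then have fAB: "finite (A \<union> B)" using U(1) finite_subset by blast
    have "card (A \<union> B) \<le> n * q + (k - Suc n) * q" using card_Un_le[of A B] cA cB by linarith
    also have "\<dots> = (k - 1) * q" using nk by (simp add: add_mult_distrib[symmetric])
    finally have "card (A \<union> B) \<le> (k - 1) * q" .
    moreover have "(k - 1) * q + q = k * q" using nk by (cases k) auto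
    ultimately have "card (A \<union> B) + q \<le> k * q" by linarith
    then have big: "q \<le> card (U - (A \<union> B))"
      using U(2) diff_card_le_card_Diff[OF fAB, of U] by linarith
    have "W n \<inter> W i = {}" if "i \<in> {Suc n..<k}" for i using disj[of n i] nk that by auto
    moreover have "W n \<inter> X i = {}" if "i < n" for i using X(3) that nk by blast
    ultimately have "W n \<inter> (A \<union> B) = {}" unfolding A_def B_def by blast
    then have "W n \<subseteq> U - (A \<union> B)" using W(1)[OF nk] by auto
    from exists_subset_between[OF W(2)[OF nk] big this] U(1)
    obtain Y where Y: "W n \<subseteq> Y" "Y \<subseteq> U - (A \<union> B)" "card Y = q" by auto
    have YX: "Y \<inter> X i = {}" if "i < n" for i using Y(2) that by (auto simp: A_def)
    have YW: "Y \<inter> W j = {}" if "Suc n \<le> j" "j < k" for j using Y(2) that by (auto simp: B_def)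
    show ?case
      by (rule exI[of _ "X(n := Y)"])
        (use X Y YX YW in \<open>auto simp: less_Suc_eq Int_commute\<close>)
  qed
  from this[of k] show ?thesis by auto
qed

context fin_graph
begin

text \<open>A set \<open>T\<close> violating Hall's condition must have at least \<open>M\<close>
  elements, hence sees half of \<open>B\<close> and is larger than \<open>q / 2\<close>. The unseen
  part of \<open>B\<close> has its neighbours in \<open>A - T\<close> only, fewer than its own size,
  so it also has at least \<open>M\<close> elements and sees half of \<open>A\<close>. Then
  \<open>A - T\<close> has at least \<open>q / 2\<close> elements, a contradiction.\<close>

lemma balanced_matching:
  assumes A: "A \<subseteq> V" "card A = q" and B: "B \<subseteq> V" "card B = q"
    and sA: "\<And>T. T \<subseteq> V \<Longrightarrow> card T \<le> M \<Longrightarrow> card T \<le> card (nb T \<inter> A)"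
    and lA: "\<And>T. T \<subseteq> V \<Longrightarrow> M \<le> card T \<Longrightarrow> q \<le> 2 * card (nb T \<inter> A)"
    and sB: "\<And>T. T \<subseteq> V \<Longrightarrow> card T \<le> M \<Longrightarrow> card T \<le> card (nb T \<inter> B)"
    and lB: "\<And>T. T \<subseteq> V \<Longrightarrow> M \<le> card T \<Longrightarrow> q \<le> 2 * card (nb T \<inter> B)"
  shows "\<exists>f. bij_betw f A B \<and> (\<forall>u\<in>A. adj u (f u))"
proof -
  have finA: "finite A" and finB: "finite B" using A B fin finite_subset by auto
  have hall: "card T \<le> card (nb T \<inter> B)" if T: "T \<subseteq> A" for T
  proof (rule ccontr)
    assume "\<not> card T \<le> card (nb T \<inter> B)"
    then have less: "card (nb T \<inter> B) < card T" by simp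
    have TV: "T \<subseteq> V" using T A by auto
    have Tq: "card T \<le> q" using T A finA card_mono by blast
    have MT: "M \<le> card T" using sB[OF TV] less by linarith
    then have T2: "q < 2 * card T" using lB[OF TV] less by linarith
    define Y where "Y = B - nb T"
    have YV: "Y \<subseteq> V" using B by (auto simp: Y_def)
    have cY: "card Y = q - card (nb T \<inter> B)"
      unfolding Y_def using B finB by (metis card_Diff_subset_Int finite_Int Int_commute)
    have nY: "nb Y \<inter> A \<subseteq> A - T" using sym by (auto simp: Y_def nb_def)
    have "card (nb Y \<inter> A) \<le> card (A - T)" by (rule card_mono) (use finA nY in auto)
    also have "\<dots> = q - card T" using T A finA by (simp add: card_Diff_subset finite_subset)
    finally have cn: "card (nb Y \<inter> A) \<le> q - card T" .
    have "card (nb Y \<inter> A) < card Y" using cn cY less Tq by linarith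
    then have "M \<le> card Y" using sA[OF YV] by linarith
    then have "q \<le> 2 * card (nb Y \<inter> A)" by (rule lA[OF YV])
    then show False using cn T2 Tq by linarith
  qed
  have "\<exists>f. inj_on f A \<and> (\<forall>u\<in>A. f u \<in> nb {u} \<inter> B)"
  proof (rule hall_marriage)
    fix J assume "J \<subseteq> A"
    moreover have "\<Union>((\<lambda>u. nb {u} \<inter> B) ` J) = nb J \<inter> B" by (auto simp: nb_def)
    ultimately show "card J \<le> card (\<Union>((\<lambda>u. nb {u} \<inter> B) ` J))" using hall by simp
  qed (use finA in auto)
  then obtain f where f: "inj_on f A" "\<forall>u\<in>A. f u \<in> nb {u} \<inter> B" by blast
  have "f ` A = B"
    by (rule card_subset_eq) (use finB f A B in \<open>auto simp: card_image\<close>)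
  then show ?thesis using f by (intro exI[of _ f]) (auto simp: bij_betw_def nb_def)
qed

lemma layered_paths:
  assumes U: "\<And>i. i \<le> n \<Longrightarrow> U i \<subseteq> V"
    and disj: "\<And>i j. i \<le> n \<Longrightarrow> j \<le> n \<Longrightarrow> i \<noteq> j \<Longrightarrow> U i \<inter> U j = {}"
    and match: "\<And>i. i < n \<Longrightarrow> \<exists>f. bij_betw f (U i) (U (Suc i)) \<and> (\<forall>u\<in>U i. adj u (f u))"
  shows "\<exists>P. (\<forall>u\<in>U 0. P u \<noteq> [] \<and> successively adj (P u) \<and> distinct (P u)) \<and>
    (\<forall>u\<in>U 0. \<forall>u'\<in>U 0. u \<noteq> u' \<longrightarrow> set (P u) \<inter> set (P u') = {}) \<and>
    (\<Union>u\<in>U 0. set (P u)) = (\<Union>i\<le>n. U i) \<and> bij_betw (\<lambda>u. last (P u)) (U 0) (U n)"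
  using assms
proof (induction n)
  case 0
  show ?case by (rule exI[of _ "\<lambda>u. [u]"]) (auto simp: bij_betw_def)
next
  case (Suc n)
  have "\<exists>P. (\<forall>u\<in>U 0. P u \<noteq> [] \<and> successively adj (P u) \<and> distinct (P u)) \<and>
    (\<forall>u\<in>U 0. \<forall>u'\<in>U 0. u \<noteq> u' \<longrightarrow> set (P u) \<inter> set (P u') = {}) \<and>
    (\<Union>u\<in>U 0. set (P u)) = (\<Union>i\<le>n. U i) \<and> bij_betw (\<lambda>u. last (P u)) (U 0) (U n)"
    by (rule Suc.IH) (use Suc.prems in auto)
  then obtain P where P: "\<And>u. u \<in> U 0 \<Longrightarrow> P u \<noteq> [] \<and> successively adj (P u) \<and> distinct (P u)"
    "\<And>u u'. u \<in> U 0 \<Longrightarrow> u' \<in> U 0 \<Longrightarrow> u \<noteq> u' \<Longrightarrow> set (P u) \<inter> set (P u') = {}"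
    "(\<Union>u\<in>U 0. set (P u)) = (\<Union>i\<le>n. U i)" "bij_betw (\<lambda>u. last (P u)) (U 0) (U n)" by metis
  from Suc.prems(3)[of n] obtain f where f: "bij_betw f (U n) (U (Suc n))" "\<And>u. u \<in> U n \<Longrightarrow> adj u (f u)"
    by auto
  define Q where "Q u = P u @ [f (last (P u))]" for u
  have lastP: "last (P u) \<in> U n" if "u \<in> U 0" for u using P(4) that by (auto simp: bij_betw_def)
  have new: "f (last (P u)) \<in> U (Suc n)" if "u \<in> U 0" for u
    using f(1) lastP[OF that] by (auto simp: bij_betw_def)
  have old: "set (P u) \<inter> U (Suc n) = {}" if "u \<in> U 0" for u
  proof -
    have "set (P u) \<subseteq> (\<Union>i\<le>n. U i)" using P(3) that by blast
    moreover have "U i \<inter> U (Suc n) = {}" if "i \<le> n" for i using Suc.prems(2)[of i "Suc n"] that by simp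
    ultimately show ?thesis by blast
  qed
  have bij: "bij_betw (\<lambda>u. last (Q u)) (U 0) (U (Suc n))"
    using bij_betw_trans[OF P(4) f(1)] by (simp add: Q_def o_def)
  have inj: "f (last (P u)) \<noteq> f (last (P u'))" if "u \<in> U 0" "u' \<in> U 0" "u \<noteq> u'" for u u'
    using bij that by (auto simp: bij_betw_def inj_on_def Q_def)
  have q1: "Q u \<noteq> [] \<and> successively adj (Q u) \<and> distinct (Q u)" if "u \<in> U 0" for u
    using P(1)[OF that] f(2)[OF lastP[OF that]] old[OF that] new[OF that]
    by (auto simp: Q_def successively_append_iff)
  have q2: "set (Q u) \<inter> set (Q u') = {}" if "u \<in> U 0" "u' \<in> U 0" "u \<noteq> u'" for u u'
    using P(2)[OF that] old[OF that(1)] old[OF that(2)] new[OF that(1)] new[OF that(2)] inj[OF that]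
    by (auto simp: Q_def)
  have "(\<Union>u\<in>U 0. set (Q u)) = (\<Union>u\<in>U 0. set (P u)) \<union> (\<lambda>u. last (Q u)) ` U 0"
    by (auto simp: Q_def)
  also have "\<dots> = (\<Union>i\<le>n. U i) \<union> U (Suc n)" using P(3) bij by (simp add: bij_betw_def)
  also have "\<dots> = (\<Union>i\<le>Suc n. U i)" by (auto simp: atMost_Suc)
  finally have q3: "(\<Union>u\<in>U 0. set (Q u)) = (\<Union>i\<le>Suc n. U i)" .
  show ?case using q1 q2 q3 bij by (intro exI[of _ Q] conjI ballI impI) blast+
qed

text \<open>Padding the \<open>W i\<close> to the common size \<open>q\<close> makes perfect
  matchings between consecutive sets possible and keeps all neighbours in \<open>W i\<close>. The
  vertices of \<open>U\<close> outside the padded sets become one-vertex paths.\<close>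

lemma path_cover:
  assumes k: "0 < k" and U: "U \<subseteq> V" "k * q \<le> card U"
    and W: "\<And>i. i < k \<Longrightarrow> W i \<subseteq> U" "\<And>i. i < k \<Longrightarrow> card (W i) \<le> q"
    and disj: "\<And>i j. i < k \<Longrightarrow> j < k \<Longrightarrow> i \<noteq> j \<Longrightarrow> W i \<inter> W j = {}"
    and small: "\<And>T i. T \<subseteq> V \<Longrightarrow> i < k \<Longrightarrow> card T \<le> M \<Longrightarrow> card T \<le> card (nb T \<inter> W i)"
    and large: "\<And>T i. T \<subseteq> V \<Longrightarrow> i < k \<Longrightarrow> M \<le> card T \<Longrightarrow> q \<le> 2 * card (nb T \<inter> W i)"
  shows "\<exists>Ps. length Ps = q + (card U - k * q) \<and> (\<forall>p\<in>set Ps. p \<noteq> [] \<and> successively adj p) \<and>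
    distinct (concat Ps) \<and> set (concat Ps) = U"
proof -
  have finU: "finite U" using U(1) fin finite_subset by blast
  have "\<exists>X. (\<forall>i<k. W i \<subseteq> X i \<and> X i \<subseteq> U \<and> card (X i) = q) \<and> (\<forall>i<k. \<forall>j<k. i \<noteq> j \<longrightarrow> X i \<inter> X j = {})"
    by (rule pad_disjoint_sets) (use finU U W disj in auto)
  then obtain X where X: "\<And>i. i < k \<Longrightarrow> W i \<subseteq> X i \<and> X i \<subseteq> U \<and> card (X i) = q"
    "\<And>i j. i < k \<Longrightarrow> j < k \<Longrightarrow> i \<noteq> j \<Longrightarrow> X i \<inter> X j = {}" by metis
  have mono: "card (nb T \<inter> W i) \<le> card (nb T \<inter> X i)" if "i < k" for T i
    by (rule card_mono) (use X(1)[OF that] in auto)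
  obtain n where n: "k = Suc n" using k by (cases k) auto
  have "\<exists>P. (\<forall>u\<in>X 0. P u \<noteq> [] \<and> successively adj (P u) \<and> distinct (P u)) \<and>
    (\<forall>u\<in>X 0. \<forall>u'\<in>X 0. u \<noteq> u' \<longrightarrow> set (P u) \<inter> set (P u') = {}) \<and>
    (\<Union>u\<in>X 0. set (P u)) = (\<Union>i\<le>n. X i) \<and> bij_betw (\<lambda>u. last (P u)) (X 0) (X n)"
  proof (rule layered_paths)
    show "X i \<subseteq> V" if "i \<le> n" for i using X(1)[of i] U(1) that n by auto
    show "X i \<inter> X j = {}" if "i \<le> n" "j \<le> n" "i \<noteq> j" for i j using X(2)[of i j] that n by auto
    fix i assume i: "i < n"
    show "\<exists>f. bij_betw f (X i) (X (Suc i)) \<and> (\<forall>u\<in>X i. adj u (f u))"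
    proof (rule balanced_matching[where q = q and M = M])
      show "X i \<subseteq> V" "X (Suc i) \<subseteq> V" "card (X i) = q" "card (X (Suc i)) = q"
        using X(1)[of i] X(1)[of "Suc i"] U(1) i n by auto
      fix T assume T: "T \<subseteq> V"
      show "card T \<le> card (nb T \<inter> X i)" if "card T \<le> M"
        using small[OF T _ that, of i] mono[of i T] i n by linarith
      show "q \<le> 2 * card (nb T \<inter> X i)" if "M \<le> card T"
        using large[OF T _ that, of i] mono[of i T] i n by linarith
      show "card T \<le> card (nb T \<inter> X (Suc i))" if "card T \<le> M"
        using small[OF T _ that, of "Suc i"] mono[of "Suc i" T] i n by linarith
      show "q \<le> 2 * card (nb T \<inter> X (Suc i))" if "M \<le> card T"
        using large[OF T _ that, of "Suc i"] mono[of "Suc i" T] i n by linarith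
    qed
  qed
  then obtain P where P: "\<And>u. u \<in> X 0 \<Longrightarrow> P u \<noteq> [] \<and> successively adj (P u) \<and> distinct (P u)"
    "\<And>u u'. u \<in> X 0 \<Longrightarrow> u' \<in> X 0 \<Longrightarrow> u \<noteq> u' \<Longrightarrow> set (P u) \<inter> set (P u') = {}"
    "(\<Union>u\<in>X 0. set (P u)) = (\<Union>i\<le>n. X i)" by metis
  define Y where "Y = (\<Union>i\<le>n. X i)"
  have YU: "Y \<subseteq> U" using X(1) n unfolding Y_def by (meson UN_least atMost_iff le_imp_less_Suc)
  have fX: "finite (X i)" if "i < k" for i using X(1)[OF that] finU finite_subset by blast
  have "card Y = (\<Sum>i\<le>n. card (X i))" unfolding Y_def
    by (rule card_UN_disjoint) (use X(2) fX n in auto)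
  also have "\<dots> = k * q" using X(1) n by simp
  finally have cY: "card Y = k * q" .
  obtain xs where xs: "set xs = X 0" "distinct xs" using finite_distinct_list[OF fX[OF k]] by auto
  obtain ys where ys: "set ys = U - Y" "distinct ys" using finite_distinct_list[of "U - Y"] finU by auto
  define Ps where "Ps = map P xs @ map (\<lambda>u. [u]) ys"
  have "length xs = q" using xs X(1)[OF k] by (metis distinct_card)
  moreover have "length ys = card U - k * q"
    using ys cY YU finU by (metis card_Diff_subset distinct_card finite_subset)
  ultimately have "length Ps = q + (card U - k * q)" by (simp add: Ps_def)
  moreover have "\<forall>p\<in>set Ps. p \<noteq> [] \<and> successively adj p" using P(1) xs(1) by (auto simp: Ps_def)
  moreover have sP: "set (concat (map P xs)) = Y" using P(3) xs(1) by (simp add: Y_def)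
  have sc: "set (concat Ps) = U" using sP ys(1) YU by (auto simp: Ps_def)
  moreover have "distinct (concat (map P xs))"
    by (rule distinct_concat_map) (use xs P in auto)
  then have "distinct (concat Ps)" using ys sP by (auto simp: Ps_def)
  ultimately show ?thesis by blast
qed

end

subsection \<open>Absorption\<close>

context fin_graph
begin

lemma linksD:
  assumes "links R L I x y P" "i \<in> I"
  shows "length (P i) = L" "distinct (P i)" "set (P i) \<subseteq> R" "successively adj (x i # P i @ [y i])"
    and "i' \<in> I \<Longrightarrow> i \<noteq> i' \<Longrightarrow> set (P i) \<inter> set (P i') = {}"
  using assms by (auto simp: links_def)

lemma links_nth_inj:
  assumes P: "links R L I x y P" and "i \<in> I" "i' \<in> I" "j < L" "j' < L" "P i ! j = P i' ! j'"
  shows "i = i' \<and> j = j'"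
proof -
  have len: "length (P i) = L" "length (P i') = L" using linksD(1)[OF P] assms by auto
  have "i = i'"
  proof (rule ccontr)
    assume "i \<noteq> i'"
    then have "set (P i) \<inter> set (P i') = {}" using linksD(5)[OF P] assms by blast
    moreover have "P i ! j \<in> set (P i)" "P i' ! j' \<in> set (P i')"
      by (rule nth_mem; use len assms(4,5) in simp)+
    ultimately show False unfolding assms(6) by blast
  qed
  then show ?thesis using linksD(2)[OF P assms(2)] len assms by (simp add: nth_eq_iff_index_eq)
qed

text \<open>Linking \<open>v\<close> to itself through \<open>R1\<close> gives an odd cycle with
  \<open>2 * h + 3\<close> vertices, read as a ladder with \<open>h + 1\<close> rungs;
  \<open>h\<close> is odd since rungs are traversed in twos. \<open>R2\<close> supplies the
  connectors inside the ladders, \<open>R3\<close> the links from one ladder to the next. The bound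
  on \<open>M\<close> is dictated by \<open>R2\<close>, where \<open>card R * h\<close> pairs are
  linked at once.\<close>

lemma absorbing_path:
  assumes R: "R \<subseteq> V" "R \<noteq> {}" and h: "odd h" "card V \<le> 2 ^ h" "M \<le> card V"
    and res: "reservoir M h R1" "reservoir M h R2" "reservoir M h R3"
    and sub: "R1 \<subseteq> V" "R2 \<subseteq> V" "R3 \<subseteq> V"
    and disj: "R \<inter> R1 = {}" "R \<inter> R2 = {}" "R \<inter> R3 = {}" "R1 \<inter> R2 = {}" "R1 \<inter> R3 = {}" "R2 \<inter> R3 = {}"
    and M: "card R * (h + 1) \<le> M"
  shows "\<exists>A s t. A \<subseteq> R1 \<union> R2 \<union> R3 \<and> s \<in> A \<and> t \<in> A \<and> (\<forall>R'\<subseteq>R. \<exists>p. p \<noteq> [] \<and> successively adj p \<and> distinct p \<and>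
      set p = A \<union> R' \<and> hd p = s \<and> last p = t)"
proof -
  obtain b where "h = 2 * b + 1" using h(1) by (rule oddE)
  then have "h = 2 * (b + 1) - 1" "1 \<le> b + 1" by simp_all
  then obtain g where g: "h = 2 * g - 1" "1 \<le> g" by blast
  define L where "L = 2 * h + 2"
  have L: "L = 4 * g" using g by (simp add: L_def)
  have hg: "h + 1 = 2 * g" using g by simp
  have finR: "finite R" using R(1) fin finite_subset by blast
  have "card R \<le> card R * (h + 1)" by simp
  then have RM: "card R \<le> M" using M by linarith
  have "\<exists>P. links R1 (2 * h + 2) R id id P"
    by (rule connect[OF res(1) h(2,3) finR RM]) (use R in auto)
  then obtain Z where Z: "links R1 L R id id Z" by (auto simp: L_def)
  have lenZ: "length (Z v) = L" if "v \<in> R" for v using linksD(1)[OF Z that] .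
  \<comment> \<open>The first half of the cycle, read forwards from \<open>v\<close>, is one rail;
    the second half, read backwards from \<open>v\<close>, is the other.\<close>
  define a where "a v i = Z v ! i" for v i
  define b where "b v i = Z v ! (L - 1 - i)" for v i
  have aZ: "a v i \<in> set (Z v)" "b v i \<in> set (Z v)" if "v \<in> R" "i < L" for v i
    using that lenZ[OF that(1)] by (auto simp: a_def b_def)
  have ZR: "set (Z v) \<subseteq> R1" if "v \<in> R" for v using linksD(3)[OF Z that] .
  let ?I2 = "R \<times> {..<h}"
  have "\<exists>P. links R2 (2 * h + 2) ?I2 (\<lambda>(v, i). b v i) (\<lambda>(v, i). a v (Suc i)) P"
  proof (rule connect[OF res(2) h(2,3)])
    show "finite ?I2" using finR by simp
    have "card ?I2 \<le> card R * (h + 1)" by (simp add: card_cartesian_product)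
    then show "card ?I2 \<le> M" using M by linarith
    show "inj_on (\<lambda>(v, i). b v i) ?I2"
    proof (rule inj_onI, clarify)
      fix v i v' i' assume as: "v \<in> R" "v' \<in> R" "i < h" "i' < h" "b v i = b v' i'"
      then have "v = v' \<and> L - 1 - i = L - 1 - i'"
        by (intro links_nth_inj[OF Z]) (auto simp: b_def L_def)
      then show "v = v' \<and> i = i'" using as by (auto simp: L_def)
    qed
    show "inj_on (\<lambda>(v, i). a v (Suc i)) ?I2"
    proof (rule inj_onI, clarify)
      fix v i v' i' assume as: "v \<in> R" "v' \<in> R" "i < h" "i' < h" "a v (Suc i) = a v' (Suc i')"
      then have "v = v' \<and> Suc i = Suc i'"
        by (intro links_nth_inj[OF Z]) (auto simp: a_def L_def)
      then show "v = v' \<and> i = i'" by auto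
    qed
    have "b v i \<in> V" "a v (Suc i) \<in> V" if "v \<in> R" "i < h" for v i
      using aZ[of v i] aZ[of v "Suc i"] ZR[of v] sub(1) that by (auto simp: L_def)
    then show "(\<lambda>(v, i). b v i) ` ?I2 \<subseteq> V" "(\<lambda>(v, i). a v (Suc i)) ` ?I2 \<subseteq> V" by auto
  qed
  then obtain C where C: "links R2 L ?I2 (\<lambda>(v, i). b v i) (\<lambda>(v, i). a v (Suc i)) C" by (auto simp: L_def)
  define S where "S v = set (Z v) \<union> (\<Union>i<h. set (C (v, i)))" for v
  have CR: "set (C (v, i)) \<subseteq> R2" if "v \<in> R" "i < h" for v i
    using linksD(3)[OF C, of "(v, i)"] that by simp
  have SV: "S v \<subseteq> R1 \<union> R2" if "v \<in> R" for v
    using ZR[OF that] CR[OF that] by (fastforce simp: S_def)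
  have distS: "distinct (Z v @ concat (map (\<lambda>i. C (v, i)) [0..<h]))"
    and setS: "set (Z v @ concat (map (\<lambda>i. C (v, i)) [0..<h])) = S v" if v: "v \<in> R" for v
  proof -
    show e: "set (Z v @ concat (map (\<lambda>i. C (v, i)) [0..<h])) = S v" by (auto simp: S_def)
    have "distinct (concat (map (\<lambda>i. C (v, i)) [0..<h]))"
    proof (rule distinct_concat_map)
      show "distinct (C (v, i))" if "i \<in> set [0..<h]" for i
        using linksD(2)[OF C, of "(v, i)"] v that by simp
      show "set (C (v, i)) \<inter> set (C (v, i')) = {}"
        if "i \<in> set [0..<h]" "i' \<in> set [0..<h]" "i \<noteq> i'" for i i'
        using linksD(5)[OF C, of "(v, i)" "(v, i')"] v that by simp
    qed simp
    moreover have "set (Z v) \<inter> set (concat (map (\<lambda>i. C (v, i)) [0..<h])) = {}"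
      using ZR[OF v] CR[OF v] disj(4) by fastforce
    ultimately show "distinct (Z v @ concat (map (\<lambda>i. C (v, i)) [0..<h]))"
      using linksD(2)[OF Z v] by simp
  qed
  have ladder: "\<exists>p q. p \<noteq> [] \<and> successively adj p \<and> hd p = a v 0 \<and> last p = b v h \<and> distinct p \<and> set p = S v \<and>
      q \<noteq> [] \<and> successively adj q \<and> hd q = a v 0 \<and> last q = b v h \<and> distinct q \<and> set q = insert v (S v)"
    if v: "v \<in> R" for v
  proof -
    have sZ: "successively adj (v # Z v @ [v])" using linksD(4)[OF Z v] by simp
    have adjZ: "adj (Z v ! i) (Z v ! Suc i)" if "Suc i < L" for i
    proof -
      have "successively adj (Z v)" using sZ by (auto simp: successively_append_iff successively_Cons)
      then show ?thesis using that lenZ[OF v] by (simp add: successively_conv_nth)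
    qed
    have A: "adj (a v i) (a v (Suc i))" if "Suc i < 2 * g" for i
      using adjZ[of i] that by (simp add: a_def L)
    have B: "adj (b v i) (b v (Suc i))" if "Suc i < 2 * g" for i
    proof -
      have "L - 1 - i = Suc (L - 1 - Suc i)" using that by (simp add: L)
      then show ?thesis using sym[OF adjZ[of "L - 1 - Suc i"]] that by (simp add: b_def L)
    qed
    have "L - 1 - (2 * g - 1) = Suc (2 * g - 1)" using g by (simp add: L)
    then have AB: "adj (a v (2 * g - 1)) (b v (2 * g - 1))"
      using adjZ[of "2 * g - 1"] g by (simp add: a_def b_def L)
    have "Z v \<noteq> []" using lenZ[OF v] L g by auto
    then have "adj v (Z v ! 0)" "adj (last (Z v)) v"
      using sZ by (auto simp: successively_append_iff successively_Cons hd_conv_nth nth_append)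
    then have V: "adj (a v 0) v" "adj v (b v 0)"
      using sym \<open>Z v \<noteq> []\<close> lenZ[OF v] by (auto simp: a_def b_def last_conv_nth)
    have CC: "successively adj (b v i # C (v, i) @ [a v (Suc i)])" if "Suc i < 2 * g" for i
      using linksD(4)[OF C, of "(v, i)"] v that g by simp
    have "mset (map (a v) [0..<2 * g]) + mset (map (b v) [0..<2 * g]) = mset (Z v)"
    proof -
      have "map (a v) [0..<2 * g] = take (2 * g) (Z v)"
        by (rule nth_equalityI) (use lenZ[OF v] in \<open>auto simp: a_def L\<close>)
      moreover have "rev (map (b v) [0..<2 * g]) = drop (2 * g) (Z v)"
        by (rule nth_equalityI) (use lenZ[OF v] in \<open>auto simp: b_def L rev_nth algebra_simps\<close>)
      then have "mset (map (b v) [0..<2 * g]) = mset (drop (2 * g) (Z v))" by (metis mset_rev)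
      ultimately show ?thesis by (metis append_take_drop_id mset_append)
    qed
    then have W: "mset (map (a v) [0..<2 * g]) + mset (map (b v) [0..<2 * g]) +
        mset (concat (map (\<lambda>i. C (v, i)) [0..<2 * g - 1])) = mset (Z v @ concat (map (\<lambda>i. C (v, i)) [0..<h]))"
      using g by simp
    have gh: "2 * g - 1 = h" using g by simp
    from ladder_absorber(1)[OF g(2) A B AB V CC] W obtain p where p: "p \<noteq> []" "successively adj p"
      "hd p = a v 0" "last p = b v h" "mset p = mset (Z v @ concat (map (\<lambda>i. C (v, i)) [0..<h]))"
      unfolding gh by auto
    from ladder_absorber(2)[OF g(2) A B AB V CC] W obtain q where q: "q \<noteq> []" "successively adj q"
      "hd q = a v 0" "last q = b v h" "mset q = mset (v # Z v @ concat (map (\<lambda>i. C (v, i)) [0..<h]))"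
      unfolding gh by auto
    have "v \<notin> S v" using SV[OF v] v disj by auto
    then have "distinct (v # Z v @ concat (map (\<lambda>i. C (v, i)) [0..<h]))" using distS[OF v] setS[OF v] by simp
    then have "distinct q" "set q = insert v (S v)"
      using mset_eq_imp_distinct_iff[OF q(5)] mset_eq_setD[OF q(5)] setS[OF v] by auto
    moreover have "distinct p" "set p = S v"
      using mset_eq_imp_distinct_iff[OF p(5)] mset_eq_setD[OF p(5)] distS[OF v] setS[OF v] by auto
    ultimately show ?thesis using p q by blast
  qed
  then obtain pw qw where pq: "\<And>v. v \<in> R \<Longrightarrow> pw v \<noteq> [] \<and> successively adj (pw v) \<and> hd (pw v) = a v 0 \<and>
      last (pw v) = b v h \<and> distinct (pw v) \<and> set (pw v) = S v"
    "\<And>v. v \<in> R \<Longrightarrow> qw v \<noteq> [] \<and> successively adj (qw v) \<and> hd (qw v) = a v 0 \<and>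
      last (qw v) = b v h \<and> distinct (qw v) \<and> set (qw v) = insert v (S v)" by metis
  have SS: "S v \<inter> S v' = {}" if "v \<in> R" "v' \<in> R" "v \<noteq> v'" for v v'
  proof -
    have "set (Z v) \<inter> set (Z v') = {}" using linksD(5)[OF Z] that by blast
    moreover have "set (C (v, i)) \<inter> set (C (v', i')) = {}" if "i < h" "i' < h" for i i'
      using linksD(5)[OF C, of "(v, i)" "(v', i')"] \<open>v \<in> R\<close> \<open>v' \<in> R\<close> \<open>v \<noteq> v'\<close> that by simp
    moreover have "set (Z v) \<inter> set (C (v', i)) = {}" "set (Z v') \<inter> set (C (v, i)) = {}" if "i < h" for i
      using ZR CR[OF _ that] disj(4) \<open>v \<in> R\<close> \<open>v' \<in> R\<close> by blast+
    ultimately show ?thesis unfolding S_def by blast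
  qed
  obtain vs where vs: "set vs = R" "distinct vs" using finite_distinct_list[OF finR] by auto
  define n where "n = length vs - 1"
  have len: "length vs = Suc n" using vs(1) R(2) by (cases vs) (auto simp: n_def)
  have vR: "vs ! i \<in> R" if "i \<le> n" for i using vs(1) len that by (metis le_imp_less_Suc nth_mem)
  have vne: "vs ! i \<noteq> vs ! j" if "i \<le> n" "j \<le> n" "i \<noteq> j" for i j
    using vs(2) len that by (simp add: nth_eq_iff_index_eq)
  have abS: "a v 0 \<in> S v" "b v h \<in> S v" if "v \<in> R" for v
    using aZ[OF that] by (auto simp: S_def L_def)
  have "\<exists>P. links R3 (2 * h + 2) {..<n} (\<lambda>i. b (vs ! i) h) (\<lambda>i. a (vs ! Suc i) 0) P"
  proof (rule connect[OF res(3) h(2,3)])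
    have "n \<le> card R" using len vs by (metis distinct_card lessI less_imp_le_nat)
    then show "card {..<n} \<le> M" using RM by simp
    show "inj_on (\<lambda>i. b (vs ! i) h) {..<n}"
    proof (rule inj_onI)
      fix i j assume "i \<in> {..<n}" "j \<in> {..<n}" "b (vs ! i) h = b (vs ! j) h"
      then show "i = j" using SS[of "vs ! i" "vs ! j"] abS(2)[of "vs ! i"] abS(2)[of "vs ! j"] vR vne[of i j]
        by (metis disjoint_iff lessThan_iff less_imp_le_nat)
    qed
    show "inj_on (\<lambda>i. a (vs ! Suc i) 0) {..<n}"
    proof (rule inj_onI)
      fix i j assume "i \<in> {..<n}" "j \<in> {..<n}" "a (vs ! Suc i) 0 = a (vs ! Suc j) 0"
      then show "i = j" using SS[of "vs ! Suc i" "vs ! Suc j"] abS(1)[of "vs ! Suc i"] abS(1)[of "vs ! Suc j"]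
          vR[of "Suc i"] vR[of "Suc j"] vne[of "Suc i" "Suc j"]
        by (metis disjoint_iff lessThan_iff Suc_leI nat.inject)
    qed
    have "a v 0 \<in> V" "b v h \<in> V" if "v \<in> R" for v using abS[OF that] SV[OF that] sub by auto
    then show "(\<lambda>i. b (vs ! i) h) ` {..<n} \<subseteq> V" "(\<lambda>i. a (vs ! Suc i) 0) ` {..<n} \<subseteq> V" using vR by auto
  qed simp
  then obtain D where D: "links R3 L {..<n} (\<lambda>i. b (vs ! i) h) (\<lambda>i. a (vs ! Suc i) 0) D" by (auto simp: L_def)
  define A where "A = (\<Union>v\<in>R. S v) \<union> (\<Union>i<n. set (D i))"
  have DR: "set (D i) \<subseteq> R3" if "i < n" for i using linksD(3)[OF D, of i] that by simp
  have "\<exists>p. p \<noteq> [] \<and> successively adj p \<and> distinct p \<and> set p = A \<union> R' \<and> hd p = a (vs ! 0) 0 \<and> last p = b (vs ! n) h"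
    if R': "R' \<subseteq> R" for R'
  proof -
    define B where "B i = (if vs ! i \<in> R' then qw (vs ! i) else pw (vs ! i))" for i
    have B: "B i \<noteq> []" "successively adj (B i)" "hd (B i) = a (vs ! i) 0" "last (B i) = b (vs ! i) h" "distinct (B i)"
      "set (B i) = S (vs ! i) \<union> (if vs ! i \<in> R' then {vs ! i} else {})" if "i \<le> n" for i
      using pq(1)[OF vR[OF that]] pq(2)[OF vR[OF that]] by (auto simp: B_def)
    \<comment> \<open>An empty link after the last block gives all blocks the same form.\<close>
    define D' where "D' i = (if i < n then D i else [])" for i
    let ?p = "concat (map (\<lambda>i. B i @ D' i) [0..<n]) @ B n"
    have ch: "successively adj ?p \<and> hd ?p = hd (B 0)"
    proof (rule successively_concat_chain)
      show "B i \<noteq> [] \<and> successively adj (B i)" if "i \<le> n" for i using B[OF that] by simp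
      fix i assume i: "i < n"
      have "hd (B (Suc i)) = a (vs ! Suc i) 0" "last (B i) = b (vs ! i) h" using B(3)[of "Suc i"] B(4)[of i] i by auto
      then show "successively adj (last (B i) # D' i @ [hd (B (Suc i))])"
        using linksD(4)[OF D, of i] i by (simp add: D'_def)
    qed
    have peq: "?p = concat (map (\<lambda>i. B i @ D' i) [0..<Suc n])" by (simp add: D'_def)
    have BD: "set (B i) \<inter> set (D' j) = {}" if "i \<le> n" for i j
    proof -
      have "set (B i) \<subseteq> R1 \<union> R2 \<union> R" using B(6)[OF that] SV[OF vR[OF that]] R' by auto
      moreover have "set (D' j) \<subseteq> R3" using DR[of j] by (auto simp: D'_def)
      ultimately show ?thesis using disj by blast
    qed
    have BB: "set (B i) \<inter> set (B j) = {}" if "i \<le> n" "j \<le> n" "i \<noteq> j" for i j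
    proof -
      have "v \<notin> S v'" if "v \<in> R" "v' \<in> R" for v v' using SV[OF that(2)] that disj by blast
      then show ?thesis using B(6)[OF that(1)] B(6)[OF that(2)] SS[OF vR[OF that(1)] vR[OF that(2)] vne[OF that]]
          vne[OF that] vR[OF that(1)] vR[OF that(2)] by auto
    qed
    have DD: "set (D' i) \<inter> set (D' j) = {}" if "i \<noteq> j" for i j
      using linksD(5)[OF D, of i j] that by (auto simp: D'_def)
    have "distinct (concat (map (\<lambda>i. B i @ D' i) [0..<Suc n]))"
    proof (rule distinct_concat_map)
      show "distinct (B i @ D' i)" if "i \<in> set [0..<Suc n]" for i
        using that B(5)[of i] BD[of i i] linksD(2)[OF D, of i] by (auto simp: D'_def)
      show "set (B i @ D' i) \<inter> set (B j @ D' j) = {}"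
        if "i \<in> set [0..<Suc n]" "j \<in> set [0..<Suc n]" "i \<noteq> j" for i j
        using that BB[of i j] DD[of i j] BD[of i j] BD[of j i] by auto
    qed simp
    moreover have "set (concat (map (\<lambda>i. B i @ D' i) [0..<Suc n])) = A \<union> R'"
    proof -
      have R_eq: "R = (\<lambda>i. vs ! i) ` {..n}"
        unfolding vs(1)[symmetric] set_conv_nth[of vs] len by (auto simp: less_Suc_eq_le)
      have "set (concat (map (\<lambda>i. B i @ D' i) [0..<Suc n])) = (\<Union>i\<le>n. set (B i)) \<union> (\<Union>i\<le>n. set (D' i))"
        unfolding set_concat set_map set_upt atLeastLessThanSuc_atLeastAtMost atLeast0AtMost by auto
      also have "(\<Union>i\<le>n. set (D' i)) = (\<Union>i<n. set (D i))" by (force simp: D'_def split: if_splits)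
      also have "(\<Union>i\<le>n. set (B i)) = (\<Union>i\<le>n. S (vs ! i) \<union> (if vs ! i \<in> R' then {vs ! i} else {}))"
        using B(6) by (intro SUP_cong) auto
      also have "\<dots> = (\<Union>v\<in>R. S v \<union> (if v \<in> R' then {v} else {}))" by (subst R_eq) simp
      also have "\<dots> = (\<Union>v\<in>R. S v) \<union> (\<Union>v\<in>R. if v \<in> R' then {v} else {})" by blast
      also have "(\<Union>v\<in>R. if v \<in> R' then {v} else {}) = R'" using R' by auto
      finally show ?thesis by (auto simp: A_def)
    qed
    ultimately show ?thesis using ch B(1,3)[of 0] B(1,4)[of n] peq by (intro exI[of _ ?p]) auto
  qed
  moreover have "A \<subseteq> R1 \<union> R2 \<union> R3" using SV DR unfolding A_def by blast
  moreover have "a (vs ! 0) 0 \<in> A" "b (vs ! n) h \<in> A" using abS vR by (auto simp: A_def)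
  ultimately show ?thesis by blast
qed


text \<open>The ends \<open>s\<close> and \<open>t\<close> of the absorbing path do not depend on
  the set it absorbs. So the closing links through \<open>R\<close> are chosen first, and whatever
  they leave of \<open>R\<close> is absorbed afterwards. \<open>cover\<close> speaks of all
  \<open>A\<close> because \<open>A\<close> is known only once the absorbing path exists.\<close>

theorem hamilton_cycle_of_reservoirs:
  assumes R: "R \<subseteq> V" "R \<noteq> {}" and h: "odd h" "card V \<le> 2 ^ h" "M \<le> card V" "M' \<le> card V"
    and res: "reservoir M h R1" "reservoir M h R2" "reservoir M h R3" "reservoir M' h R"
    and sub: "R1 \<subseteq> V" "R2 \<subseteq> V" "R3 \<subseteq> V"
    and disj: "R \<inter> R1 = {}" "R \<inter> R2 = {}" "R \<inter> R3 = {}" "R1 \<inter> R2 = {}" "R1 \<inter> R3 = {}" "R2 \<inter> R3 = {}"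
    and M: "card R * (h + 1) \<le> M"
    and cover: "\<And>A. A \<subseteq> R1 \<union> R2 \<union> R3 \<Longrightarrow> \<exists>Ps. length Ps < M' \<and> (\<forall>p\<in>set Ps. p \<noteq> [] \<and> successively adj p) \<and>
                  distinct (concat Ps) \<and> set (concat Ps) = V - (R \<union> A)"
  shows "\<exists>vs. vs \<noteq> [] \<and> distinct vs \<and> set vs = V \<and> successively adj vs \<and> adj (last vs) (hd vs)"
proof -
  from absorbing_path[OF R h(1-3) res(1-3) sub disj M] obtain A s t where
    A: "A \<subseteq> R1 \<union> R2 \<union> R3" "s \<in> A" "t \<in> A" and
    absorb: "\<forall>R'\<subseteq>R. \<exists>p. p \<noteq> [] \<and> successively adj p \<and> distinct p \<and> set p = A \<union> R' \<and> hd p = s \<and> last p = t"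
    by (elim exE conjE)
  from cover[OF A(1)] obtain Ps where Ps0: "length Ps < M'" "\<forall>p\<in>set Ps. p \<noteq> [] \<and> successively adj p"
    "distinct (concat Ps)" "set (concat Ps) = V - (R \<union> A)" by (elim exE conjE)
  have Ps: "length Ps < M'" "p \<in> set Ps \<Longrightarrow> p \<noteq> [] \<and> successively adj p"
    "distinct (concat Ps)" "set (concat Ps) = V - (R \<union> A)" for p
    using Ps0 by blast+
  define n where "n = length Ps"
  \<comment> \<open>Block \<open>0\<close> is the absorbing path and block \<open>i + 1\<close> is
    \<open>Ps ! i\<close>; below, \<open>x i\<close> is the end of block \<open>i\<close> and
    \<open>y i\<close> the start of its cyclic successor \<open>nx i\<close>.\<close>
  define S where "S i = (if i = 0 then A else set (Ps ! (i - 1)))" for i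
  have dPs: "distinct Ps"
  proof -
    have "[] \<notin> set Ps" using Ps(2)[of "[]"] by blast
    then show ?thesis using Ps(3) by (simp add: distinct_concat_iff removeAll_id)
  qed
  have inP: "Ps ! i \<in> set Ps" if "i < n" for i using that by (simp add: n_def)
  have SU: "S (Suc i) \<subseteq> V - (R \<union> A)" if "i < n" for i
    using Ps(4) inP[OF that] by (auto simp: S_def)
  have AV: "A \<subseteq> V - R" using A(1) sub disj by blast
  have SV: "S i \<subseteq> V - R" if "i \<le> n" for i
    using SU[of "i - 1"] AV that by (cases i) (auto simp: S_def)
  have SS: "S i \<inter> S j = {}" if "i < j" "j \<le> n" for i j
  proof (cases "i = 0")
    case True
    have "j - 1 < n" "0 < j" using that by auto
    then show ?thesis using True SU[of "j - 1"] by (auto simp: S_def)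
  next
    case False
    then have "Ps ! (i - 1) \<noteq> Ps ! (j - 1)" using dPs that by (simp add: nth_eq_iff_index_eq n_def)
    moreover have "Ps ! (i - 1) \<in> set Ps" "Ps ! (j - 1) \<in> set Ps" using that False by (auto intro!: inP)
    ultimately have "set (Ps ! (i - 1)) \<inter> set (Ps ! (j - 1)) = {}"
      using Ps(3) by (simp add: distinct_concat_iff)
    then show ?thesis using that False by (simp add: S_def)
  qed
  have S_eq: "i = j" if "v \<in> S i" "v \<in> S j" "i \<le> n" "j \<le> n" for i j v
    using SS[of i j] SS[of j i] that by (metis IntI empty_iff nat_neq_iff)
  define x where "x i = (if i = 0 then t else last (Ps ! (i - 1)))" for i
  define y where "y i = (if i = n then s else hd (Ps ! i))" for i
  define nx where "nx i = (if i = n then 0 else Suc i)" for i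
  have xS: "x i \<in> S i" if "i \<le> n" for i
    using A(3) Ps(2)[OF inP[of "i - 1"]] that by (auto simp: x_def S_def)
  have yS: "y i \<in> S (nx i)" if "i \<le> n" for i
    using A(2) Ps(2)[OF inP[of i]] that by (auto simp: y_def S_def nx_def)
  have nx: "nx i \<le> n" if "i \<le> n" for i using that by (auto simp: nx_def)
  have "\<exists>P. links R (2 * h + 2) {..n} x y P"
  proof (rule connect[OF res(4) h(2,4)])
    show "card {..n} \<le> M'" using Ps(1) by (simp add: n_def)
    show "inj_on x {..n}" using S_eq xS unfolding inj_on_def by (metis atMost_iff)
    show "inj_on y {..n}"
    proof (rule inj_onI)
      fix i j assume ij: "i \<in> {..n}" "j \<in> {..n}" "y i = y j"
      then have "nx i = nx j" using S_eq[of "y i" "nx i" "nx j"] yS[of i] yS[of j] nx by simp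
      then show "i = j" by (simp add: nx_def split: if_splits)
    qed
    show "x ` {..n} \<subseteq> V" using xS SV by blast
    show "y ` {..n} \<subseteq> V" using yS SV nx by blast
  qed simp
  then obtain E where E: "links R (2 * h + 2) {..n} x y E" by blast
  define R' where "R' = R - (\<Union>i\<le>n. set (E i))"
  have ER: "set (E i) \<subseteq> R" if "i \<le> n" for i using linksD(3)[OF E, of i] that by simp
  obtain p0 where p0: "p0 \<noteq> []" "successively adj p0" "distinct p0" "set p0 = A \<union> R'" "hd p0 = s" "last p0 = t"
    using absorb[rule_format, of R'] by (auto simp: R'_def)
  define B where "B i = (if i = 0 then p0 else Ps ! (i - 1))" for i
  have B: "B i \<noteq> [] \<and> successively adj (B i)" if "i \<le> n" for i
    using p0 Ps(2)[OF inP[of "i - 1"]] that by (auto simp: B_def)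
  have Bx: "last (B i) = x i" for i using p0 by (simp add: B_def x_def)
  have By: "hd (B (nx i)) = y i" for i using p0 by (simp add: B_def y_def nx_def)
  have Bset: "set (B i) = S i \<union> (if i = 0 then R' else {})" for i using p0 by (auto simp: B_def S_def)
  let ?c = "concat (map (\<lambda>i. B i @ E i) [0..<n]) @ B n"
  let ?vs = "concat (map (\<lambda>i. B i @ E i) [0..<Suc n])"
  have vs_eq: "?vs = ?c @ E n" by simp
  have succE: "successively adj (last (B i) # E i @ [hd (B (nx i))])" if "i \<le> n" for i
    using linksD(4)[OF E, of i] that by (simp add: Bx By)
  have ch: "successively adj ?c \<and> hd ?c = hd (B 0)"
  proof (rule successively_concat_chain)
    show "successively adj (last (B i) # E i @ [hd (B (Suc i))])" if "i < n" for i
      using succE[of i] that by (simp add: nx_def)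
  qed (rule B)
  have cne: "?c \<noteq> []" and lastc: "last ?c = last (B n)" using B[of n] by auto
  have "successively adj (?c @ (E n @ [hd (B 0)]))"
    by (rule successively_append_last[OF cne]) (use ch succE[of n] lastc in \<open>auto simp: nx_def\<close>)
  then have cyc: "successively adj (?vs @ [hd (B 0)])" by (simp add: vs_eq)
  have vne: "?vs \<noteq> []" and hdvs: "hd ?vs = hd (B 0)"
    using ch hd_append2[OF cne] append_is_Nil_conv[of ?c "E n"] cne unfolding vs_eq by (metis, metis)
  have E0: "set (E i) \<inter> set (B j) = {}" if "i \<le> n" "j \<le> n" for i j
    using ER[OF that(1)] SV[OF that(2)] that(1) unfolding Bset by (auto simp: R'_def)
  have "distinct ?vs"
  proof (rule distinct_concat_map)
    show "distinct (B i @ E i)" if "i \<in> set [0..<Suc n]" for i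
    proof -
      have "distinct (B i)" using p0 Ps(3) inP[of "i - 1"] that by (auto simp: B_def distinct_concat_iff)
      then show ?thesis using E0[of i i] linksD(2)[OF E, of i] that by auto
    qed
    show "set (B i @ E i) \<inter> set (B j @ E j) = {}"
      if "i \<in> set [0..<Suc n]" "j \<in> set [0..<Suc n]" "i \<noteq> j" for i j
    proof -
      have ij: "i \<le> n" "j \<le> n" using that by auto
      have "S i \<inter> S j = {}" using S_eq ij that(3) by blast
      moreover have "S i \<inter> R' = {}" "S j \<inter> R' = {}" using SV[OF ij(1)] SV[OF ij(2)] by (auto simp: R'_def)
      ultimately have "set (B i) \<inter> set (B j) = {}" using that(3) by (auto simp: Bset)
      then show ?thesis using E0[OF ij] E0[OF ij(2,1)] linksD(5)[OF E, of i j] ij that(3) by auto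
    qed
  qed simp
  moreover have "set ?vs = V"
  proof -
    have s1: "set ?vs = (\<Union>i\<le>n. set (B i)) \<union> (\<Union>i\<le>n. set (E i))"
      unfolding set_concat set_map set_upt atLeastLessThanSuc_atLeastAtMost atLeast0AtMost by auto
    have e: "{..n} = insert 0 (Suc ` {..<n})"
      by (metis lessThan_Suc_atMost lessThan_Suc_eq_insert_0)
    have "(\<Union>i\<le>n. S i) = A \<union> (\<Union>i<n. set (Ps ! i))" 
    proof -
      have "S 0 = A" "S (Suc i) = set (Ps ! i)" for i by (simp_all add: S_def)
      then show ?thesis unfolding e by simp
    qed
    also have "(\<Union>i<n. set (Ps ! i)) = (\<Union>p\<in>set Ps. set p)"
      unfolding n_def by (auto simp: set_conv_nth[of Ps])
    also have "(\<Union>p\<in>set Ps. set p) = V - (R \<union> A)" using Ps(4) by simp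
    finally have "(\<Union>i\<le>n. S i) = A \<union> (V - (R \<union> A))" .
    moreover have "(\<Union>i\<le>n. set (B i)) = R' \<union> (\<Union>i\<le>n. S i)"
      by (auto simp: Bset split: if_splits)
    ultimately have "(\<Union>i\<le>n. set (B i)) = R' \<union> (A \<union> (V - (R \<union> A)))" by simp
    moreover have "R' \<union> (\<Union>i\<le>n. set (E i)) = R" using ER by (auto simp: R'_def)
    ultimately show ?thesis using s1 AV R(1) by auto
  qed
  moreover have "successively adj ?vs" "adj (last ?vs) (hd ?vs)"
    using cyc vne hdvs unfolding successively_append_iff by auto
  ultimately show ?thesis using vne by blast
qed

end

subsection \<open>Hamilton cycles in randomly coloured expanders\<close>

lemma block_index_less:
  fixes p q P g :: nat
  assumes "p < P" "i < g"
  shows "p * g + i < P * g"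
proof -
  have "p * g + i < Suc p * g" using assms(2) by simp
  also have "\<dots> \<le> P * g" using assms(1) by (intro mult_le_mono1) simp
  finally show ?thesis .
qed

text \<open>\<open>B\<close> is the average class size, \<open>m\<close> separates small from large
  sets, and \<open>\<eta>\<close> is the relative deviation of class sizes. As
  \<open>\<eta> \<le> c\<close>, even in the largest class \<open>(1 / 2 + c) * B\<close> neighbours
  are more than half.\<close>

locale coloured_graph = fin_graph +
  fixes Cl :: "nat \<Rightarrow> 'a set" and k m :: nat and c \<eta> B :: real
  assumes Cl_disj: "i < k \<Longrightarrow> j < k \<Longrightarrow> i \<noteq> j \<Longrightarrow> Cl i \<inter> Cl j = {}"
    and Cl_V: "i < k \<Longrightarrow> Cl i \<subseteq> V"
    and V_eq: "real (card V) = real k * B"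
    and c: "0 < c" "c \<le> 1 / 6" and \<eta>: "0 \<le> \<eta>" "\<eta> \<le> c"
    and small: "i < k \<Longrightarrow> T \<subseteq> V \<Longrightarrow> card T \<le> m \<Longrightarrow> 6 * card T \<le> card (nb T \<inter> Cl i)"
    and large: "i < k \<Longrightarrow> T \<subseteq> V \<Longrightarrow> m \<le> card T \<Longrightarrow> (1 / 2 + c) * B \<le> real (card (nb T \<inter> Cl i))"
    and size: "i < k \<Longrightarrow> (1 - \<eta>) * B \<le> real (card (Cl i))" "i < k \<Longrightarrow> real (card (Cl i)) \<le> (1 + \<eta>) * B"
    and m: "real m \<le> B / 2" and kB: "real k + 3 \<le> B"
begin

definition classes :: "nat set \<Rightarrow> 'a set" where
  "classes I = (\<Union>i\<in>I. Cl i)"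

lemma B_pos: "0 < B"
  using kB by linarith

lemma fin_Cl: "i < k \<Longrightarrow> finite (Cl i)"
  using Cl_V fin finite_subset by blast

lemma classes_V: "I \<subseteq> {..<k} \<Longrightarrow> classes I \<subseteq> V"
  using Cl_V by (auto simp: classes_def)

lemma classes_disj:
  assumes "I \<subseteq> {..<k}" "J \<subseteq> {..<k}" "I \<inter> J = {}"
  shows "classes I \<inter> classes J = {}"
proof -
  have "Cl i \<inter> Cl j = {}" if "i \<in> I" "j \<in> J" for i j
    using Cl_disj[of i j] assms that by auto
  then show ?thesis unfolding classes_def by blast
qed

lemma card_inter_classes:
  assumes "I \<subseteq> {..<k}"
  shows "card (X \<inter> classes I) = (\<Sum>i\<in>I. card (X \<inter> Cl i))"
proof -
  have "X \<inter> classes I = (\<Union>i\<in>I. X \<inter> Cl i)" by (auto simp: classes_def)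
  moreover have "card (\<Union>i\<in>I. X \<inter> Cl i) = (\<Sum>i\<in>I. card (X \<inter> Cl i))"
  proof (rule card_UN_disjoint)
    show "finite I" using assms finite_subset by blast
    show "\<forall>i\<in>I. finite (X \<inter> Cl i)" using assms fin_Cl by blast
    show "\<forall>i\<in>I. \<forall>j\<in>I. i \<noteq> j \<longrightarrow> X \<inter> Cl i \<inter> (X \<inter> Cl j) = {}"
      using assms Cl_disj by blast
  qed
  ultimately show ?thesis by simp
qed

lemma card_classes: "I \<subseteq> {..<k} \<Longrightarrow> card (classes I) = (\<Sum>i\<in>I. card (Cl i))"
  using card_inter_classes[of I UNIV] by simp

lemma card_classes_le:
  assumes "I \<subseteq> {..<k}"
  shows "real (card (classes I)) \<le> real (card I) * ((1 + \<eta>) * B)"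
proof -
  have "real (card (classes I)) = (\<Sum>i\<in>I. real (card (Cl i)))" using card_classes[OF assms] by simp
  also have "\<dots> \<le> (\<Sum>i\<in>I. (1 + \<eta>) * B)" by (rule sum_mono) (use size(2) assms in auto)
  finally show ?thesis by simp
qed

lemma card_classes_ge:
  assumes "I \<subseteq> {..<k}"
  shows "real (card I) * ((1 - \<eta>) * B) \<le> real (card (classes I))"
proof -
  have "(\<Sum>i\<in>I. (1 - \<eta>) * B) \<le> (\<Sum>i\<in>I. real (card (Cl i)))" by (rule sum_mono) (use size(1) assms in auto)
  then show ?thesis using card_classes[OF assms] by simp
qed

text \<open>Each class contributes a surplus of at least \<open>c * B\<close> to twice the
  neighbours minus the size. The surpluses add up, so a union of classes tolerates a threshold
  \<open>M\<close> that grows with their number.\<close>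

lemma expands_classes:
  assumes I: "I \<subseteq> {..<k}" "I \<noteq> {}" and M: "m \<le> M" "2 * real M < real (card I) * (c * B)"
  shows "expands M (classes I)"
proof -
  have finI: "finite I" using I(1) finite_subset by blast
  have big: "real (card I) * ((1 / 2 + c) * B) \<le> real (card (nb T \<inter> classes I))"
    if "T \<subseteq> V" "m \<le> card T" for T
  proof -
    have "(\<Sum>i\<in>I. (1 / 2 + c) * B) \<le> (\<Sum>i\<in>I. real (card (nb T \<inter> Cl i)))"
      by (rule sum_mono) (use large that I in auto)
    then show ?thesis using card_inter_classes[OF I(1), of "nb T"] by simp
  qed
  have "6 * card T \<le> card (nb T \<inter> classes I)" if T: "T \<subseteq> V" "card T \<le> M" for T
  proof (cases "card T \<le> m")
    case True
    obtain i where i: "i \<in> I" using I(2) by auto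
    have "6 * card T \<le> card (nb T \<inter> Cl i)" using small[of i T] True T(1) I(1) i by auto
    also have "\<dots> \<le> card (nb T \<inter> classes I)" by (rule card_mono) (use i in \<open>auto simp: classes_def\<close>)
    finally show ?thesis .
  next
    case False
    have "real (card I) * (c * B) \<le> real (card I) * (1 / 6 * B)"
      using c(2) B_pos by (intro mult_left_mono mult_right_mono) auto
    then have "6 * real M \<le> real (card I) * (1 / 2 * B)" using M(2) by simp
    also have "\<dots> \<le> real (card I) * ((1 / 2 + c) * B)"
      using c(1) B_pos by (intro mult_left_mono mult_right_mono) auto
    also have "\<dots> \<le> real (card (nb T \<inter> classes I))" using big[OF T(1)] False by simp
    finally show ?thesis using T(2) by linarith
  qed
  moreover have "card (classes I) + 2 * M < 2 * card (nb T \<inter> classes I)" if T: "T \<subseteq> V" "M \<le> card T" for T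
  proof -
    have "real (card (classes I)) \<le> real (card I) * ((1 + c) * B)"
      using card_classes_le[OF I(1)] mult_left_mono[OF mult_right_mono[of "1 + \<eta>" "1 + c" B], of "real (card I)"]
        \<eta>(2) B_pos by simp
    then have "real (card (classes I)) + 2 * real M < real (card I) * ((1 + c) * B) + real (card I) * (c * B)"
      using M(2) by linarith
    also have "\<dots> = 2 * (real (card I) * ((1 / 2 + c) * B))" by (simp add: algebra_simps)
    also have "\<dots> \<le> 2 * real (card (nb T \<inter> classes I))" using big[OF T(1)] M(1) T(2) by simp
    finally have "real (card (classes I) + 2 * M) < real (2 * card (nb T \<inter> classes I))" by simp
    then show ?thesis by (simp only: of_nat_less_iff)
  qed
  ultimately show ?thesis using classes_V[OF I(1)] by (simp add: expands_def)
qed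

text \<open>Layer \<open>j\<close> of round \<open>r\<close> is the block of \<open>g\<close>
  consecutive classes with number \<open>r * (2 * h + 2) + j\<close>.\<close>

lemma reservoir_classes:
  assumes a: "a + (h + 1) * (2 * h + 2) * g \<le> k" "0 < g"
    and M: "m \<le> M" "2 * real M < real g * (c * B)"
  shows "reservoir M h (classes {a..<a + (h + 1) * (2 * h + 2) * g})"
proof -
  define L where "L = 2 * h + 2"
  define I where "I p = {a + p * g..<a + p * g + g}" for p
  define S where "S r j = classes (I (r * L + j))" for r j
  have p_less: "r * L + j < (h + 1) * L" if "r \<le> h" "j < L" for r j
    using block_index_less[of r "h + 1" j L] that by simp
  have I_sub: "I p \<subseteq> {a..<a + (h + 1) * L * g}" if "p < (h + 1) * L" for p
  proof -
    have "p * g + g \<le> (h + 1) * L * g" using block_index_less[OF that, of "g - 1" g] a(2) by simp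
    then show ?thesis by (auto simp: I_def)
  qed
  have I_k: "I p \<subseteq> {..<k}" if "p < (h + 1) * L" for p using I_sub[OF that] a(1) by (auto simp: L_def)
  have cI: "card (I p) = g" "I p \<noteq> {}" for p using a(2) by (auto simp: I_def)
  have I_disj: "I p \<inter> I q = {}" if "p < q" for p q
  proof -
    have "p * g + g \<le> q * g" using mult_le_mono1[of "Suc p" q g] that by simp
    then show ?thesis by (auto simp: I_def)
  qed
  have idx: "r = r' \<and> j = j'" if "r * L + j = r' * L + j'" "j < L" "j' < L" for r j r' j'
  proof -
    have "(r * L + j) div L = r" "(r' * L + j') div L = r'" using that(2,3) by simp_all
    then have "r = r'" using that(1) by metis
    then show ?thesis using that by simp
  qed
  show ?thesis
    unfolding reservoir_def L_def[symmetric]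
  proof (intro exI[of _ S] conjI allI impI)
    fix r j assume rj: "r \<le> h" "j < L"
    show "S r j \<subseteq> classes {a..<a + (h + 1) * L * g}"
      using I_sub[OF p_less[OF rj]] unfolding S_def classes_def by blast
    show "expands M (S r j)"
      unfolding S_def by (rule expands_classes) (use I_k[OF p_less[OF rj]] cI M in auto)
    fix r' j' assume rj': "r' \<le> h" "j' < L" "(r, j) \<noteq> (r', j')"
    then have "r * L + j \<noteq> r' * L + j'" using idx[of r j r' j'] rj(2) by auto
    then have "I (r * L + j) \<inter> I (r' * L + j') = {}"
      using I_disj[of "r * L + j" "r' * L + j'"] I_disj[of "r' * L + j'" "r * L + j"] by (metis Int_commute nat_neq_iff)
    then show "S r j \<inter> S r' j' = {}"
      unfolding S_def using I_k p_less rj rj' by (intro classes_disj) auto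
  qed
qed

text \<open>\<open>P\<close> is the number of layers of a reservoir. With \<open>g\<close> classes
  per layer, \<open>R\<close> can link \<open>3 * B\<close> pairs; with \<open>g'\<close> classes
  per layer, \<open>R1\<close> to \<open>R3\<close> can link \<open>card R * (h + 1)\<close> pairs.
  The reservoirs take \<open>P * (g + 3 * g')\<close> classes, but \<open>l\<close> classes are kept
  out of the path cover: the vertices of the extra ones are used for padding. They lift the layer
  size \<open>q\<close> above every class size, while \<open>q \<le> (1 + 2 * c) * B\<close> keeps
  \<open>(1 / 2 + c) * B\<close> neighbours at half a layer.\<close>

theorem hamilton_cycle_of_colouring:
  fixes h g g' l :: nat
  defines "P \<equiv> (h + 1) * (2 * h + 2)"
  assumes h: "odd h" "card V \<le> 2 ^ h"
    and g: "6 < real g * c" and g': "4 * real P * real g * (real h + 1) < real g' * c"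
    and l: "P * (g + 3 * g') \<le> l" "2 * l \<le> k" "real k \<le> (1 + 2 * c) * (real k - real l)"
    and pool: "(real k - real l) * ((1 + \<eta>) * B + 1) \<le> (real k - real (P * (g + 3 * g'))) * ((1 - \<eta>) * B)"
  shows "\<exists>vs. vs \<noteq> [] \<and> distinct vs \<and> set vs = V \<and> successively adj vs \<and> adj (last vs) (hd vs)"
proof -
  define u where "u = P * (g + 3 * g')"
  define \<alpha> where "\<alpha> = P * g"
  define \<beta> where "\<beta> = P * g'"
  have u: "u = \<alpha> + \<beta> + \<beta> + \<beta>" by (simp add: u_def \<alpha>_def \<beta>_def algebra_simps)
  have P1: "1 \<le> P" by (simp add: P_def)
  have g0: "0 < g" using g c by (cases g) auto
  have "0 \<le> 4 * real P * real g * (real h + 1)" by simp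
  then have "0 < real g' * c" using g' by linarith
  then have g'0: "0 < g'" using c by (cases g') auto
  have "1 * 1 \<le> P * g" using P1 g0 by (intro mult_le_mono) auto
  then have \<alpha>1: "1 \<le> \<alpha>" by (simp add: \<alpha>_def)
  have uk: "u \<le> l" "l < k"
    using l(1,2) \<alpha>1 u unfolding u_def by auto
  define R where "R = classes {0..<\<alpha>}"
  define R1 where "R1 = classes {\<alpha>..<\<alpha> + \<beta>}"
  define R2 where "R2 = classes {\<alpha> + \<beta>..<\<alpha> + \<beta> + \<beta>}"
  define R3 where "R3 = classes {\<alpha> + \<beta> + \<beta>..<\<alpha> + \<beta> + \<beta> + \<beta>}"
  note Rdefs = R_def R1_def R2_def R3_def
  have sub: "R \<subseteq> V" "R1 \<subseteq> V" "R2 \<subseteq> V" "R3 \<subseteq> V"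
    unfolding Rdefs using uk u by (intro classes_V; auto)+
  have disj: "R \<inter> R1 = {}" "R \<inter> R2 = {}" "R \<inter> R3 = {}" "R1 \<inter> R2 = {}" "R1 \<inter> R3 = {}" "R2 \<inter> R3 = {}"
    unfolding Rdefs using uk u by (intro classes_disj; auto)+
  define M where "M = card R * (h + 1)"
  \<comment> \<open>Enough for the at most \<open>2 * B\<close> layered paths and the fewer than
    \<open>k \<le> B - 3\<close> single vertices left over by the division of
    \<open>card U\<close>.\<close>
  define M' where "M' = nat \<lfloor>3 * B\<rfloor>"
  have ak: "{0..<\<alpha>} \<subseteq> {..<k}" using uk u by auto
  have "real (card R) \<le> real \<alpha> * ((1 + \<eta>) * B)" "real \<alpha> * ((1 - \<eta>) * B) \<le> real (card R)"
    using card_classes_le[of "{0..<\<alpha>}"] card_classes_ge[of "{0..<\<alpha>}"] ak unfolding R_def by simp_all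
  moreover have "real \<alpha> * ((1 + \<eta>) * B) \<le> real \<alpha> * (2 * B)"
    using \<eta> c B_pos by (intro mult_left_mono mult_right_mono) auto
  moreover have "1 * (1 / 2 * B) \<le> real \<alpha> * ((1 - \<eta>) * B)"
    using \<eta> c B_pos \<alpha>1 by (intro mult_mono mult_right_mono) auto
  ultimately have cR: "real (card R) \<le> 2 * real \<alpha> * B" "B / 2 \<le> real (card R)" by auto
  have mR: "m \<le> card R" using m cR(2) by linarith
  have "card R * 1 \<le> M" unfolding M_def by (intro mult_le_mono) auto
  then have mM: "m \<le> M" using mR by simp
  have "2 * real M \<le> 2 * ((2 * real \<alpha> * B) * (real h + 1))"
    unfolding M_def of_nat_mult using cR(1) B_pos by (intro mult_left_mono mult_mono) auto
  also have "\<dots> = (4 * real P * real g * (real h + 1)) * B" by (simp add: \<alpha>_def)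
  also have "\<dots> < (real g' * c) * B" using g' B_pos by (rule mult_strict_right_mono)
  finally have M: "2 * real M < real g' * (c * B)" by simp
  have M'_le: "real M' \<le> 3 * B" and M'_gt: "3 * B - 1 < real M'" using B_pos by (auto simp: M'_def)
  have "2 * (3 * B) < (real g * c) * B" using g B_pos by simp
  then have M': "2 * real M' < real g * (c * B)" using M'_le by simp
  have mM': "m \<le> M'" using m M'_gt kB by linarith
  have gle: "real x * (c * B) \<le> real (card V)" if "x \<le> k" for x
  proof -
    have "real x * (c * B) \<le> real k * (1 * B)" using that c B_pos by (intro mult_mono) auto
    then show ?thesis using V_eq by simp
  qed
  have "g \<le> \<alpha>" "g' \<le> \<beta>" using P1 by (auto simp: \<alpha>_def \<beta>_def)
  then have gk: "g \<le> k" "g' \<le> k" using uk u by auto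
  have MV: "M \<le> card V" using M gle[OF gk(2)] by linarith
  have MV': "M' \<le> card V" using M' gle[OF gk(1)] by linarith
  have res: "reservoir M' h R"
    using reservoir_classes[of 0 h g M'] uk u g0 mM' M' unfolding R_def \<alpha>_def P_def by simp
  have res1: "reservoir M h R1"
    using reservoir_classes[of \<alpha> h g' M] uk u g'0 mM M unfolding R1_def \<beta>_def P_def by simp
  have res2: "reservoir M h R2"
    using reservoir_classes[of "\<alpha> + \<beta>" h g' M] uk u g'0 mM M unfolding R2_def \<beta>_def P_def by simp
  have res3: "reservoir M h R3"
    using reservoir_classes[of "\<alpha> + \<beta> + \<beta>" h g' M] uk u g'0 mM M unfolding R3_def \<beta>_def P_def by simp
  show ?thesis
  proof (rule hamilton_cycle_of_reservoirs[OF sub(1) _ h MV MV' res1 res2 res3 res sub(2-4) disj])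
    show "R \<noteq> {}" using cR(2) B_pos by auto
    show "card R * (h + 1) \<le> M" by (simp add: M_def)
    fix A assume A: "A \<subseteq> R1 \<union> R2 \<union> R3"
    define U where "U = V - (R \<union> A)"
    define k' where "k' = k - l"
    define q where "q = card U div k'"
    have k': "0 < k'" "real k' = real k - real l" using uk by (auto simp: k'_def)
    have sub_U: "classes {u..<k} \<subseteq> U"
    proof -
      have "classes {u..<k} \<inter> R = {}" "classes {u..<k} \<inter> R1 = {}" "classes {u..<k} \<inter> R2 = {}"
        "classes {u..<k} \<inter> R3 = {}"
        unfolding Rdefs using uk u by (intro classes_disj; auto)+
      moreover have "classes {u..<k} \<subseteq> V" by (rule classes_V) auto
      ultimately show ?thesis using A unfolding U_def by blast
    qed
    have finU: "finite U" using fin by (simp add: U_def)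
    have "real (card {u..<k}) * ((1 - \<eta>) * B) \<le> real (card (classes {u..<k}))"
      by (rule card_classes_ge) auto
    also have "\<dots> \<le> real (card U)" using card_mono[OF finU sub_U] by simp
    finally have cU: "(real k - real u) * ((1 - \<eta>) * B) \<le> real (card U)" using uk by simp
    have UV: "card U \<le> card V" using fin by (intro card_mono) (auto simp: U_def)
    have "real k' * ((1 + \<eta>) * B + 1) \<le> real (card U)" using pool cU k'(2) unfolding u_def by simp
    then have "(1 + \<eta>) * B + 1 \<le> real (card U) / real k'" using k'(1) by (simp add: pos_le_divide_eq mult.commute)
    moreover have "real (card U) / real k' < real q + 1"
    proof -
      have "real (card U) < real (k' + q * k')"
        unfolding of_nat_less_iff q_def using k'(1) by (rule dividend_less_div_times)
      then show ?thesis using k'(1) by (simp add: pos_divide_less_eq algebra_simps)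
    qed
    ultimately have q_ge: "(1 + \<eta>) * B \<le> real q" by linarith
    have "real q \<le> real (card U) / real k'" 
  proof -
      have "real (q * k') \<le> real (card U)" unfolding of_nat_le_iff q_def by simp
      then show ?thesis using k'(1) by (simp add: pos_le_divide_eq)
    qed
    also have "\<dots> \<le> real k * B / real k'" using UV V_eq by (intro divide_right_mono) auto
    finally have q_le: "real q \<le> real k * B / real k'" .
    have "real k * B \<le> (1 + 2 * c) * real k' * B" using l(3) k'(2) B_pos by (intro mult_right_mono) auto
    then have "real k * B / real k' \<le> (1 + 2 * c) * B" using k'(1) by (simp add: pos_divide_le_eq mult_ac)
    then have q2: "real q \<le> 2 * ((1 / 2 + c) * B)" using q_le by (simp add: algebra_simps)
    have "real k * B \<le> 2 * real k' * B" using l(2) k'(2) B_pos by (intro mult_right_mono) auto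
    then have "real k * B / real k' \<le> 2 * B" using k'(1) by (simp add: pos_divide_le_eq mult_ac)
    then have q3: "real q \<le> 2 * B" using q_le by linarith
    have "\<exists>Ps. length Ps = q + (card U - k' * q) \<and> (\<forall>p\<in>set Ps. p \<noteq> [] \<and> successively adj p) \<and>
      distinct (concat Ps) \<and> set (concat Ps) = U"
    proof (rule path_cover[where W = "\<lambda>i. Cl (l + i)" and M = m])
      show "0 < k'" "U \<subseteq> V" "k' * q \<le> card U" using k' by (auto simp: U_def q_def)
      fix i assume i: "i < k'"
      then have ik: "l + i < k" by (auto simp: k'_def)
      show "Cl (l + i) \<subseteq> U" using sub_U ik uk(1) by (fastforce simp: classes_def)
      show "card (Cl (l + i)) \<le> q" using size(2)[OF ik] q_ge by linarith
      fix T assume T: "T \<subseteq> V"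
      show "card T \<le> card (nb T \<inter> Cl (l + i))" if "card T \<le> m"
        using small[OF ik T that] by linarith
      show "q \<le> 2 * card (nb T \<inter> Cl (l + i))" if "m \<le> card T"
        using large[OF ik T that] q2 by linarith
    next
      fix i j assume "i < k'" "j < k'" "i \<noteq> j"
      then show "Cl (l + i) \<inter> Cl (l + j) = {}" by (intro Cl_disj) (auto simp: k'_def)
    qed
    moreover have "q + (card U - k' * q) < M'"
    proof -
      have "card U - k' * q < k'" unfolding q_def using k'(1)
        by (metis minus_mult_div_eq_mod mod_less_divisor)
      then have "real (q + (card U - k' * q)) \<le> 2 * B + real k" using q3 k'_def by linarith
      then show ?thesis using M'_gt kB by linarith
    qed
    ultimately show "\<exists>Ps. length Ps < M' \<and> (\<forall>p\<in>set Ps. p \<noteq> [] \<and> successively adj p) \<and>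
        distinct (concat Ps) \<and> set (concat Ps) = V - (R \<union> A)"
      unfolding U_def by metis
  qed
qed

end

section \<open>Random colourings and the choice of parameters\<close>

lemma sum_Pow_power_card:
  fixes x :: "'b :: comm_semiring_1"
  assumes "finite V"
  shows "(\<Sum>T\<in>Pow V. x ^ card T) = (1 + x) ^ card V"
  using assms
proof (induction V rule: finite_induct)
  case (insert a V)
  have "Pow V \<inter> insert a ` Pow V = {}" using insert.hyps by auto
  then have "(\<Sum>T\<in>Pow (insert a V). x ^ card T) = (\<Sum>T\<in>Pow V. x ^ card T) + (\<Sum>T\<in>insert a ` Pow V. x ^ card T)"
    using insert.hyps by (simp add: Pow_insert sum.union_disjoint)
  also have "(\<Sum>T\<in>insert a ` Pow V. x ^ card T) = (\<Sum>T\<in>Pow V. x ^ card (insert a T))"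
    using insert.hyps by (intro sum.reindex_cong[of "insert a"]) (auto simp: inj_on_def)
  also have "\<dots> = (\<Sum>T\<in>Pow V. x * x ^ card T)"
  proof (rule sum.cong)
    fix T assume "T \<in> Pow V"
    then have "finite T" "a \<notin> T" using insert.hyps finite_subset by auto
    then show "x ^ card (insert a T) = x * x ^ card T" by simp
  qed simp
  finally show ?case using insert by (simp add: sum_distrib_left[symmetric] distrib_right)
qed simp

lemma one_plus_power_le:
  fixes x :: real
  assumes "0 \<le> x" "real n * x \<le> 1"
  shows "(1 + x) ^ n \<le> 1 + 2 * (real n * x)"
proof -
  have "(1 + x) ^ n \<le> exp x ^ n" using assms(1) by (intro power_mono) (auto simp: exp_ge_add_one_self)
  also have "\<dots> = exp (real n * x)" by (simp add: exp_of_nat_mult)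
  also have "\<dots> \<le> 1 + real n * x + (real n * x)\<^sup>2" using assms by (intro exp_bound) auto
  also have "(real n * x)\<^sup>2 \<le> real n * x * 1"
    unfolding power2_eq_square using assms by (intro mult_left_mono) auto
  finally show ?thesis by (simp add: algebra_simps)
qed

text \<open>For fixed \<open>i\<close> the events \<open>f v = i\<close> are independent with
  probability \<open>1 / k\<close>; the count is therefore binomial, and Hoeffding's inequality
  applies.\<close>

lemma colour_count_tail:
  fixes N V :: "'a set" and e :: real
  assumes V: "finite V" "N \<subseteq> V" "N \<noteq> {}" and i: "i < k" and e: "0 \<le> e"
  shows "measure_pmf.prob (Pi_pmf V k (\<lambda>_. pmf_of_set {..<k}))
      {f. e \<le> \<bar>real (card {v \<in> N. f v = i}) - real (card N) / real k\<bar>} \<le> 2 * exp (- 2 * e\<^sup>2 / real (card N))"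
proof -
  let ?P = "Pi_pmf V k (\<lambda>_. pmf_of_set {..<k})"
  have k: "0 < k" and i': "i \<in> {..<k}" using i by auto
  then have p: "1 / real k \<in> {0..1}" by auto
  have finN: "finite N" using V finite_subset by blast
  then have cN: "0 < card N" using V(3) by (simp add: card_gt_0_iff)
  have "map_pmf (\<lambda>x. x = i) (pmf_of_set {..<k}) = bernoulli_pmf (1 / real k)"
  proof (rule pmf_eqI)
    fix b
    have ne: "{..<k} \<noteq> {}" using i by auto
    have "{..<k} \<inter> {x. x = i} = {i}" "{..<k} \<inter> {x. x \<noteq> i} = {..<k} - {i}" using i by auto
    moreover have "card ({..<k} - {i}) = k - 1" using i by simp
    ultimately have "measure_pmf.prob (pmf_of_set {..<k}) {x. x = i} = 1 / real k"
      "measure_pmf.prob (pmf_of_set {..<k}) {x. x \<noteq> i} = real (k - 1) / real k"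
      using measure_pmf_of_set[OF ne, of "{x. x = i}"] measure_pmf_of_set[OF ne, of "{x. x \<noteq> i}"]
      by simp_all
    moreover have "real (k - 1) / real k = 1 - 1 / real k"
      using k by (simp add: of_nat_diff diff_divide_distrib)
    ultimately have m: "measure_pmf.prob (pmf_of_set {..<k}) {x. x = i} = 1 / real k"
      "measure_pmf.prob (pmf_of_set {..<k}) {x. x \<noteq> i} = 1 - 1 / real k" by simp_all
    show "pmf (map_pmf (\<lambda>x. x = i) (pmf_of_set {..<k})) b = pmf (bernoulli_pmf (1 / real k)) b"
      using m p by (cases b) (auto simp: pmf_map vimage_def)
  qed
  then have "binomial_pmf (card N) (1 / real k) =
      map_pmf (\<lambda>f. card {v \<in> N. f v}) (Pi_pmf N False (\<lambda>_. map_pmf (\<lambda>x. x = i) (pmf_of_set {..<k})))"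
    using binomial_pmf_altdef'[OF finN refl p, of False] by simp
  also have "Pi_pmf N False (\<lambda>_. map_pmf (\<lambda>x. x = i) (pmf_of_set {..<k})) =
      map_pmf (\<lambda>h. (\<lambda>x. x = i) \<circ> h) (Pi_pmf N k (\<lambda>_. pmf_of_set {..<k}))"
    by (rule Pi_pmf_map) (use finN i in auto)
  also have "Pi_pmf N k (\<lambda>_. pmf_of_set {..<k}) = map_pmf (\<lambda>f x. if x \<in> N then f x else k) ?P"
    by (rule Pi_pmf_subset) (use V in auto)
  finally have "binomial_pmf (card N) (1 / real k) = map_pmf (\<lambda>f. card {v \<in> N. f v = i}) ?P"
    by (simp add: map_pmf_comp o_def conj_commute cong: conj_cong)
  then have "measure_pmf.prob ?P {f. e \<le> \<bar>real (card {v \<in> N. f v = i}) - real (card N) / real k\<bar>}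
      = measure_pmf.prob (binomial_pmf (card N) (1 / real k)) {x. \<bar>real x - real (card N) * (1 / real k)\<bar> \<ge> e}"
    by (simp add: vimage_def)
  also have "\<dots> \<le> 2 * exp (- 2 * e\<^sup>2 / real (card N))"
    by (rule binomial_distribution.prob_abs_ge) (use p cN e in \<open>auto simp: binomial_distribution_def\<close>)
  finally show ?thesis .
qed

context fin_graph
begin

text \<open>A union bound. With \<open>x = 1 / n ^ 4\<close> a failure at \<open>T\<close> has
  probability at most \<open>2 * x ^ card T\<close>, and these weights sum over all nonempty
  \<open>T\<close> to \<open>(1 + x) ^ n - 1 \<le> 2 * n * x\<close>. Small sets may lose half of
  the expected neighbours in a class, sets of size \<open>m\<close> may lose
  \<open>c * n / k\<close>, and class sizes may deviate by \<open>\<eta> * n / k\<close>; the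
  hypotheses push each Hoeffding exponent to \<open>4 * ln n * card T\<close>.\<close>

theorem exists_colouring:
  fixes k m :: nat and K c \<eta> :: real
  defines "n \<equiv> card V"
  assumes n: "4 \<le> n" and k: "1 \<le> k" "k \<le> n" and m: "1 \<le> m" and K: "12 * real k \<le> K" "8 * (real k)\<^sup>2 * ln n \<le> K"
    and c: "0 < c" "c\<^sup>2 * real n \<ge> 2 * real m * ln n * (real k)\<^sup>2"
    and \<eta>: "0 < \<eta>" "\<eta>\<^sup>2 * real n \<ge> 2 * ln n * (real k)\<^sup>2"
    and small: "\<And>T. T \<subseteq> V \<Longrightarrow> card T \<le> m \<Longrightarrow> K * real (card T) \<le> real (card (nb T))"
    and large: "\<And>T. T \<subseteq> V \<Longrightarrow> m \<le> card T \<Longrightarrow> (1 / 2 + 2 * c) * real n \<le> real (card (nb T))"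
  shows "\<exists>Cl. (\<forall>i<k. Cl i \<subseteq> V) \<and> (\<forall>i<k. \<forall>j<k. i \<noteq> j \<longrightarrow> Cl i \<inter> Cl j = {}) \<and>
    (\<forall>i<k. \<forall>T\<subseteq>V. card T \<le> m \<longrightarrow> 6 * card T \<le> card (nb T \<inter> Cl i)) \<and>
    (\<forall>i<k. \<forall>T\<subseteq>V. m \<le> card T \<longrightarrow> (1 / 2 + c) * (real n / real k) \<le> real (card (nb T \<inter> Cl i))) \<and>
    (\<forall>i<k. (1 - \<eta>) * (real n / real k) \<le> real (card (Cl i)) \<and> real (card (Cl i)) \<le> (1 + \<eta>) * (real n / real k))"
proof -
  define P where "P = Pi_pmf V k (\<lambda>_. pmf_of_set {..<k})"
  define dev where "dev N i e = {f. e \<le> \<bar>real (card {v \<in> N. f v = i}) - real (card N) / real k\<bar>}" for N :: "'a set" and i :: nat and e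
  define x where "x = exp (- 4 * ln (real n))"
  define \<T> where "\<T> = {T. T \<subseteq> V \<and> T \<noteq> {} \<and> card T \<le> m}"
  \<comment> \<open>Sets of exactly \<open>m\<close> vertices suffice, as neighbourhoods grow with
    \<open>T\<close>; for larger sets the required exponent \<open>4 * ln n * card T\<close> could
    exceed what the deviation \<open>c * n / k\<close> yields.\<close>
  define \<S> where "\<S> = {T. T \<subseteq> V \<and> T \<noteq> {} \<and> card T = m}"
  define E1 where "E1 = (\<lambda>(T, i). dev (nb T) i (real (card (nb T)) / (2 * real k)))"
  define E2 where "E2 = (\<lambda>(T, i). dev (nb T) i (c * real n / real k))"
  define E3 where "E3 = (\<lambda>i. dev V i (\<eta> * real n / real k))"
  have n0: "0 < real n" "0 < ln (real n)" and k0: "0 < real k" using n k by auto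
  have xn: "x = 1 / real n ^ 4" using n0
    by (simp add: x_def exp_minus exp_of_nat_mult[of 4, simplified] inverse_eq_divide)
  have x0: "0 < x" by (simp add: x_def)
  have xpow: "x ^ t = exp (- 4 * ln (real n) * real t)" for t
    by (simp add: x_def exp_of_nat2_mult[symmetric])
  have tail: "measure_pmf.prob P (dev N i e) \<le> 2 * x ^ t"
    if "N \<subseteq> V" "N \<noteq> {}" "i < k" "0 \<le> e" "4 * ln (real n) * real t * real (card N) \<le> 2 * e\<^sup>2" for N i e t
  proof -
    have "0 < real (card N)" using that fin finite_subset card_gt_0_iff by fastforce
    then have "4 * ln (real n) * real t \<le> 2 * e\<^sup>2 / real (card N)" using that(5) by (simp add: pos_le_divide_eq)
    then have "exp (- 2 * e\<^sup>2 / real (card N)) \<le> x ^ t" by (simp add: xpow)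
    then show ?thesis using colour_count_tail[OF fin that(1-4)] unfolding P_def dev_def by simp
  qed
  have nbV: "card (nb T) \<le> n" for T unfolding n_def by (rule card_mono) (use fin nb_subset in auto)
  have fT: "finite \<T>" "finite \<S>" using fin by (auto simp: \<T>_def \<S>_def)
  have K0: "0 < K" using K(1) k0 by linarith
  have p1: "measure_pmf.prob P (E1 (T, i)) \<le> 2 * x ^ card T" if "T \<in> \<T>" "i < k" for T i
  proof -
    have T: "T \<subseteq> V" "card T \<le> m" "0 < card T" using that fin finite_subset by (auto simp: \<T>_def card_gt_0_iff)
    have N: "K * real (card T) \<le> real (card (nb T))" by (rule small) fact+
    have "0 < K * real (card T)" using K0 T(3) by simp
    then have N0: "0 < real (card (nb T))" using N by linarith
    have "8 * (real k)\<^sup>2 * ln n * real (card T) \<le> K * real (card T)" using K(2) by (intro mult_right_mono) auto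
    then have "8 * (real k)\<^sup>2 * ln n * real (card T) \<le> real (card (nb T))" using N by linarith
    then have "8 * (real k)\<^sup>2 * ln n * real (card T) * real (card (nb T)) \<le> (real (card (nb T)))\<^sup>2"
      unfolding power2_eq_square[of "real (card (nb T))"] by (rule mult_right_mono) simp
    then have "4 * ln n * real (card T) * real (card (nb T)) \<le> 2 * (real (card (nb T)) / (2 * real k))\<^sup>2"
      using k0 by (simp add: power_divide power_mult_distrib field_simps)
    then show ?thesis unfolding E1_def prod.case using that N0 nb_subset by (intro tail) auto
  qed
  have p2: "measure_pmf.prob P (E2 (T, i)) \<le> 2 * x ^ card T" if "T \<in> \<S>" "i < k" for T i
  proof -
    have T: "T \<subseteq> V" "card T = m" using that by (auto simp: \<S>_def)
    have "0 < (1 / 2 + 2 * c) * real n" using c n0 by simp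
    then have N0: "0 < real (card (nb T))" using large[of T] T by linarith
    have "2 * real m * ln n * (real k)\<^sup>2 * real (card (nb T)) \<le> c\<^sup>2 * real n * real n"
      by (rule mult_mono) (use c(2) nbV n0 in auto)
    then have "4 * ln n * real (card T) * real (card (nb T)) \<le> 2 * (c * real n / real k)\<^sup>2"
      using k0 T(2) by (simp add: power_divide power_mult_distrib field_simps power2_eq_square)
    then show ?thesis unfolding E2_def prod.case using that N0 nb_subset c n0 by (intro tail) auto
  qed
  have p3: "measure_pmf.prob P (E3 i) \<le> 2 * x" if "i < k" for i
  proof -
    have "4 * ln n * real 1 * real (card V) \<le> 2 * (\<eta> * real n / real k)\<^sup>2"
    proof -
      have "2 * ln n * (real k)\<^sup>2 * real n \<le> \<eta>\<^sup>2 * real n * real n"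
        using \<eta>(2) by (intro mult_right_mono) auto
      then show ?thesis using k0 by (simp add: n_def[symmetric] power_divide power_mult_distrib field_simps power2_eq_square)
    qed
    moreover have "V \<noteq> {}" using n by (auto simp: n_def)
    ultimately have "measure_pmf.prob P (E3 i) \<le> 2 * x ^ 1"
      unfolding E3_def using that \<eta> n0 by (intro tail) auto
    then show ?thesis by simp
  qed
  define Bad where "Bad = (\<Union>z\<in>\<T> \<times> {..<k}. E1 z) \<union> (\<Union>z\<in>\<S> \<times> {..<k}. E2 z) \<union> (\<Union>i<k. E3 i)"
  have sumx: "(\<Sum>T\<in>\<X>. x ^ card T) \<le> 2 * (real n * x)" if "\<X> \<subseteq> {T. T \<subseteq> V \<and> T \<noteq> {}}" for \<X>
  proof -
    have "(\<Sum>T\<in>\<X>. x ^ card T) \<le> (\<Sum>T\<in>Pow V - {{}}. x ^ card T)"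
      by (rule sum_mono2) (use that fin x0 in auto)
    also have "\<dots> = (\<Sum>T\<in>Pow V. x ^ card T) - 1" using fin by (subst sum_diff1) auto
    also have "\<dots> = (1 + x) ^ n - 1" using sum_Pow_power_card[OF fin, of x] by (simp add: n_def)
    also have "\<dots> \<le> 2 * (real n * x)"
    proof -
      have "real n * x = 1 / real n ^ 3" using n0 by (simp add: xn power_numeral_reduce)
      also have "\<dots> \<le> 1" using n by (simp add: one_le_power)
      finally show ?thesis using one_plus_power_le[of x n] x0 by simp
    qed
    finally show ?thesis .
  qed
  have "measure_pmf.prob P (\<Union>z\<in>\<T> \<times> {..<k}. E1 z) \<le> (\<Sum>z\<in>\<T> \<times> {..<k}. measure_pmf.prob P (E1 z))"
    by (rule measure_pmf.finite_measure_subadditive_finite) (use fT in auto)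
  also have "\<dots> = (\<Sum>T\<in>\<T>. \<Sum>i<k. measure_pmf.prob P (E1 (T, i)))" by (simp add: sum.cartesian_product)
  also have "\<dots> \<le> (\<Sum>T\<in>\<T>. \<Sum>i<k. 2 * x ^ card T)" by (intro sum_mono p1) auto
  also have "\<dots> = 2 * real k * (\<Sum>T\<in>\<T>. x ^ card T)" by (simp add: sum_distrib_left mult_ac)
  also have "\<dots> \<le> 2 * real k * (2 * (real n * x))" by (intro mult_left_mono sumx) (auto simp: \<T>_def)
  finally have b1: "measure_pmf.prob P (\<Union>z\<in>\<T> \<times> {..<k}. E1 z) \<le> 4 * real k * real n * x" by simp
  have "measure_pmf.prob P (\<Union>z\<in>\<S> \<times> {..<k}. E2 z) \<le> (\<Sum>z\<in>\<S> \<times> {..<k}. measure_pmf.prob P (E2 z))"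
    by (rule measure_pmf.finite_measure_subadditive_finite) (use fT in auto)
  also have "\<dots> = (\<Sum>T\<in>\<S>. \<Sum>i<k. measure_pmf.prob P (E2 (T, i)))" by (simp add: sum.cartesian_product)
  also have "\<dots> \<le> (\<Sum>T\<in>\<S>. \<Sum>i<k. 2 * x ^ card T)" by (intro sum_mono p2) auto
  also have "\<dots> = 2 * real k * (\<Sum>T\<in>\<S>. x ^ card T)" by (simp add: sum_distrib_left mult_ac)
  also have "\<dots> \<le> 2 * real k * (2 * (real n * x))" by (intro mult_left_mono sumx) (auto simp: \<S>_def)
  finally have b2: "measure_pmf.prob P (\<Union>z\<in>\<S> \<times> {..<k}. E2 z) \<le> 4 * real k * real n * x" by simp
  have "measure_pmf.prob P (\<Union>i<k. E3 i) \<le> (\<Sum>i<k. measure_pmf.prob P (E3 i))"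
    by (rule measure_pmf.finite_measure_subadditive_finite) auto
  also have "\<dots> \<le> (\<Sum>i<k. 2 * x)" by (intro sum_mono p3) auto
  finally have b3: "measure_pmf.prob P (\<Union>i<k. E3 i) \<le> 2 * real k * x" by simp
  have "measure_pmf.prob P Bad \<le> 4 * real k * real n * x + 4 * real k * real n * x + 2 * real k * x"
  proof -
    let ?A = "\<Union>z\<in>\<T> \<times> {..<k}. E1 z" and ?B = "\<Union>z\<in>\<S> \<times> {..<k}. E2 z" and ?C = "\<Union>i<k. E3 i"
    have "measure_pmf.prob P (?A \<union> ?B \<union> ?C) \<le> measure_pmf.prob P (?A \<union> ?B) + measure_pmf.prob P ?C"
      "measure_pmf.prob P (?A \<union> ?B) \<le> measure_pmf.prob P ?A + measure_pmf.prob P ?B"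
      by (rule measure_Un_le; simp)+
    then show ?thesis using b1 b2 b3 unfolding Bad_def by linarith
  qed
  also have "\<dots> = (8 * real n + 2) * x * real k" by (simp add: algebra_simps)
  also have "\<dots> \<le> (8 * real n + 2) * x * real n" using k x0 by (intro mult_left_mono) auto
  also have "\<dots> < 1"
  proof -
    have "(8 * real n + 2) * real n \<le> (9 * real n) * real n" using n by (intro mult_right_mono) auto
    also have "\<dots> = 9 * (real n)\<^sup>2" by (simp add: power2_eq_square)
    also have "\<dots> < (real n)\<^sup>2 * (real n)\<^sup>2"
    proof -
      have "4\<^sup>2 \<le> (real n)\<^sup>2" using n by (intro power_mono) auto
      then have "9 < (real n)\<^sup>2" by simp
      then show ?thesis using n0 by (intro mult_strict_right_mono) auto
    qed
    also have "\<dots> = real n ^ 4" by (simp add: power_add[symmetric])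
    finally show ?thesis using n0 by (simp add: xn field_simps)
  qed
  finally have "Bad \<noteq> UNIV" by (metis less_irrefl measure_pmf.prob_space space_measure_pmf)
  then obtain f where f: "f \<notin> Bad" by auto
  define Cl where "Cl i = {v \<in> V. f v = i}" for i
  have nbCl: "nb T \<inter> Cl i = {v \<in> nb T. f v = i}" for T i using nb_subset by (auto simp: Cl_def)
  have "6 * card T \<le> card (nb T \<inter> Cl i)" if "i < k" "T \<subseteq> V" "card T \<le> m" for i T
  proof (cases "T = {}")
    case False
    then have "f \<notin> E1 (T, i)" using f that by (auto simp: Bad_def \<T>_def)
    then have "real (card (nb T)) / real k - real (card (nb T)) / (2 * real k) < real (card (nb T \<inter> Cl i))"
      by (auto simp: E1_def dev_def nbCl)
    then have "real (card (nb T)) / (2 * real k) < real (card (nb T \<inter> Cl i))" by (simp add: field_simps)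
    moreover have "12 * real k * real (card T) \<le> K * real (card T)" using K(1) by (intro mult_right_mono) auto
    then have "12 * real k * real (card T) \<le> real (card (nb T))" using small[OF that(2,3)] by linarith
    then have "6 * real (card T) \<le> real (card (nb T)) / (2 * real k)" using k0 by (simp add: field_simps)
    ultimately show ?thesis by linarith
  qed simp
  moreover have "(1 / 2 + c) * (real n / real k) \<le> real (card (nb T \<inter> Cl i))"
    if i: "i < k" and T: "T \<subseteq> V" "m \<le> card T" for i T
  proof -
    obtain T' where T': "T' \<subseteq> T" "card T' = m" using T(2) by (meson obtain_subset_with_card_n)
    have "T' \<in> \<S>" using T T' m by (auto simp: \<S>_def)
    then have "f \<notin> E2 (T', i)" using f i by (auto simp: Bad_def)
    then have "real (card (nb T')) / real k - c * real n / real k < real (card (nb T' \<inter> Cl i))"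
      by (auto simp: E2_def dev_def nbCl)
    moreover have "(1 / 2 + 2 * c) * real n / real k \<le> real (card (nb T')) / real k"
      using large[of T'] T T' by (intro divide_right_mono) auto
    moreover have "card (nb T' \<inter> Cl i) \<le> card (nb T \<inter> Cl i)"
      by (rule card_mono) (use nb_mono[OF T'(1)] in auto)
    ultimately show ?thesis by (simp add: algebra_simps add_divide_distrib)
  qed
  moreover have "(1 - \<eta>) * (real n / real k) \<le> real (card (Cl i)) \<and> real (card (Cl i)) \<le> (1 + \<eta>) * (real n / real k)"
    if "i < k" for i
  proof -
    have "f \<notin> E3 i" using f that by (auto simp: Bad_def)
    then have "\<bar>real (card (Cl i)) - real n / real k\<bar> < \<eta> * (real n / real k)"
      by (auto simp: E3_def dev_def Cl_def n_def)
    then show ?thesis unfolding abs_less_iff left_diff_distrib distrib_right by linarith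
  qed
  ultimately show ?thesis by (intro exI[of _ Cl]) (auto simp: Cl_def)
qed


text \<open>Sizes are powers of \<open>x = ln n\<close>: \<open>k\<close> about \<open>x ^ 6\<close>
  classes, \<open>h\<close> of order \<open>x\<close>, \<open>P\<close> of order
  \<open>x ^ 2\<close>, \<open>g'\<close> of order \<open>x ^ 3\<close>. So the reservoirs take at
  most \<open>C * x ^ 5\<close> classes, where \<open>C\<close> collects the constants, and hence at
  most a share \<open>d\<close> of all classes.\<close>

lemma hamilton_cycle_of_expansion:
  fixes c x :: real and g m :: nat
  defines "n \<equiv> card V" and "d \<equiv> c / 6" and "C \<equiv> 18 * (real g + 6 + 648 * real g / c)"
  assumes c: "0 < c" "c \<le> 1 / 6" and g: "6 < real g * c"
    and x: "x = ln (real n)" "100 \<le> x" "2 / c \<le> x" "8 / d \<le> x" "2 * C / d \<le> x" "x ^ 15 \<le> real n"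
    and m: "1 \<le> m" "real m \<le> real n / x ^ 15"
    and small: "\<And>T. T \<subseteq> V \<Longrightarrow> card T \<le> m \<Longrightarrow> x ^ 14 * real (card T) \<le> real (card (nb T))"
    and large: "\<And>T. T \<subseteq> V \<Longrightarrow> m \<le> card T \<Longrightarrow> (1 / 2 + 2 * c) * real n \<le> real (card (nb T))"
  shows "\<exists>vs. vs \<noteq> [] \<and> distinct vs \<and> set vs = V \<and> successively adj vs \<and> adj (last vs) (hd vs)"
proof -
  have p13: "x ^ 13 = x * x ^ 12" and p6: "x ^ 6 = x * x ^ 5" and p3: "x ^ 3 = x * x\<^sup>2"
    by (simp_all add: power_numeral_reduce)
  define k where "k = nat \<lfloor>x ^ 6\<rfloor>"
  define \<eta> where "\<eta> = d / 4"
  \<comment> \<open>Odd, and large enough for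
    \<open>2 ^ h \<ge> 4 ^ nat \<lceil>x\<rceil> \<ge> exp x = n\<close>.\<close>
  define h where "h = 2 * nat \<lceil>x\<rceil> + 1"
  define P where "P = (h + 1) * (2 * h + 2)"
  define g' where "g' = nat \<lceil>4 * real P * real g * (real h + 1) / c\<rceil> + 1"
  \<comment> \<open>Twice the share \<open>d\<close> that the reservoirs may take; the other half
    supplies the padding.\<close>
  define l where "l = nat \<lceil>2 * d * real k\<rceil>"
  define B where "B = real n / real k"
  have d: "0 < d" "d \<le> 1 / 36" "c = 6 * d" using c by (auto simp: d_def)
  have x1: "1 \<le> x" using x(2) by simp
  have pow: "x ^ i \<le> x ^ j" if "i \<le> j" for i j using power_increasing[OF that x1] .
  have pow': "100 * x ^ i \<le> x ^ j" if "i < j" for i j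
  proof -
    have "100 * x ^ i \<le> x * x ^ i" using x(2) x1 by (intro mult_right_mono) auto
    also have "\<dots> \<le> x ^ j" using pow[of "Suc i" j] that by simp
    finally show ?thesis .
  qed
  have xp: "1 \<le> x ^ i" for i using x1 by (rule one_le_power)
  have k_le: "real k \<le> x ^ 6" and k_gt: "x ^ 6 - 1 < real k"
    using xp[of 6] by (auto simp: k_def)
  have k_half: "x ^ 6 / 2 \<le> real k" using k_gt pow'[of 0 6] by simp
  have x6: "x \<le> x ^ 6" using pow[of 1 6] by simp
  have kx: "x / 2 \<le> real k" using k_half x6 by linarith
  have k50: "50 \<le> real k" using kx x(2) by linarith
  have k0: "0 < real k" using k50 by linarith
  have k1: "1 \<le> k" using k50 by linarith
  have "8 / d \<le> 2 * real k" using kx x(4) by linarith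
  then have dk: "4 \<le> d * real k" using d(1) by (simp add: divide_le_eq algebra_simps)
  have n1: "x ^ 15 \<le> real n" by fact
  have nB: "x ^ 9 \<le> B"
  proof -
    have "x ^ 9 * real k \<le> x ^ 9 * x ^ 6" using k_le x1 by (intro mult_left_mono) auto
    also have "\<dots> = x ^ 15" by (simp add: power_add[symmetric])
    finally show ?thesis using n1 k0 by (simp add: B_def pos_le_divide_eq)
  qed
  have B0: "0 < B" using nB xp[of 9] by linarith
  have dB: "2 / d \<le> B"
  proof -
    have "2 / d \<le> 8 / d" using d(1) by (intro divide_right_mono) auto
    also have "\<dots> \<le> x" by fact
    also have "\<dots> \<le> B" using nB pow[of 1 9] by simp
    finally show ?thesis .
  qed
  have k2: "(real k)\<^sup>2 \<le> x ^ 12"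
  proof -
    have "(real k)\<^sup>2 \<le> (x ^ 6)\<^sup>2" using k_le by (intro power_mono) auto
    then show ?thesis by (simp add: power_mult[symmetric])
  qed
  have mB: "real m \<le> B / 2"
  proof -
    have "2 * real k \<le> x ^ 15" using k_le pow'[of 6 15] xp[of 6] by linarith
    then have "real n / x ^ 15 \<le> real n / (2 * real k)" using k0 x1 by (intro divide_left_mono) auto
    then show ?thesis using m(2) by (simp add: B_def)
  qed
  have kB: "real k + 3 \<le> B" using k_le nB pow'[of 6 9] xp[of 6] by linarith
  have kn: "real k \<le> real n" using k_le n1 pow[of 6 15] by linarith
  have "\<exists>Cl. (\<forall>i<k. Cl i \<subseteq> V) \<and> (\<forall>i<k. \<forall>j<k. i \<noteq> j \<longrightarrow> Cl i \<inter> Cl j = {}) \<and>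
    (\<forall>i<k. \<forall>T\<subseteq>V. card T \<le> m \<longrightarrow> 6 * card T \<le> card (nb T \<inter> Cl i)) \<and>
    (\<forall>i<k. \<forall>T\<subseteq>V. m \<le> card T \<longrightarrow> (1 / 2 + c) * (real n / real k) \<le> real (card (nb T \<inter> Cl i))) \<and>
    (\<forall>i<k. (1 - \<eta>) * (real n / real k) \<le> real (card (Cl i)) \<and> real (card (Cl i)) \<le> (1 + \<eta>) * (real n / real k))"
    unfolding n_def
  proof (rule exists_colouring[where K = "x ^ 14"], unfold n_def[symmetric] x(1)[symmetric])
    show "4 \<le> n" using kn k50 by linarith
    show "1 \<le> k" "k \<le> n" "1 \<le> m" using k1 kn m by auto
    show "12 * real k \<le> x ^ 14" using k_le pow'[of 6 14] xp[of 6] by linarith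
    have "8 * (real k)\<^sup>2 * x \<le> 8 * x ^ 12 * x" using k2 x1 by (intro mult_right_mono) auto
    also have "\<dots> = 8 * x ^ 13" unfolding p13 by simp
    also have "\<dots> \<le> x ^ 14" using pow'[of 13 14] xp[of 13] by linarith
    finally show "8 * (real k)\<^sup>2 * x \<le> x ^ 14" .
    show "0 < c" "0 < \<eta>" using c d by (auto simp: \<eta>_def)
    \<comment> \<open>Both concentration hypotheses compare
      \<open>x * k\<^sup>2 \<le> x ^ 13\<close> with a constant times \<open>x ^ 15\<close>, for the
      constants \<open>c\<close> and \<open>\<eta>\<close>.\<close>
    have sq: "2 * x ^ 13 \<le> a\<^sup>2 * x ^ 15" if "2 / a \<le> x" "0 < a" for a
    proof -
      have "2 \<le> a * x" using that by (simp add: divide_le_eq mult.commute)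
      then have "2\<^sup>2 \<le> (a * x)\<^sup>2" by (intro power_mono) auto
      then have "2 * x ^ 13 \<le> (a * x)\<^sup>2 * x ^ 13" using x1 by (intro mult_right_mono) auto
      also have "\<dots> = a\<^sup>2 * x ^ 15" by (simp add: power_mult_distrib power_add[symmetric])
      finally show ?thesis .
    qed
    have "2 * real m * x * (real k)\<^sup>2 \<le> 2 * (real n / x ^ 15) * x * x ^ 12"
      using m(2) k2 x1 by (intro mult_mono) auto
    also have "\<dots> = (2 * x ^ 13) * (real n / x ^ 15)" unfolding p13 by simp
    also have "\<dots> \<le> (c\<^sup>2 * x ^ 15) * (real n / x ^ 15)" using sq[OF x(3) c(1)] x1 by (intro mult_right_mono) auto
    also have "\<dots> = c\<^sup>2 * real n" using x1 by simp
    finally show "2 * real m * x * (real k)\<^sup>2 \<le> c\<^sup>2 * real n" .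
    have "2 / \<eta> \<le> x" using x(4) by (simp add: \<eta>_def)
    have "2 * x * (real k)\<^sup>2 \<le> 2 * x * x ^ 12" using k2 x1 by (intro mult_left_mono) auto
    also have "\<dots> = 2 * x ^ 13" unfolding p13 by simp
    also have "\<dots> \<le> \<eta>\<^sup>2 * x ^ 15" by (rule sq) fact+
    also have "\<dots> \<le> \<eta>\<^sup>2 * real n" using n1 by (intro mult_left_mono) auto
    finally show "2 * x * (real k)\<^sup>2 \<le> \<eta>\<^sup>2 * real n" .
  qed (use small large in auto)
  then obtain Cl where Cl: "\<forall>i<k. Cl i \<subseteq> V" "\<forall>i<k. \<forall>j<k. i \<noteq> j \<longrightarrow> Cl i \<inter> Cl j = {}"
    "\<forall>i<k. \<forall>T\<subseteq>V. card T \<le> m \<longrightarrow> 6 * card T \<le> card (nb T \<inter> Cl i)"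
    "\<forall>i<k. \<forall>T\<subseteq>V. m \<le> card T \<longrightarrow> (1 / 2 + c) * B \<le> real (card (nb T \<inter> Cl i))"
    "\<forall>i<k. (1 - \<eta>) * B \<le> real (card (Cl i)) \<and> real (card (Cl i)) \<le> (1 + \<eta>) * B"
    unfolding B_def by (elim exE conjE)
  interpret coloured_graph V adj Cl k m c \<eta> B
  proof
    show "real (card V) = real k * B" using k0 by (simp add: B_def n_def)
    show "0 \<le> \<eta>" "\<eta> \<le> c" using d by (auto simp: \<eta>_def)
  qed (use Cl c mB kB in auto)
  have h3: "real h + 1 \<le> 3 * x"
  proof -
    have "real (nat \<lceil>x\<rceil>) \<le> x + 1" using x1 by linarith
    then have "2 * real (nat \<lceil>x\<rceil>) + 2 \<le> 3 * x" using x(2) by linarith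
    then show ?thesis unfolding h_def of_nat_add of_nat_mult by simp
  qed
  have Px: "real P \<le> 18 * x\<^sup>2"
  proof -
    have "real P = 2 * (real h + 1)\<^sup>2" by (simp add: P_def power2_eq_square algebra_simps)
    also have "\<dots> \<le> 2 * (3 * x)\<^sup>2" using h3 by (intro mult_left_mono power_mono) auto
    finally show ?thesis by (simp add: power_mult_distrib)
  qed
  have gP: "4 * real P * real g * (real h + 1) / c \<le> 216 * real g / c * x ^ 3"
  proof -
    have "real P * (real h + 1) \<le> (18 * x\<^sup>2) * (3 * x)" using Px h3 x1 by (intro mult_mono) auto
    also have "\<dots> = 54 * x ^ 3" unfolding p3 by simp
    finally have "(4 * real g / c) * (real P * (real h + 1)) \<le> (4 * real g / c) * (54 * x ^ 3)"
      using c by (intro mult_left_mono) auto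
    then show ?thesis by (simp add: mult_ac)
  qed
  have g'_gt: "4 * real P * real g * (real h + 1) / c < real g'" unfolding g'_def by linarith
  have g'_le: "real g' \<le> 216 * real g / c * x ^ 3 + 2"
  proof -
    have "0 \<le> 4 * real P * real g * (real h + 1) / c" using c by simp
    then have "real g' \<le> 4 * real P * real g * (real h + 1) / c + 2" unfolding g'_def by linarith
    then show ?thesis using gP by linarith
  qed
  have u: "real (P * (g + 3 * g')) \<le> d * real k"
  proof -
    have "real g + 3 * real g' \<le> (real g + 6) * 1 + 648 * real g / c * x ^ 3" using g'_le by simp
    also have "\<dots> \<le> (real g + 6) * x ^ 3 + 648 * real g / c * x ^ 3"
      by (rule add_right_mono, rule mult_left_mono) (use xp[of 3] in auto)
    also have "\<dots> = (C / 18) * x ^ 3" by (simp add: C_def algebra_simps)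
    finally have "real P * (real g + 3 * real g') \<le> (18 * x\<^sup>2) * ((C / 18) * x ^ 3)"
      using Px x1 by (intro mult_mono) auto
    also have "\<dots> = C * x ^ 5" by (simp add: power_add[symmetric])
    also have "\<dots> \<le> (d / 2 * x) * x ^ 5"
      using x(5) d(1) x1 by (intro mult_right_mono) (auto simp: divide_le_eq algebra_simps)
    also have "\<dots> = d * (x ^ 6 / 2)" unfolding p6 by simp
    also have "\<dots> \<le> d * real k" using k_half d(1) by (intro mult_left_mono) auto
    finally show ?thesis by simp
  qed
  have l_ge: "2 * d * real k \<le> real l" and l_le: "real l \<le> 2 * d * real k + 1"
  proof -
    have "0 \<le> 2 * d * real k" using d(1) k0 by simp
    then show "2 * d * real k \<le> real l" "real l \<le> 2 * d * real k + 1" unfolding l_def by linarith+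
  qed
  show ?thesis
  proof (rule hamilton_cycle_of_colouring[of h g g' l])
    show "odd h" by (simp add: h_def)
    show "card V \<le> 2 ^ h"
    proof -
      have n0: "0 < real n" using kn k0 by linarith
      have "real n = exp x" using n0 x(1) by simp
      also have "\<dots> \<le> exp (real (nat \<lceil>x\<rceil>))" by (simp add: real_nat_ceiling_ge)
      also have "\<dots> = exp 1 ^ nat \<lceil>x\<rceil>" by (simp add: exp_of_nat_mult[symmetric])
      also have "\<dots> \<le> 4 ^ nat \<lceil>x\<rceil>" using exp_le by (intro power_mono) auto
      also have "\<dots> = 2 ^ (2 * nat \<lceil>x\<rceil>)" by (simp add: power_mult)
      also have "\<dots> \<le> 2 ^ h" by (rule power_increasing) (auto simp: h_def)
      finally have "real (card V) \<le> real (2 ^ h)" by (simp add: n_def)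
      then show ?thesis by (simp only: of_nat_le_iff)
    qed
    show "6 < real g * c" by fact
    show "4 * real ((h + 1) * (2 * h + 2)) * real g * (real h + 1) < real g' * c"
      using g'_gt c(1) unfolding P_def by (simp add: pos_divide_less_eq)
    show "(h + 1) * (2 * h + 2) * (g + 3 * g') \<le> l"
    proof -
      have "real (P * (g + 3 * g')) \<le> real l" using u l_ge d(1) k0 dk by linarith
      then show ?thesis unfolding P_def by (simp only: of_nat_le_iff)
    qed
    have dk36: "d * real k \<le> 1 / 36 * real k" using d(2) k0 by (intro mult_right_mono) auto
    show "2 * l \<le> k"
    proof -
      have "2 * real l \<le> real k" using l_le dk36 k50 by linarith
      then have "real (2 * l) \<le> real k" by simp
      then show ?thesis by (simp only: of_nat_le_iff)
    qed
    have l3: "real l \<le> 3 * (d * real k)" using l_le dk by linarith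
    show "real k \<le> (1 + 2 * c) * (real k - real l)"
    proof -
      have "(1 + 2 * c) * real l \<le> (1 + 2 * c) * (3 * (d * real k))" using l3 c by (intro mult_left_mono) auto
      moreover have "(1 + 2 * c) * (3 * (d * real k)) \<le> 2 * c * real k"
      proof -
        have "(1 + 2 * c) * (3 * d) \<le> 4 * (3 * d)" using c d by (intro mult_right_mono) auto
        also have "\<dots> = 2 * c" using d(3) by simp
        finally have "(1 + 2 * c) * (3 * d) * real k \<le> 2 * c * real k" using k0 by (intro mult_right_mono) auto
        then show ?thesis by (simp add: mult_ac)
      qed
      ultimately show ?thesis by (simp add: algebra_simps)
    qed
    show "(real k - real l) * ((1 + \<eta>) * B + 1) \<le>
        (real k - real ((h + 1) * (2 * h + 2) * (g + 3 * g'))) * ((1 - \<eta>) * B)"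
    proof -
      have oneB: "1 \<le> d / 2 * B" using dB d(1) by (simp add: divide_le_eq algebra_simps)
      have \<eta>0: "0 \<le> \<eta>" using d by (simp add: \<eta>_def)
      have "(real k - real l) * ((1 + \<eta>) * B + 1) \<le> (real k - real l) * ((1 + \<eta>) * B + d / 2 * B)"
        by (rule mult_left_mono) (use oneB l_le dk36 k50 in linarith)+
      also have "\<dots> = (real k - real l) * ((1 + \<eta> + d / 2) * B)" by (simp add: algebra_simps)
      also have "\<dots> \<le> ((1 - 2 * d) * real k) * ((1 + \<eta> + d / 2) * B)"
        using l_ge \<eta>0 d B0 by (intro mult_right_mono) (auto simp: algebra_simps)
      also have "\<dots> = ((1 - 2 * d) * (1 + \<eta> + d / 2)) * (real k * B)" by (simp add: mult_ac)
      also have "\<dots> \<le> ((1 - d) * (1 - \<eta>)) * (real k * B)"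
      proof (rule mult_right_mono)
        \<comment> \<open>With \<open>\<eta> = d / 4\<close> the linear terms of both products are
          \<open>- 5 / 4 * d\<close> and cancel, leaving a positive quadratic remainder.\<close>
        have "(1 - d) * (1 - \<eta>) - (1 - 2 * d) * (1 + \<eta> + d / 2) = d / 4 * (7 * d)"
          unfolding \<eta>_def by (simp add: field_simps)
        moreover have "0 \<le> d / 4 * (7 * d)" using d by simp
        ultimately show "(1 - 2 * d) * (1 + \<eta> + d / 2) \<le> (1 - d) * (1 - \<eta>)" by linarith
      qed (use k0 B0 in auto)
      also have "\<dots> = ((1 - d) * real k) * ((1 - \<eta>) * B)" by (simp add: mult_ac)
      also have "\<dots> \<le> (real k - real (P * (g + 3 * g'))) * ((1 - \<eta>) * B)"
        using u \<eta>0 d B0 by (intro mult_right_mono) (auto simp: algebra_simps \<eta>_def)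
      finally show ?thesis unfolding P_def .
    qed
  qed
qed

end

subsection \<open>Edges leaving a set\<close>

lemma double_count_le:
  fixes b c :: nat
  assumes fin: "finite X" "finite Y"
    and c: "\<And>x. x \<in> X \<Longrightarrow> c \<le> card {y \<in> Y. R x y}" and b: "\<And>y. y \<in> Y \<Longrightarrow> card {x \<in> X. R x y} \<le> b"
  shows "card X * c \<le> card Y * b"
proof -
  have cd: "card {z \<in> Z. Q z} = (\<Sum>z\<in>Z. if Q z then 1 else 0)" if "finite Z" for Z :: "'z set" and Q
    using that by (subst sum.inter_filter[symmetric]) auto
  have "card X * c = (\<Sum>x\<in>X. c)" by simp
  also have "\<dots> \<le> (\<Sum>x\<in>X. card {y \<in> Y. R x y})" by (rule sum_mono) (rule c)
  also have "\<dots> = (\<Sum>x\<in>X. \<Sum>y\<in>Y. if R x y then 1 else 0)"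
    by (simp only: cd[OF fin(2)])
  also have "\<dots> = (\<Sum>y\<in>Y. \<Sum>x\<in>X. if R x y then 1 else 0)" by (rule sum.swap)
  also have "\<dots> = (\<Sum>y\<in>Y. card {x \<in> X. R x y})"
    by (simp only: cd[OF fin(1)])
  also have "\<dots> \<le> (\<Sum>y\<in>Y. b)" by (rule sum_mono) (rule b)
  finally show ?thesis by simp
qed

text \<open>Every factor obeys \<open>N - i \<le> \<alpha> * (n - i)\<close>, because
  \<open>\<alpha> \<le> 1\<close>; the absorption identity peels the factors off one by one.\<close>

lemma choose_scale:
  fixes \<alpha> :: real
  assumes "0 \<le> \<alpha>" "\<alpha> \<le> 1" "real N \<le> \<alpha> * real n"
  shows "real (N choose a) \<le> \<alpha> ^ a * real (n choose a)"
  using assms(3)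
proof (induction a arbitrary: N n)
  case (Suc a)
  show ?case
  proof (cases "N = 0")
    case False
    then have "n \<noteq> 0" using Suc.prems by (cases n) auto
    have "real N - 1 \<le> \<alpha> * (real n - 1)" using Suc.prems assms(2) by (simp add: algebra_simps)
    then have "real (N - 1) \<le> \<alpha> * real (n - 1)" using False \<open>n \<noteq> 0\<close> by (simp add: of_nat_diff)
    then have IH: "real ((N - 1) choose a) \<le> \<alpha> ^ a * real ((n - 1) choose a)" by (rule Suc.IH)
    have "real (Suc a) * real (N choose Suc a) = real N * real ((N - 1) choose a)"
      using binomial_absorption[of a N] by (metis of_nat_mult)
    also have "\<dots> \<le> (\<alpha> * real n) * (\<alpha> ^ a * real ((n - 1) choose a))"
      using Suc.prems IH by (rule mult_mono) (use assms in auto)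
    also have "\<dots> = \<alpha> ^ Suc a * (real n * real ((n - 1) choose a))" by simp
    also have "real n * real ((n - 1) choose a) = real (Suc a) * real (n choose Suc a)"
      using binomial_absorption[of a n] by (metis of_nat_mult)
    finally have "real (Suc a) * real (N choose Suc a) \<le> real (Suc a) * (\<alpha> ^ Suc a * real (n choose Suc a))"
      by (simp add: mult_ac)
    then show ?thesis by (simp only: mult_le_cancel_left_pos of_nat_0_less_iff zero_less_Suc)
  qed (use assms in simp)
qed simp

text \<open>Deleting \<open>j\<close> points from the ground set lowers the number of
  \<open>s\<close>-sets by a factor of at most \<open>((N + j) / (N - s)) ^ j\<close>. It later
  compensates for samples that have to avoid the other vertices of an edge.\<close>

lemma choose_shift:
  fixes N s j :: nat
  shows "(N + j choose s) * (N - s) ^ j \<le> (N choose s) * (N + j) ^ j"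
proof (induction j)
  case (Suc j)
  have "(N - s) * (N + Suc j choose s) \<le> (N + Suc j - s) * (N + Suc j choose s)" by (intro mult_right_mono) auto
  also have "\<dots> = (N + Suc j) * (N + j choose s)" using binomial_absorb_comp[of "N + Suc j" s] by simp
  finally have *: "(N - s) * (N + Suc j choose s) \<le> (N + Suc j) * (N + j choose s)" .
  have "(N + Suc j choose s) * (N - s) ^ Suc j = ((N - s) * (N + Suc j choose s)) * (N - s) ^ j" by simp
  also have "\<dots> \<le> ((N + Suc j) * (N + j choose s)) * (N - s) ^ j" using * by (rule mult_right_mono) simp
  also have "\<dots> = (N + Suc j) * ((N + j choose s) * (N - s) ^ j)" by (rule mult.assoc)
  also have "\<dots> \<le> (N + Suc j) * ((N choose s) * (N + j) ^ j)" using Suc.IH by (rule mult_left_mono) simp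
  also have "\<dots> \<le> (N + Suc j) * ((N choose s) * (N + Suc j) ^ j)"
    by (intro mult_left_mono power_mono) auto
  finally show ?case by (simp add: mult_ac)
qed simp

text \<open>An edge counts once for each of its vertices in \<open>T\<close>, as it does in a sum of
  degrees over \<open>T\<close>.\<close>

definition inner_flags :: "'a set set \<Rightarrow> 'a set \<Rightarrow> 'a set \<Rightarrow> ('a \<times> 'a set) set" where
  "inner_flags E T W = {(v, e). v \<in> T \<and> e \<in> E \<and> v \<in> e \<and> e \<subseteq> W}"

text \<open>Cross edges have exactly one vertex on the \<open>T\<close> side, whereas an inner edge
  may have several. A flag \<open>(v, e)\<close> is seen by each \<open>s\<close>-set consisting of
  \<open>v\<close> and \<open>s - 1\<close> vertices of \<open>T - e\<close>; double counting of
  flags against \<open>s\<close>-sets gives the bound.\<close>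

lemma inner_flags_sampling:
  assumes E: "finite E" "\<And>e. e \<in> E \<Longrightarrow> finite e \<and> card e = r" and T: "finite T"
    and s: "1 \<le> s" and b: "\<And>T'. T' \<subseteq> T \<Longrightarrow> card T' = s \<Longrightarrow> card {e \<in> E. e \<subseteq> W \<and> card (e \<inter> T') = 1} \<le> b"
  shows "card (inner_flags E T W) * (card T - r choose (s - 1)) \<le> (card T choose s) * b"
proof -
  let ?Y = "{T'. T' \<subseteq> T \<and> card T' = s}"
  have "inner_flags E T W \<subseteq> T \<times> E" by (auto simp: inner_flags_def)
  then have finX: "finite (inner_flags E T W)" using E(1) T by (meson finite_SigmaI finite_subset)
  have "card (inner_flags E T W) * (card T - r choose (s - 1)) \<le> card ?Y * b"
  proof (rule double_count_le[where R = "\<lambda>z T'. snd z \<inter> T' = {fst z}"])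
    fix z assume z: "z \<in> inner_flags E T W"
    obtain v e where ve: "z = (v, e)" "v \<in> T" "e \<in> E" "v \<in> e" using z by (auto simp: inner_flags_def)
    have fe: "finite e" "card e = r" using E(2)[OF ve(3)] by auto
    have "card T - r \<le> card (T - e)" using diff_card_le_card_Diff[OF fe(1), of T] fe(2) by simp
    then have "(card T - r choose (s - 1)) \<le> (card (T - e) choose (s - 1))" by (rule binomial_right_mono)
    also have "\<dots> = card {S. S \<subseteq> T - e \<and> card S = s - 1}" using T by (simp add: n_subsets)
    also have "\<dots> = card (insert v ` {S. S \<subseteq> T - e \<and> card S = s - 1})"
    proof (rule card_image[symmetric])
      show "inj_on (insert v) {S. S \<subseteq> T - e \<and> card S = s - 1}"
        using ve(4) unfolding inj_on_def by (metis (no_types, lifting) DiffE insert_ident mem_Collect_eq subsetD)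
    qed
    also have "\<dots> \<le> card {T' \<in> ?Y. snd z \<inter> T' = {fst z}}"
    proof (rule card_mono)
      show "finite {T' \<in> ?Y. snd z \<inter> T' = {fst z}}" using T by simp
      show "insert v ` {S. S \<subseteq> T - e \<and> card S = s - 1} \<subseteq> {T' \<in> ?Y. snd z \<inter> T' = {fst z}}"
      proof
        fix T' assume "T' \<in> insert v ` {S. S \<subseteq> T - e \<and> card S = s - 1}"
        then obtain S where S: "T' = insert v S" "S \<subseteq> T - e" "card S = s - 1" by auto
        have "finite S" "v \<notin> S" using S(2) T ve(4) finite_subset by auto
        then have "card T' = s" using S s by simp
        then show "T' \<in> {T' \<in> ?Y. snd z \<inter> T' = {fst z}}" using S ve by auto
      qed
    qed
    finally show "(card T - r choose (s - 1)) \<le> card {T' \<in> ?Y. snd z \<inter> T' = {fst z}}" .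
  next
    fix T' assume T': "T' \<in> ?Y"
    have "card {z \<in> inner_flags E T W. snd z \<inter> T' = {fst z}} \<le> card {e \<in> E. e \<subseteq> W \<and> card (e \<inter> T') = 1}"
    proof (rule card_inj_on_le[where f = snd])
      show "inj_on snd {z \<in> inner_flags E T W. snd z \<inter> T' = {fst z}}" by (auto simp: inj_on_def prod_eq_iff)
    qed (use E(1) in \<open>auto simp: inner_flags_def\<close>)
    also have "\<dots> \<le> b" by (rule b) (use T' in auto)
    finally show "card {z \<in> inner_flags E T W. snd z \<inter> T' = {fst z}} \<le> b" .
  qed (use T finX in auto)
  then show ?thesis using n_subsets[OF T, of s] by simp
qed

text \<open>Shrinks the \<open>U\<close> side until it is no larger than the \<open>T\<close> side.
  An edge is counted by the \<open>u\<close>-sets containing \<open>e \<inter> U\<close>, and the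
  identity \<open>choose_mult\<close> turns their number into the ratio of
  \<open>card U choose a\<close> to \<open>u choose a\<close>.\<close>

lemma cross_edges_sampling:
  assumes E: "finite E" "\<And>e. e \<in> E \<Longrightarrow> finite e" and U: "finite U" "u \<le> card U" "a \<le> u"
    and b: "\<And>U'. U' \<subseteq> U \<Longrightarrow> card U' = u \<Longrightarrow> card {e \<in> E. card (e \<inter> T) = 1 \<and> card (e \<inter> U') = a} \<le> b"
  shows "card {e \<in> E. card (e \<inter> T) = 1 \<and> card (e \<inter> U) = a} * (u choose a) \<le> (card U choose a) * b"
proof -
  let ?F = "{e \<in> E. card (e \<inter> T) = 1 \<and> card (e \<inter> U) = a}"
  let ?Y = "{U'. U' \<subseteq> U \<and> card U' = u}"
  let ?c = "card U - a choose (u - a)"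
  have "card ?F * ?c \<le> card ?Y * b"
  proof (rule double_count_le[where R = "\<lambda>e U'. e \<inter> U \<subseteq> U'"])
    fix e assume e: "e \<in> ?F"
    have fe: "finite (e \<inter> U)" using U(1) by simp
    have "?c = card {S. S \<subseteq> U - e \<and> card S = u - a}"
    proof -
      have "card (U - e) = card U - a" using e U(1) by (simp add: card_Diff_subset_Int Int_commute)
      then show ?thesis using n_subsets[of "U - e" "u - a"] U(1) by simp
    qed
    also have "\<dots> = card ((\<lambda>S. e \<inter> U \<union> S) ` {S. S \<subseteq> U - e \<and> card S = u - a})"
      by (rule card_image[symmetric]) (auto simp: inj_on_def)
    also have "\<dots> \<le> card {U' \<in> ?Y. e \<inter> U \<subseteq> U'}"
    proof (rule card_mono)
      show "finite {U' \<in> ?Y. e \<inter> U \<subseteq> U'}" using U(1) by simp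
      have "card (e \<inter> U \<union> S) = u" if "S \<subseteq> U - e" "card S = u - a" for S
      proof -
        have "finite S" "e \<inter> U \<inter> S = {}" using that U(1) finite_subset by auto
        then show ?thesis using that e U(3) fe by (simp add: card_Un_disjoint)
      qed
      then show "(\<lambda>S. e \<inter> U \<union> S) ` {S. S \<subseteq> U - e \<and> card S = u - a} \<subseteq> {U' \<in> ?Y. e \<inter> U \<subseteq> U'}" by auto
    qed
    finally show "?c \<le> card {U' \<in> ?Y. e \<inter> U \<subseteq> U'}" .
  next
    fix U' assume U': "U' \<in> ?Y"
    have "card {e \<in> ?F. e \<inter> U \<subseteq> U'} \<le> card {e \<in> E. card (e \<inter> T) = 1 \<and> card (e \<inter> U') = a}"
    proof (rule card_mono)
      show "{e \<in> ?F. e \<inter> U \<subseteq> U'} \<subseteq> {e \<in> E. card (e \<inter> T) = 1 \<and> card (e \<inter> U') = a}"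
      proof
        fix e assume e: "e \<in> {e \<in> ?F. e \<inter> U \<subseteq> U'}"
        then have "e \<inter> U' = e \<inter> U" using U' by auto
        then show "e \<in> {e \<in> E. card (e \<inter> T) = 1 \<and> card (e \<inter> U') = a}" using e by auto
      qed
    qed (use E(1) in auto)
    also have "\<dots> \<le> b" by (rule b) (use U' in auto)
    finally show "card {e \<in> ?F. e \<inter> U \<subseteq> U'} \<le> b" .
  qed (use E(1) U(1) in auto)
  then have "card ?F * ?c \<le> (card U choose u) * b" using n_subsets[OF U(1), of u] by simp
  then have "card ?F * ?c * (u choose a) \<le> (card U choose u) * b * (u choose a)" by (rule mult_right_mono) simp
  also have "\<dots> = ((card U choose u) * (u choose a)) * b" by simp
  also have "\<dots> = (card U choose a) * ?c * b" using choose_mult[OF U(3,2)] by simp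
  finally have "(card ?F * (u choose a)) * ?c \<le> ((card U choose a) * b) * ?c" by (simp add: mult_ac)
  moreover have "0 < ?c" using U(2,3) by (simp add: zero_less_binomial_iff)
  ultimately show ?thesis by (simp only: mult_le_cancel2)
qed

text \<open>Both samples have size \<open>s\<close>, so the hypothesis on \<open>T'\<close> and
  \<open>U\<close> is what pseudorandomness provides for disjoint sets of equal size.
  \<open>U\<close> is drawn from \<open>W - T'\<close>, which contains the remaining
  \<open>r - 1\<close> vertices of each edge counted.\<close>

lemma inner_flags_le_sampled:
  fixes Q :: real
  assumes E: "finite E" "\<And>e. e \<in> E \<Longrightarrow> finite e \<and> card e = r" and W: "finite W" "T \<subseteq> W" and r: "2 \<le> r"
    and Q0: "0 \<le> Q" and s: "1 \<le> s" "r - 1 \<le> s" "r \<le> card T" "2 * s \<le> card W"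
    and Q: "\<And>T' U. T' \<subseteq> T \<Longrightarrow> U \<subseteq> W \<Longrightarrow> T' \<inter> U = {} \<Longrightarrow> card T' = s \<Longrightarrow> card U = s \<Longrightarrow>
        real (card {e \<in> E. card (e \<inter> T') = 1 \<and> card (e \<inter> U) = r - 1}) \<le> real s * Q"
  shows "real (card (inner_flags E T W)) * real (s choose (r - 1)) * real (card T - r - (s - 1)) ^ (r - 1)
    \<le> real (card T) ^ r * real (card W choose (r - 1)) * Q"
proof -
  define t where "t = card T"
  define a where "a = r - 1"
  have finT: "finite T" using W finite_subset by blast
  \<comment> \<open>The counting lemmas take natural bounds; rounding \<open>s * Q\<close> down here
    and the quotient \<open>b'\<close> below loses nothing for integer counts.\<close>
  define b where "b = nat \<lfloor>real s * Q\<rfloor>"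
  define G where "G T' = {e \<in> E. e \<subseteq> W \<and> card (e \<inter> T') = 1}" for T'
  have Gb: "card (G T') * (s choose a) \<le> (card W choose a) * b" if T': "T' \<subseteq> T" "card T' = s" for T'
  proof -
    have finT': "finite T'" using T' finT finite_subset by blast
    have "G T' \<subseteq> {e \<in> E. card (e \<inter> T') = 1 \<and> card (e \<inter> (W - T')) = a}"
    proof
      fix e assume e: "e \<in> G T'"
      then have "e \<inter> (W - T') = e - e \<inter> T'" by (auto simp: G_def)
      moreover have "finite e" "card e = r" using e E(2) by (auto simp: G_def)
      ultimately have "card (e \<inter> (W - T')) = a" using e by (simp add: G_def card_Diff_subset a_def)
      then show "e \<in> {e \<in> E. card (e \<inter> T') = 1 \<and> card (e \<inter> (W - T')) = a}" using e by (auto simp: G_def)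
    qed
    then have "card (G T') \<le> card {e \<in> E. card (e \<inter> T') = 1 \<and> card (e \<inter> (W - T')) = a}"
      using E(1) by (intro card_mono) auto
    then have "card (G T') * (s choose a) \<le> card {e \<in> E. card (e \<inter> T') = 1 \<and> card (e \<inter> (W - T')) = a} * (s choose a)"
      by (rule mult_right_mono) simp
    also have "\<dots> \<le> (card (W - T') choose a) * b"
    proof (rule cross_edges_sampling)
      have "card (W - T') = card W - s" using T' W finT' by (subst card_Diff_subset) auto
      then show "s \<le> card (W - T')" using s(4) by simp
      show "a \<le> s" using s(2) by (simp add: a_def)
      fix U assume U: "U \<subseteq> W - T'" "card U = s"
      then have "real (card {e \<in> E. card (e \<inter> T') = 1 \<and> card (e \<inter> U) = a}) \<le> real s * Q"
        unfolding a_def by (intro Q T') auto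
      then show "card {e \<in> E. card (e \<inter> T') = 1 \<and> card (e \<inter> U) = a} \<le> b" unfolding b_def by linarith
    qed (use E W in auto)
    also have "\<dots> \<le> (card W choose a) * b"
      using W(1) by (intro mult_right_mono binomial_right_mono card_mono) auto
    finally show ?thesis .
  qed
  define b' where "b' = (card W choose a) * b div (s choose a)"
  have sa: "0 < (s choose a)" using s(2) by (simp add: a_def zero_less_binomial_iff)
  have "card (inner_flags E T W) * (t - r choose (s - 1)) \<le> (t choose s) * b'"
    unfolding t_def
  proof (rule inner_flags_sampling[OF E finT s(1)])
    fix T' assume "T' \<subseteq> T" "card T' = s"
    from Gb[OF this] show "card {e \<in> E. e \<subseteq> W \<and> card (e \<inter> T') = 1} \<le> b'"
      unfolding G_def b'_def using sa by (simp add: less_eq_div_iff_mult_less_eq)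
  qed
  then have "card (inner_flags E T W) * (t - r choose (s - 1)) * (s choose a) \<le> (t choose s) * b' * (s choose a)"
    by (rule mult_right_mono) simp
  also have "\<dots> = (t choose s) * (b' * (s choose a))" by simp
  also have "\<dots> \<le> (t choose s) * ((card W choose a) * b)" unfolding b'_def by (intro mult_left_mono) auto
  finally have 1: "card (inner_flags E T W) * (t - r choose (s - 1)) * (s choose a) \<le> (t choose s) * ((card W choose a) * b)" .
  define N where "N = t - r"
  have Na: "N + a = t - 1" using s(3) r by (simp add: N_def a_def t_def)
  have 2: "(t - 1 choose (s - 1)) * (N - (s - 1)) ^ a \<le> (N choose (s - 1)) * t ^ a"
  proof -
    have "(t - 1 choose (s - 1)) * (N - (s - 1)) ^ a \<le> (N choose (s - 1)) * (t - 1) ^ a"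
      using choose_shift[of N a "s - 1"] by (simp add: Na)
    also have "\<dots> \<le> (N choose (s - 1)) * t ^ a" by (intro mult_left_mono power_mono) auto
    finally show ?thesis .
  qed
  have b: "real b \<le> real s * Q" using Q0 by (simp add: b_def)
  show ?thesis
  proof (cases "N choose (s - 1) = 0")
    \<comment> \<open>With too few vertices left to sample, the truncated difference
      \<open>card T - r - (s - 1)\<close> is zero, and so is the left-hand side.\<close>
    case True
    then have "card T - r - (s - 1) = 0" by (simp add: N_def t_def binomial_eq_0_iff)
    then show ?thesis using r Q0 by (simp add: power_0_left)
  next
    case False
    let ?w = "real (card (inner_flags E T W))" and ?cW = "real (card W choose a)" and ?cN = "real (N choose (s - 1))"
      and ?M = "real ((N - (s - 1)) ^ a)"
    have "?w * ?cN * real (s choose a) = real (card (inner_flags E T W) * (t - r choose (s - 1)) * (s choose a))"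
      by (simp add: N_def)
    also have "\<dots> \<le> real ((t choose s) * ((card W choose a) * b))" using 1 by (simp only: of_nat_le_iff)
    also have "\<dots> = real (t choose s) * ?cW * real b" by simp
    also have "\<dots> \<le> real (t choose s) * ?cW * (real s * Q)" using b by (intro mult_left_mono) auto
    also have "\<dots> = real (s * (t choose s)) * ?cW * Q" by simp
    also have "s * (t choose s) = t * (t - 1 choose (s - 1))" using s(1) by (simp add: times_binomial_minus1_eq)
    finally have 3: "?w * ?cN * real (s choose a) \<le> real (t * (t - 1 choose (s - 1))) * ?cW * Q" .
    have "?cN * (?w * real (s choose a) * ?M) = (?w * ?cN * real (s choose a)) * ?M" by simp
    also have "\<dots> \<le> (real (t * (t - 1 choose (s - 1))) * ?cW * Q) * ?M" using 3 by (rule mult_right_mono) simp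
    also have "\<dots> = real t * ?cW * Q * real ((t - 1 choose (s - 1)) * (N - (s - 1)) ^ a)" by simp
    also have "\<dots> \<le> real t * ?cW * Q * real ((N choose (s - 1)) * t ^ a)"
      using 2 Q0 by (intro mult_left_mono) (auto simp only: of_nat_le_iff intro!: mult_nonneg_nonneg of_nat_0_le_iff)
    also have "\<dots> = ?cN * (real t * real t ^ a * ?cW * Q)" by simp
    finally have "?w * real (s choose a) * ?M \<le> real t * real t ^ a * ?cW * Q"
      using False by (simp only: mult_le_cancel_left_pos of_nat_0_less_iff neq0_conv)
    moreover have "real t * real t ^ a = real t ^ r" using r by (cases r) (simp_all add: a_def)
    ultimately show ?thesis by (simp add: N_def t_def a_def)
  qed
qed

text \<open>Samples of about \<open>\<eta> * card T\<close> vertices cost only a factor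
  \<open>(1 / (1 - 2 * \<eta>)) ^ a\<close> near 1, and the main term is the share
  \<open>\<alpha> ^ a\<close> of all \<open>a\<close>-sets that can lie in \<open>W\<close>. The
  additive error \<open>lam\<close> is inflated by the ratio of \<open>card W choose a\<close> to
  \<open>s choose a\<close>, a power of \<open>\<kappa> / \<eta>\<close>.\<close>

lemma inner_flags_bound:
  fixes \<alpha> \<eta> \<epsilon> p lam \<kappa> :: real and r :: nat
  defines "a \<equiv> r - 1"
  assumes V: "finite V" and E: "\<And>e. e \<in> E \<Longrightarrow> e \<subseteq> V \<and> card e = r" and r: "2 \<le> r"
    and W: "T \<subseteq> W" "W \<subseteq> V" "real (card W) \<le> \<alpha> * real (card V)" "real (card W) \<le> \<kappa> * real (card T)"
    and \<alpha>: "0 \<le> \<alpha>" "\<alpha> \<le> 1" and \<eta>: "0 < \<eta>" "\<eta> \<le> 1 / 4" "2 * real r \<le> \<eta> * real (card T)"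
    and p: "0 \<le> p" "0 \<le> \<epsilon>" "0 \<le> lam"
    and pr: "\<And>T U. T \<subseteq> V \<Longrightarrow> U \<subseteq> V \<Longrightarrow> T \<inter> U = {} \<Longrightarrow> card U \<le> card T \<Longrightarrow>
        real (card {e \<in> E. card (e \<inter> T) = 1 \<and> card (e \<inter> U) = a})
          \<le> (1 + \<epsilon>) * p * real (card T) * real (card U choose a) + real (card T) * lam"
  shows "real (card (inner_flags E T W)) \<le> real (card T) *
     ((1 / (1 - 2 * \<eta>)) ^ a * ((1 + \<epsilon>) * \<alpha> ^ a * (p * real (card V choose a)) + lam * (2 * real a * \<kappa> / \<eta>) ^ a))"
proof -
  define t where "t = real (card T)"
  define s where "s = nat \<lfloor>\<eta> * t\<rfloor>"
  define Q where "Q = (1 + \<epsilon>) * p * real (s choose a) + lam"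
  define w where "w = real (card (inner_flags E T W))"
  have a1: "1 \<le> a" using r by (simp add: a_def)
  have \<eta>t: "2 * real r \<le> \<eta> * t" using \<eta>(3) by (simp add: t_def)
  have s_le: "real s \<le> \<eta> * t" and s_gt: "\<eta> * t - 1 < real s" using \<eta>t unfolding s_def by linarith+
  have s_half: "\<eta> * t / 2 \<le> real s" using s_gt \<eta>t r by linarith
  have sr: "real r \<le> real s" using s_gt \<eta>t r by linarith
  then have sa: "a \<le> s" "1 \<le> s" using r by (auto simp: a_def)
  have "\<eta> * t \<le> 1 / 4 * t" using \<eta> by (intro mult_right_mono) (auto simp: t_def)
  then have t8: "4 * (\<eta> * t) \<le> t" by simp
  have t0: "0 < t" using t8 \<eta>t r by linarith
  have finW: "finite W" using W V finite_subset by blast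
  have finE: "finite E" using E V by (intro finite_subset[of E "Pow V"]) auto
  have TW: "t \<le> real (card W)" unfolding t_def using card_mono[OF finW W(1)] by simp
  have "w * real (s choose (r - 1)) * real (card T - r - (s - 1)) ^ (r - 1)
    \<le> real (card T) ^ r * real (card W choose (r - 1)) * Q"
    unfolding w_def
  proof (rule inner_flags_le_sampled[OF finE _ finW W(1) r])
    show "finite e \<and> card e = r" if "e \<in> E" for e using E[OF that] V finite_subset by blast
    show "0 \<le> Q" using p by (simp add: Q_def)
    show "1 \<le> s" "r - 1 \<le> s" using sa by (auto simp: a_def)
    have "real r \<le> real (card T)" using t8 \<eta>t by (simp add: t_def)
    then show "r \<le> card T" by simp
    have "2 * real s \<le> real (card W)" using s_le t8 TW t0 by linarith
    then have "real (2 * s) \<le> real (card W)" by simp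
    then show "2 * s \<le> card W" by (simp only: of_nat_le_iff)
    fix T' U assume TU: "T' \<subseteq> T" "U \<subseteq> W" "T' \<inter> U = {}" "card T' = s" "card U = s"
    have "T' \<subseteq> V" "U \<subseteq> V" using TU W by auto
    from pr[OF this TU(3)] TU
    show "real (card {e \<in> E. card (e \<inter> T') = 1 \<and> card (e \<inter> U) = r - 1}) \<le> real s * Q"
      by (simp add: Q_def a_def algebra_simps)
  qed
  then have main: "w * real (s choose a) * real (card T - r - (s - 1)) ^ a \<le> t ^ r * real (card W choose a) * Q"
    by (simp add: a_def t_def)
  have "(1 - 2 * \<eta>) * t \<le> real (card T - r - (s - 1))"
  proof -
    have "(1 - 2 * \<eta>) * t = t - 2 * (\<eta> * t)" by (simp add: algebra_simps)
    also have "\<dots> \<le> t - real r - real s" using s_le \<eta>t by linarith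
    also have "\<dots> \<le> real (card T - r - (s - 1))" unfolding t_def by linarith
    finally show ?thesis .
  qed
  then have "((1 - 2 * \<eta>) * t) ^ a \<le> real (card T - r - (s - 1)) ^ a"
    using \<eta> t0 by (intro power_mono) auto
  then have "w * real (s choose a) * ((1 - 2 * \<eta>) * t) ^ a \<le> w * real (s choose a) * real (card T - r - (s - 1)) ^ a"
    by (intro mult_left_mono) (auto simp: w_def)
  also note main
  finally have m2: "w * real (s choose a) * ((1 - 2 * \<eta>) * t) ^ a \<le> t ^ r * real (card W choose a) * Q" .
  have cs: "0 < real (s choose a)" using sa by (simp add: zero_less_binomial_iff)
  have tr: "t ^ r = t * t ^ a" using r by (cases r) (auto simp: a_def)
  have "t ^ a * real (s choose a) * (w * (1 - 2 * \<eta>) ^ a) \<le> t ^ a * real (s choose a) * (t * (real (card W choose a) * Q / real (s choose a)))"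
    using m2 cs unfolding tr power_mult_distrib by (simp add: mult_ac)
  then have m3: "w * (1 - 2 * \<eta>) ^ a \<le> t * (real (card W choose a) * Q / real (s choose a))"
    using t0 cs by (simp only: mult_le_cancel_left_pos mult_pos_pos zero_less_power)
  have "real (card W choose a) * Q / real (s choose a) =
      (1 + \<epsilon>) * p * real (card W choose a) + lam * (real (card W choose a) / real (s choose a))"
    using cs by (simp add: Q_def field_simps)
  also have "\<dots> \<le> (1 + \<epsilon>) * p * (\<alpha> ^ a * real (card V choose a)) + lam * (2 * real a * \<kappa> / \<eta>) ^ a"
  proof (rule add_mono; rule mult_left_mono)
    show "real (card W choose a) \<le> \<alpha> ^ a * real (card V choose a)" by (rule choose_scale[OF \<alpha> W(3)])
    have "a \<le> card W" using t8 \<eta>t TW r unfolding a_def by linarith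
    then have "real (card W choose a) \<le> real (card W) ^ a" using binomial_le_pow by (metis of_nat_le_iff of_nat_power)
    also have "\<dots> \<le> (\<kappa> * t) ^ a" using W(4) by (intro power_mono) (auto simp: t_def)
    finally have 1: "real (card W choose a) \<le> (\<kappa> * t) ^ a" .
    have "(\<eta> * t / 2 / real a) ^ a \<le> (real s / real a) ^ a"
      using s_half \<eta> t0 by (intro power_mono divide_right_mono) auto
    also have "\<dots> \<le> real (s choose a)" by (rule binomial_ge_n_over_k_pow_k) (use sa in simp)
    finally have 2: "(\<eta> * t / 2 / real a) ^ a \<le> real (s choose a)" .
    have pos: "0 < (\<eta> * t / 2 / real a) ^ a" using \<eta> t0 a1 by simp
    have "real (card W choose a) / real (s choose a) \<le> (\<kappa> * t) ^ a / (\<eta> * t / 2 / real a) ^ a"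
      using 1 2 pos by (intro frac_le) auto
    also have "\<dots> = ((\<kappa> * t) / (\<eta> * t / 2 / real a)) ^ a" by (simp only: power_divide)
    also have "(\<kappa> * t) / (\<eta> * t / 2 / real a) = 2 * real a * \<kappa> / \<eta>" using t0 \<eta> a1 by (simp add: field_simps)
    finally show "real (card W choose a) / real (s choose a) \<le> (2 * real a * \<kappa> / \<eta>) ^ a" .
  qed (use p in auto)
  finally have m4: "real (card W choose a) * Q / real (s choose a) \<le>
      (1 + \<epsilon>) * \<alpha> ^ a * (p * real (card V choose a)) + lam * (2 * real a * \<kappa> / \<eta>) ^ a" by (simp add: mult_ac)
  have "w * (1 - 2 * \<eta>) ^ a \<le> t * ((1 + \<epsilon>) * \<alpha> ^ a * (p * real (card V choose a)) + lam * (2 * real a * \<kappa> / \<eta>) ^ a)"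
    using m3 mult_left_mono[OF m4, of t] t0 by linarith
  moreover have "0 < (1 - 2 * \<eta>) ^ a" using \<eta> by simp
  ultimately have "w \<le> t * ((1 + \<epsilon>) * \<alpha> ^ a * (p * real (card V choose a)) + lam * (2 * real a * \<kappa> / \<eta>) ^ a) / (1 - 2 * \<eta>) ^ a"
    by (simp add: pos_le_divide_eq)
  then show ?thesis by (simp add: w_def t_def power_divide mult_ac)
qed

text \<open>Substitute for sampling when \<open>T\<close> has bounded size: every flag contains a
  second vertex of \<open>W\<close>, and the codegree bounds the edges through such a pair.\<close>

lemma inner_flags_codegree:
  fixes \<Delta> :: nat
  assumes V: "finite V" and E: "\<And>e. e \<in> E \<Longrightarrow> e \<subseteq> V \<and> card e = r" and r: "2 \<le> r"
    and W: "T \<subseteq> W" "W \<subseteq> V"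
    and codeg: "\<And>u v. u \<in> V \<Longrightarrow> v \<in> V \<Longrightarrow> u \<noteq> v \<Longrightarrow> card {e \<in> E. {u, v} \<subseteq> e} \<le> \<Delta>"
  shows "card (inner_flags E T W) \<le> card T * card W * \<Delta>"
proof -
  have finW: "finite W" "finite T" using W V by (meson finite_subset)+
  have finE: "finite E" using E V by (intro finite_subset[of E "Pow V"]) auto
  define D where "D = {z \<in> T \<times> W. fst z \<noteq> snd z}"
  have "inner_flags E T W \<subseteq> (\<Union>z\<in>D. Pair (fst z) ` {e \<in> E. {fst z, snd z} \<subseteq> e})"
  proof
    fix z assume "z \<in> inner_flags E T W"
    then obtain v e where ve: "z = (v, e)" "v \<in> T" "e \<in> E" "v \<in> e" "e \<subseteq> W" by (auto simp: inner_flags_def)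
    have "e \<noteq> {v}" using E[OF ve(3)] r by auto
    then obtain y where "y \<in> e" "y \<noteq> v" using ve(4) by auto
    then show "z \<in> (\<Union>z\<in>D. Pair (fst z) ` {e \<in> E. {fst z, snd z} \<subseteq> e})"
      using ve by (intro UN_I[of "(v, y)"]) (auto simp: D_def)
  qed
  then have "card (inner_flags E T W) \<le> card (\<Union>z\<in>D. Pair (fst z) ` {e \<in> E. {fst z, snd z} \<subseteq> e})"
    using finE finW by (intro card_mono) (auto simp: D_def)
  also have "\<dots> \<le> (\<Sum>z\<in>D. card (Pair (fst z) ` {e \<in> E. {fst z, snd z} \<subseteq> e}))"
    by (rule card_UN_le) (use finW in \<open>simp add: D_def\<close>)
  also have "\<dots> \<le> (\<Sum>z\<in>D. \<Delta>)"
  proof (rule sum_mono)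
    fix z assume "z \<in> D"
    then have "card {e \<in> E. {fst z, snd z} \<subseteq> e} \<le> \<Delta>" using W by (intro codeg) (auto simp: D_def)
    moreover have "card (Pair (fst z) ` {e \<in> E. {fst z, snd z} \<subseteq> e}) \<le> card {e \<in> E. {fst z, snd z} \<subseteq> e}"
      using finE by (intro card_image_le) auto
    ultimately show "card (Pair (fst z) ` {e \<in> E. {fst z, snd z} \<subseteq> e}) \<le> \<Delta>" by linarith
  qed
  also have "\<dots> \<le> card T * card W * \<Delta>"
  proof -
    have "card D \<le> card (T \<times> W)" using finW by (intro card_mono) (auto simp: D_def)
    then have "card D \<le> card T * card W" by (simp add: card_cartesian_product)
    then show ?thesis by simp
  qed
  finally show ?thesis .
qed

text \<open>The sum of the \<open>H\<close>-degrees over \<open>T\<close> counts flags. Those inside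
  \<open>W\<close> are among the flags of \<open>E\<close>, and each edge leaving \<open>W\<close>
  accounts for at most \<open>r\<close> of the others.\<close>

lemma leaving_edges_ge:
  fixes \<delta> :: real
  assumes V: "finite V" and E: "\<And>e. e \<in> E \<Longrightarrow> e \<subseteq> V \<and> card e = r" and H: "H \<subseteq> E" and W: "T \<subseteq> W" "W \<subseteq> V"
    and deg: "\<And>v. v \<in> V \<Longrightarrow> \<delta> \<le> real (card {e \<in> H. v \<in> e})"
  shows "real (card T) * \<delta> \<le> real (card (inner_flags E T W)) + real r * real (card {e \<in> H. e \<inter> T \<noteq> {} \<and> \<not> e \<subseteq> W})"
proof -
  let ?F = "{e \<in> H. e \<inter> T \<noteq> {} \<and> \<not> e \<subseteq> W}"
  have finW: "finite W" "finite T" using W V by (meson finite_subset)+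
  have finE: "finite E" using E V by (intro finite_subset[of E "Pow V"]) auto
  have finH: "finite H" using H finE finite_subset by blast
  have "real (card T) * \<delta> = (\<Sum>v\<in>T. \<delta>)" by simp
  also have "\<dots> \<le> (\<Sum>v\<in>T. real (card {e \<in> H. v \<in> e}))" by (intro sum_mono deg) (use W in auto)
  also have "\<dots> = real (card (SIGMA v:T. {e \<in> H. v \<in> e}))" using finW finH by (simp add: card_SigmaI)
  also have "\<dots> \<le> real (card (inner_flags E T W \<union> (\<lambda>(e, v). (v, e)) ` (SIGMA e:?F. e)))"
  proof -
    have sub: "(SIGMA v:T. {e \<in> H. v \<in> e}) \<subseteq> inner_flags E T W \<union> (\<lambda>(e, v). (v, e)) ` (SIGMA e:?F. e)"
      using H by (auto simp: inner_flags_def image_iff)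
    have "finite (inner_flags E T W)"
      by (rule finite_subset[of _ "T \<times> E"]) (use finW finE in \<open>auto simp: inner_flags_def\<close>)
    moreover have "finite (SIGMA e:?F. e)"
      using finH H E V by (intro finite_SigmaI) (auto dest: finite_subset)
    ultimately show ?thesis using sub by (simp only: of_nat_le_iff, intro card_mono) auto
  qed
  also have "\<dots> \<le> real (card (inner_flags E T W)) + real (card ((\<lambda>(e, v). (v, e)) ` (SIGMA e:?F. e)))"
    using card_Un_le[of "inner_flags E T W"] by (simp only: of_nat_add[symmetric] of_nat_le_iff)
  also have "card ((\<lambda>(e, v). (v, e)) ` (SIGMA e:?F. e)) = card (SIGMA e:?F. e)"
    by (rule card_image) (auto simp: inj_on_def)
  also have "card (SIGMA e:?F. e) = (\<Sum>e\<in>?F. card e)"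
    using finH H E V by (intro card_SigmaI) (auto dest: finite_subset)
  also have "\<dots> = (\<Sum>e\<in>?F. r)" using H E by (intro sum.cong) auto
  finally show ?thesis by (simp add: mult.commute)
qed

text \<open>An edge that meets \<open>T\<close> and leaves \<open>W\<close> picks a suitable pair
  with probability at least \<open>1 / r\<^sup>2\<close>. If there are as many such edges as
  assumed, all of them fail with probability at most
  \<open>1 / n ^ (4 * (1 + card T + card W))\<close>, small enough for a union bound over all
  \<open>T\<close> and \<open>W\<close> simultaneously.\<close>

lemma exists_pair_choice:
  fixes H :: "'a set set"
  assumes V: "finite V" "2 \<le> card V" and H: "\<And>e. e \<in> H \<Longrightarrow> e \<subseteq> V \<and> card e = r" and r: "2 \<le> r"
  shows "\<exists>\<phi>. \<forall>T W. T \<subseteq> W \<longrightarrow> W \<subseteq> V \<longrightarrow>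
      4 * (real r)\<^sup>2 * ln (real (card V)) * (1 + real (card T) + real (card W))
        \<le> real (card {e \<in> H. e \<inter> T \<noteq> {} \<and> \<not> e \<subseteq> W}) \<longrightarrow>
      (\<exists>e\<in>H. \<exists>u\<in>T. \<exists>v. v \<notin> W \<and> {u, v} \<subseteq> e \<and> \<phi> e = {u, v})"
proof -
  define n where "n = card V"
  define F where "F T W = {e \<in> H. e \<inter> T \<noteq> {} \<and> \<not> e \<subseteq> W}" for T W
  define pairs where "pairs e = {s. s \<subseteq> e \<and> card s = 2}" for e :: "'a set"
  define P where "P = Pi_pmf H {} (\<lambda>e. pmf_of_set (pairs e))"
  define y where "y = exp (- 4 * ln (real n))"
  have finH: "finite H" using H V by (intro finite_subset[of H "Pow V"]) auto
  have n2: "2 \<le> real n" using V by (simp add: n_def)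
  have yn: "y = 1 / real n ^ 4"
    using n2 by (simp add: y_def exp_minus exp_of_nat_mult[of 4, simplified] inverse_eq_divide)
  have y0: "0 < y" by (simp add: y_def)
  have ypow: "y ^ t = exp (- 4 * ln (real n) * real t)" for t
    by (simp add: y_def exp_of_nat2_mult[symmetric])
  have avoid: "measure_pmf.prob (pmf_of_set (pairs e)) (- {s}) \<le> exp (- 1 / (real r)\<^sup>2)"
    if e: "e \<in> H" and s: "s \<in> pairs e" for e s
  proof -
    have fe: "finite e" "card e = r" using H[OF e] V finite_subset by auto
    have fp: "finite (pairs e)" "pairs e \<noteq> {}" using fe(1) s by (auto simp: pairs_def)
    have cp: "card (pairs e) = r choose 2" using n_subsets[OF fe(1), of 2] fe(2) by (simp add: pairs_def)
    have "r choose 2 \<le> r ^ 2" by (rule binomial_le_pow[OF r])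
    then have c2: "real (card (pairs e)) \<le> (real r)\<^sup>2" unfolding cp by (metis of_nat_le_iff of_nat_power)
    have c0: "0 < card (pairs e)" using fp by (simp add: card_gt_0_iff)
    have "pairs e \<inter> - {s} = pairs e - {s}" by auto
    then have "card (pairs e \<inter> - {s}) = card (pairs e) - 1" using s fp by simp
    then have "measure_pmf.prob (pmf_of_set (pairs e)) (- {s}) = real (card (pairs e) - 1) / real (card (pairs e))"
      using measure_pmf_of_set[OF fp(2,1), of "- {s}"] by simp
    also have "\<dots> = 1 - 1 / real (card (pairs e))" using c0 by (simp add: of_nat_diff diff_divide_distrib)
    also have "\<dots> \<le> 1 - 1 / (real r)\<^sup>2" using c2 c0 r by (simp add: frac_le)
    also have "\<dots> \<le> exp (- 1 / (real r)\<^sup>2)" using exp_ge_add_one_self[of "- 1 / (real r)\<^sup>2"] by simp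
    finally show ?thesis .
  qed
  define hit where "hit \<phi> T W \<longleftrightarrow> (\<exists>e\<in>H. \<exists>u\<in>T. \<exists>v. v \<notin> W \<and> {u, v} \<subseteq> e \<and> \<phi> e = {u, v})" for \<phi> T W
  define \<R> where "\<R> = {(T, W). T \<subseteq> W \<and> W \<subseteq> V \<and>
    4 * (real r)\<^sup>2 * ln (real n) * (1 + real (card T) + real (card W)) \<le> real (card (F T W))}"
  have miss: "measure_pmf.prob P {\<phi>. \<not> hit \<phi> T W} \<le> y * (y ^ card T * y ^ card W)" if TW: "(T, W) \<in> \<R>" for T W
  proof -
    have TWV: "T \<subseteq> W" "W \<subseteq> V" using TW by (auto simp: \<R>_def)
    have "\<exists>u v. u \<in> T \<and> v \<notin> W \<and> {u, v} \<subseteq> e \<and> {u, v} \<in> pairs e" if "e \<in> F T W" for e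
    proof -
      obtain u v where uv: "u \<in> e" "u \<in> T" "v \<in> e" "v \<notin> W" using \<open>e \<in> F T W\<close> by (auto simp: F_def)
      then have "u \<noteq> v" using TWV by auto
      then have "{u, v} \<in> pairs e" using uv by (simp add: pairs_def)
      then show ?thesis using uv by blast
    qed
    \<comment> \<open>One witness pair per edge is enough; missing it is the event
      \<open>A e\<close>, and these events are independent over the edges.\<close>
    then obtain fu fv where f: "\<And>e. e \<in> F T W \<Longrightarrow> fu e \<in> T \<and> fv e \<notin> W \<and> {fu e, fv e} \<subseteq> e \<and> {fu e, fv e} \<in> pairs e"
      by metis
    define A where "A e = (if e \<in> F T W then - {{fu e, fv e}} else UNIV)" for e
    have "{\<phi>. \<not> hit \<phi> T W} \<subseteq> Pi H A"
    proof (intro subsetI Pi_I)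
      fix \<phi> e assume "\<phi> \<in> {\<phi>. \<not> hit \<phi> T W}" "e \<in> H"
      then have "\<phi> e \<noteq> {fu e, fv e}" if "e \<in> F T W" using f[OF that] by (auto simp: hit_def)
      then show "\<phi> e \<in> A e" by (simp add: A_def)
    qed
    then have "measure_pmf.prob P {\<phi>. \<not> hit \<phi> T W} \<le> measure_pmf.prob P (Pi H A)"
      by (intro measure_pmf.finite_measure_mono) auto
    also have "\<dots> = (\<Prod>e\<in>H. measure_pmf.prob (pmf_of_set (pairs e)) (A e))"
      unfolding P_def by (rule measure_Pi_pmf_Pi[OF finH])
    also have "\<dots> \<le> (\<Prod>e\<in>H. if e \<in> F T W then exp (- 1 / (real r)\<^sup>2) else 1)"
      by (rule prod_mono) (use avoid f in \<open>auto simp: A_def\<close>)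
    also have "\<dots> = exp (- 1 / (real r)\<^sup>2) ^ card (F T W)"
    proof -
      have "{e \<in> H. e \<in> F T W} = F T W" by (auto simp: F_def)
      then show ?thesis using prod.inter_filter[OF finH, of "\<lambda>_. exp (- 1 / (real r)\<^sup>2)" "\<lambda>e. e \<in> F T W"] by simp
    qed
    also have "\<dots> = exp (- (real (card (F T W)) / (real r)\<^sup>2))" by (simp add: exp_of_nat_mult[symmetric])
    also have "\<dots> \<le> exp (- 4 * ln (real n) * real (1 + card T + card W))"
    proof -
      have "4 * (real r)\<^sup>2 * ln (real n) * (1 + real (card T) + real (card W)) \<le> real (card (F T W))"
        using TW by (simp add: \<R>_def)
      then have "4 * ln (real n) * (1 + real (card T) + real (card W)) * (real r)\<^sup>2 \<le> real (card (F T W))"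
        by (simp only: mult_ac)
      then have "4 * ln (real n) * (1 + real (card T) + real (card W)) \<le> real (card (F T W)) / (real r)\<^sup>2"
        using r by (simp add: pos_le_divide_eq)
      then show ?thesis by (simp add: add.assoc)
    qed
    also have "\<dots> = y ^ (1 + card T + card W)" by (rule ypow[symmetric])
    finally show ?thesis by (simp add: power_add)
  qed
  have fR: "finite \<R>"
    by (rule finite_subset[of _ "Pow V \<times> Pow V"]) (use V in \<open>auto simp: \<R>_def\<close>)
  have "measure_pmf.prob P (\<Union>(T, W)\<in>\<R>. {\<phi>. \<not> hit \<phi> T W}) \<le> (\<Sum>z\<in>\<R>. measure_pmf.prob P (case z of (T, W) \<Rightarrow> {\<phi>. \<not> hit \<phi> T W}))"
    by (rule measure_pmf.finite_measure_subadditive_finite) (use fR in auto)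
  also have "\<dots> \<le> (\<Sum>(T, W)\<in>\<R>. y * (y ^ card T * y ^ card W))"
    by (rule sum_mono) (use miss in auto)
  also have "\<dots> \<le> (\<Sum>(T, W)\<in>Pow V \<times> Pow V. y * (y ^ card T * y ^ card W))"
    by (rule sum_mono2) (use V y0 in \<open>auto simp: \<R>_def\<close>)
  also have "\<dots> = y * ((\<Sum>T\<in>Pow V. y ^ card T) * (\<Sum>W\<in>Pow V. y ^ card W))"
    by (subst sum_product) (simp add: sum.cartesian_product[symmetric] sum_distrib_left)
  also have "\<dots> = y * ((1 + y) ^ n * (1 + y) ^ n)" using V by (simp add: sum_Pow_power_card n_def)
  also have "\<dots> < 1"
  proof -
    have n8: "2 ^ 3 \<le> real n ^ 3" "2 ^ 4 \<le> real n ^ 4" using n2 by (intro power_mono; simp)+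
    have "real n * y = 1 / real n ^ 3" using n2 by (simp add: yn power_numeral_reduce)
    also have "\<dots> \<le> 1 / 8" using n8(1) n2 by (intro divide_left_mono) auto
    finally have ny: "real n * y \<le> 1 / 8" .
    then have "(1 + y) ^ n \<le> 2" using one_plus_power_le[of y n] y0 by simp
    then have "(1 + y) ^ n * (1 + y) ^ n \<le> 2 * 2" using y0 by (intro mult_mono) auto
    moreover have "y \<le> 1 / 16" unfolding yn using n8(2) n2 by (intro divide_left_mono) auto
    ultimately have "y * ((1 + y) ^ n * (1 + y) ^ n) \<le> 1 / 16 * (2 * 2)"
      by - (rule mult_mono; use y0 in simp)
    then show ?thesis by simp
  qed
  finally have "(\<Union>(T, W)\<in>\<R>. {\<phi>. \<not> hit \<phi> T W}) \<noteq> UNIV"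
    by (metis less_irrefl measure_pmf.prob_space space_measure_pmf)
  then obtain \<phi> where "\<phi> \<notin> (\<Union>(T, W)\<in>\<R>. {\<phi>. \<not> hit \<phi> T W})" by auto
  then have "hit \<phi> T W" if "(T, W) \<in> \<R>" for T W using that by auto
  then show ?thesis unfolding hit_def \<R>_def F_def n_def by (intro exI[of _ \<phi>]) auto
qed

subsection \<open>Hamilton Berge cycles\<close>

text \<open>\<open>D\<close> is the degree scale. Inside \<open>W\<close> there are on average at
  most \<open>((1 / 2) ^ a + \<gamma> / 2) * D\<close> edges at a vertex of \<open>T\<close>, so
  \<open>\<gamma> / 2 * D\<close> remain to leave. If \<open>T\<close> is large enough to sample,
  \<open>\<gamma> / 4\<close> is spent on the constant in \<open>f\<close> and
  \<open>\<gamma> / 4\<close> on the error in \<open>c2\<close>; otherwise the codegree bound and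
  \<open>c3\<close> do it.\<close>

lemma many_leaving_edges:
  fixes \<sigma> \<gamma> x p lam :: real and r \<Delta> :: nat and V :: "'a set"
  defines "a \<equiv> r - 1"
  defines "D \<equiv> p * real (card V choose a)"
  assumes V: "finite V" and E: "\<And>e. e \<in> E \<Longrightarrow> e \<subseteq> V \<and> card e = r" and r: "2 \<le> r" and H: "H \<subseteq> E"
    and W: "T \<subseteq> W" "W \<subseteq> V" "real (card W) \<le> (1 / 2 + 3 * \<sigma>) * real (card V)"
      "real (card W) \<le> 2 * x ^ 15 * real (card T)"
    and \<sigma>: "0 < \<sigma>" "\<sigma> \<le> 1 / 6" and p: "0 \<le> p" and lam: "0 \<le> lam" "lam \<le> x\<^sup>2" and x: "1 \<le> x" and \<gamma>: "0 < \<gamma>"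
    and pr: "\<And>T U. T \<subseteq> V \<Longrightarrow> U \<subseteq> V \<Longrightarrow> T \<inter> U = {} \<Longrightarrow> card U \<le> card T \<Longrightarrow>
        real (card {e \<in> E. card (e \<inter> T) = 1 \<and> card (e \<inter> U) = a})
          \<le> (1 + \<sigma>) * p * real (card T) * real (card U choose a) + real (card T) * lam"
    and codeg: "\<And>u v. u \<in> V \<Longrightarrow> v \<in> V \<Longrightarrow> u \<noteq> v \<Longrightarrow> card {e \<in> E. {u, v} \<subseteq> e} \<le> \<Delta>" "real \<Delta> \<le> 2 * x"
    and deg: "\<And>v. v \<in> V \<Longrightarrow> ((1 / 2) ^ a + \<gamma>) * D \<le> real (card {e \<in> H. v \<in> e})"
    and f: "(1 / (1 - 2 * \<sigma>)) ^ a * ((1 + \<sigma>) * (1 / 2 + 3 * \<sigma>) ^ a) \<le> (1 / 2) ^ a + \<gamma> / 4"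
    and c2: "(1 / (1 - 2 * \<sigma>)) ^ a * (x\<^sup>2 * (4 * real a * x ^ 15 / \<sigma>) ^ a) \<le> \<gamma> / 4 * D"
    and c3: "8 * real r / \<sigma> * x ^ 16 \<le> \<gamma> / 2 * D"
  shows "\<gamma> / 2 * D * real (card T) \<le> real r * real (card {e \<in> H. e \<inter> T \<noteq> {} \<and> \<not> e \<subseteq> W})"
proof -
  define t where "t = real (card T)"
  have D0: "0 \<le> D" using p by (simp add: D_def)
  have t0: "0 \<le> t" by (simp add: t_def)
  have "real (card (inner_flags E T W)) \<le> t * (((1 / 2) ^ a + \<gamma> / 2) * D)"
  proof (cases "2 * real r \<le> \<sigma> * t")
    case True
    have "real (card (inner_flags E T W)) \<le> t *
      ((1 / (1 - 2 * \<sigma>)) ^ a * ((1 + \<sigma>) * (1 / 2 + 3 * \<sigma>) ^ a * D + lam * (2 * real a * (2 * x ^ 15) / \<sigma>) ^ a))"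
      unfolding t_def D_def a_def
    proof (rule inner_flags_bound[OF V E r W])
      show "2 * real r \<le> \<sigma> * real (card T)" using True by (simp add: t_def)
    qed (use \<sigma> p lam pr in \<open>auto simp: a_def\<close>)
    also have "\<dots> \<le> t * (((1 / 2) ^ a + \<gamma> / 2) * D)"
    proof (rule mult_left_mono[OF _ t0])
      let ?k = "(1 / (1 - 2 * \<sigma>)) ^ a"
      have k0: "0 \<le> ?k" using \<sigma> by simp
      have "?k * (lam * (2 * real a * (2 * x ^ 15) / \<sigma>) ^ a) \<le> ?k * (x\<^sup>2 * (4 * real a * x ^ 15 / \<sigma>) ^ a)"
        using lam \<sigma> x k0 by (intro mult_left_mono mult_mono) (auto simp: mult_ac)
      moreover have "?k * ((1 + \<sigma>) * (1 / 2 + 3 * \<sigma>) ^ a) * D \<le> ((1 / 2) ^ a + \<gamma> / 4) * D"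
        using f D0 by (rule mult_right_mono)
      ultimately show "?k * ((1 + \<sigma>) * (1 / 2 + 3 * \<sigma>) ^ a * D + lam * (2 * real a * (2 * x ^ 15) / \<sigma>) ^ a)
          \<le> ((1 / 2) ^ a + \<gamma> / 2) * D"
        using c2 by (simp add: algebra_simps)
    qed
    finally show ?thesis .
  next
    case False
    then have t_less: "t \<le> 2 * real r / \<sigma>" using \<sigma> by (simp add: pos_le_divide_eq mult.commute)
    have "card (inner_flags E T W) \<le> card T * card W * \<Delta>"
      by (rule inner_flags_codegree[OF V E r W(1,2) codeg(1)])
    then have "real (card (inner_flags E T W)) \<le> real (card T * card W * \<Delta>)" by (simp only: of_nat_le_iff)
    also have "\<dots> = t * (real (card W) * real \<Delta>)" by (simp add: t_def)
    also have "\<dots> \<le> t * ((2 * x ^ 15 * t) * (2 * x))"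
      using W(4) codeg(2) x t0 unfolding t_def[symmetric] by (intro mult_left_mono mult_mono) auto
    also have "(2 * x ^ 15 * t) * (2 * x) = 4 * x ^ 16 * t" by (simp add: power_numeral_reduce)
    also have "t * (4 * x ^ 16 * t) \<le> t * (4 * x ^ 16 * (2 * real r / \<sigma>))"
      using t_less t0 x by (intro mult_left_mono) auto
    also have "4 * x ^ 16 * (2 * real r / \<sigma>) = 8 * real r / \<sigma> * x ^ 16" by simp
    also have "t * (8 * real r / \<sigma> * x ^ 16) \<le> t * (\<gamma> / 2 * D)" using c3 t0 by (rule mult_left_mono)
    also have "\<dots> \<le> t * (((1 / 2) ^ a + \<gamma> / 2) * D)"
      using D0 t0 by (intro mult_left_mono mult_right_mono) auto
    finally show ?thesis .
  qed
  moreover have "t * (((1 / 2) ^ a + \<gamma>) * D) \<le> real (card (inner_flags E T W)) +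
      real r * real (card {e \<in> H. e \<inter> T \<noteq> {} \<and> \<not> e \<subseteq> W})"
    unfolding t_def by (rule leaving_edges_ge[OF V E H W(1,2) deg])
  ultimately show ?thesis unfolding t_def[symmetric] by (simp add: algebra_simps)
qed

text \<open>From three vertices on, the cyclically consecutive pairs are distinct; on two vertices
  the closing pair would repeat the first one and with it the hyperedge.\<close>

lemma hamilton_berge_cycle_of_pairs:
  assumes vs: "distinct vs" "set vs = V" "3 \<le> length vs"
    and adj: "\<And>i. i + 1 < length vs \<Longrightarrow> \<exists>e\<in>H. {vs ! i, vs ! (i + 1)} \<subseteq> e \<and> \<phi> e = {vs ! i, vs ! (i + 1)}"
    and close: "\<exists>e\<in>H. {last vs, hd vs} \<subseteq> e \<and> \<phi> e = {last vs, hd vs}"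
  shows "\<exists>es. hamilton_berge_cycle V H vs es"
proof -
  define n where "n = length vs"
  define nx where "nx i = (if i + 1 = n then 0 else i + 1)" for i
  have ne: "vs \<noteq> []" and n3: "3 \<le> n" using vs(3) by (auto simp: n_def)
  have "\<exists>e\<in>H. {vs ! i, vs ! nx i} \<subseteq> e \<and> \<phi> e = {vs ! i, vs ! nx i}" if "i < n" for i
  proof (cases "i + 1 = n")
    case True
    then have "i = length vs - 1" "nx i = 0" by (simp_all add: n_def nx_def)
    then have "vs ! i = last vs" "vs ! nx i = hd vs" using ne by (simp_all add: last_conv_nth hd_conv_nth)
    then show ?thesis using close by simp
  next
    case False
    then show ?thesis using adj[of i] that by (simp add: nx_def n_def)
  qed
  then obtain f where f: "\<And>i. i < n \<Longrightarrow> f i \<in> H \<and> {vs ! i, vs ! nx i} \<subseteq> f i \<and> \<phi> (f i) = {vs ! i, vs ! nx i}"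
    by metis
  define es where "es = map f [0..<n]"
  have "inj_on f {0..<n}"
  proof (rule inj_onI)
    fix i j assume ij: "i \<in> {0..<n}" "j \<in> {0..<n}" "f i = f j"
    then have eq: "{vs ! i, vs ! nx i} = {vs ! j, vs ! nx j}" using f[of i] f[of j] by auto
    have lt: "i < n" "j < n" "nx i < n" "nx j < n" using ij n3 by (auto simp: nx_def)
    have "vs ! i = vs ! j \<or> vs ! i = vs ! nx j \<and> vs ! nx i = vs ! j" using eq by (auto simp: doubleton_eq_iff)
    then have "i = j \<or> i = nx j \<and> nx i = j"
      using vs(1) lt by (simp add: nth_eq_iff_index_eq n_def)
    then show "i = j" using n3 lt by (auto simp: nx_def split: if_splits)
  qed
  then have "distinct es" by (simp add: es_def distinct_map)
  moreover have "set es \<subseteq> H" using f by (auto simp: es_def)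
  moreover have "\<forall>i. i + 1 < length vs \<longrightarrow> {vs ! i, vs ! (i + 1)} \<subseteq> es ! i"
  proof (intro allI impI)
    fix i assume "i + 1 < length vs"
    then show "{vs ! i, vs ! (i + 1)} \<subseteq> es ! i" using f[of i] by (simp add: es_def n_def nx_def)
  qed
  moreover have "{hd vs, last vs} \<subseteq> last es"
  proof -
    have "last es = f (n - 1)" using n3 by (simp add: es_def last_map)
    moreover have "vs ! (n - 1) = last vs" "vs ! nx (n - 1) = hd vs"
      using ne n3 by (auto simp: last_conv_nth hd_conv_nth n_def nx_def)
    ultimately show ?thesis using f[of "n - 1"] n3 by auto
  qed
  moreover have "length es = length vs" by (simp add: es_def n_def)
  ultimately show ?thesis
    using vs(1,2) ne unfolding hamilton_berge_cycle_def by (intro exI[of _ es] conjI)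
qed

text \<open>The left-hand side is continuous in \<open>\<sigma>\<close> and equals
  \<open>(1 / 2) ^ a\<close> at \<open>\<sigma> = 0\<close>.\<close>

lemma exists_slack:
  fixes \<gamma> :: real
  assumes "0 < \<gamma>"
  shows "\<exists>\<sigma>>0. \<sigma> \<le> 1 / 6 \<and> (1 / (1 - 2 * \<sigma>)) ^ a * ((1 + \<sigma>) * (1 / 2 + 3 * \<sigma>) ^ a) \<le> (1 / 2) ^ a + \<gamma>"
proof -
  let ?f = "\<lambda>\<sigma>::real. (1 / (1 - 2 * \<sigma>)) ^ a * ((1 + \<sigma>) * (1 / 2 + 3 * \<sigma>) ^ a)"
  have "(?f \<longlongrightarrow> (1 / (1 - 2 * 0)) ^ a * ((1 + 0) * (1 / 2 + 3 * 0) ^ a)) (at_right 0)"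
    by (intro tendsto_intros) auto
  then have "(?f \<longlongrightarrow> (1 / 2) ^ a) (at_right 0)" by simp
  then have "\<forall>\<^sub>F \<sigma> in at_right 0. ?f \<sigma> < (1 / 2) ^ a + \<gamma>"
    by (rule order_tendstoD(2)) (use assms in simp)
  moreover have "\<forall>\<^sub>F \<sigma> in at_right (0::real). \<sigma> \<in> {0<..<1 / 6}"
    by (rule eventually_at_right_real) simp
  ultimately have "\<forall>\<^sub>F \<sigma> in at_right 0. ?f \<sigma> < (1 / 2) ^ a + \<gamma> \<and> \<sigma> \<in> {0<..<1 / 6}"
    by (rule eventually_conj)
  then have "\<exists>\<sigma>. ?f \<sigma> < (1 / 2) ^ a + \<gamma> \<and> \<sigma> \<in> {0<..<1 / 6}"
    by (rule eventually_happens'[rotated]) simp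
  then obtain \<sigma> where \<sigma>: "?f \<sigma> < (1 / 2) ^ a + \<gamma>" "\<sigma> \<in> {0<..<1 / 6}" by (elim exE conjE)
  then have "0 < \<sigma>" "\<sigma> \<le> 1 / 6" by simp_all
  then show ?thesis using less_imp_le[OF \<sigma>(1)] by (intro exI[of _ \<sigma>] conjI)
qed

text \<open>The 16th power of \<open>x / 16 \<le> exp (x / 16)\<close> has one factor
  \<open>x\<close> to spare, which pays for \<open>16 ^ 16\<close>.\<close>

lemma power_15_le_exp:
  fixes x :: real
  assumes "16 ^ 16 \<le> x"
  shows "x ^ 15 \<le> exp x"
proof -
  have x0: "0 < x" using assms by (rule less_le_trans[rotated]) simp
  have "x ^ 15 * 16 ^ 16 \<le> x ^ 15 * x" using assms x0 by (intro mult_left_mono) auto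
  also have "\<dots> = x ^ 16" by (simp add: power_numeral_reduce)
  finally have "x ^ 15 \<le> (x / 16) ^ 16" by (simp add: power_divide pos_le_divide_eq)
  also have "x / 16 \<le> exp (x / 16)" using exp_ge_add_one_self[of "x / 16"] by linarith
  then have "(x / 16) ^ 16 \<le> exp (x / 16) ^ 16" using x0 by (intro power_mono) auto
  also have "\<dots> = exp x" by (simp add: exp_of_nat_mult[symmetric])
  finally show ?thesis .
qed

text \<open>\<open>\<sigma>\<close> is at once the \<open>\<epsilon>\<close> of pseudorandomness,
  the sampling ratio and the surplus in the expansion. The lower bounds on \<open>x\<close> spell
  out how large \<open>n\<close> has to be.\<close>

lemma berge_cycle_of_pseudorandom:
  fixes r g n :: nat and \<gamma> \<sigma> p x :: real and E H :: "nat set set"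
  defines "a \<equiv> r - 1"
  assumes r: "3 \<le> r" and \<gamma>: "0 < \<gamma>" and \<sigma>: "0 < \<sigma>" "\<sigma> \<le> 1 / 6" and g: "6 < real g * \<sigma>"
    and f: "(1 / (1 - 2 * \<sigma>)) ^ a * ((1 + \<sigma>) * (1 / 2 + 3 * \<sigma>) ^ a) \<le> (1 / 2) ^ a + \<gamma> / 4"
    and x: "x = ln (real n)" "100 \<le> x" "2 / \<sigma> \<le> x" "8 / (\<sigma> / 6) \<le> x"
      "2 * (18 * (real g + 6 + 648 * real g / \<sigma>)) / (\<sigma> / 6) \<le> x" "16 ^ 16 \<le> x"
      "(1 / (1 - 2 * \<sigma>)) ^ a * (4 * real a / \<sigma>) ^ a * real a ^ a * (4 / \<gamma>) \<le> x"
      "16 * real r / \<sigma> / \<gamma> * real a ^ a \<le> x" "32 * real r ^ 3 * real a ^ a / \<gamma> \<le> x"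
      "real a \<le> x"
    and p: "p = x ^ (17 * r) / real n ^ a" and pr: "pseudorandom r \<sigma> p {1..n} E"
    and codeg: "real (max_codegree {1..n} E) \<le> 2 * x"
    and H: "H \<subseteq> E" and deg: "((1 / 2) ^ a + \<gamma>) * p * real (n choose a) \<le> real (min_degree {1..n} H)"
  shows "\<exists>vs es. hamilton_berge_cycle {1..n} H vs es"
proof -
  define V where "V = {1..n}"
  define D where "D = p * real (card V choose a)"
  define m where "m = nat \<lfloor>real n / x ^ 15\<rfloor>"
  define lam where "lam = x powr (1 + \<sigma>)"
  define F where "F T W = {e \<in> H. e \<inter> T \<noteq> {} \<and> \<not> e \<subseteq> W}" for T W :: "nat set"
  have cV: "card V = n" and fV: "finite V" by (simp_all add: V_def)
  have x1: "1 \<le> x" and x0: "0 < x" using x(2) by auto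
  have n0: "0 < real n" using x1 x(1) by (cases n) auto
  have n15: "x ^ 15 \<le> real n" using power_15_le_exp[OF x(6)] x(1) n0 by simp
  have xn: "x \<le> real n" using power_increasing[of 1 15 x] x1 n15 by simp
  have EV: "e \<subseteq> V \<and> card e = r" if "e \<in> E" for e
    using pr that by (auto simp: pseudorandom_def uniform_hypergraph_def V_def)
  have finE: "finite E" using EV fV by (intro finite_subset[of E "Pow V"]) auto
  have finH: "finite H" using H finE finite_subset by blast
  have a2: "2 \<le> a" and r2: "2 \<le> r" using r by (auto simp: a_def)
  have p0: "0 \<le> p" using x0 by (simp add: p)
  have aa: "0 < real a ^ a" using a2 by simp
  have D_ge: "x ^ (17 * r) / real a ^ a \<le> D"
  proof -
    have "a \<le> n" using x(10) xn by linarith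
    then have "(real n / real a) ^ a \<le> real (n choose a)" by (rule binomial_ge_n_over_k_pow_k)
    then have "p * (real n / real a) ^ a \<le> D" unfolding D_def cV using p0 by (rule mult_left_mono)
    moreover have "p * (real n / real a) ^ a = x ^ (17 * r) / real a ^ a"
      using n0 by (simp add: p power_divide)
    ultimately show ?thesis by simp
  qed
  \<comment> \<open>Every power of \<open>x\<close> with exponent below \<open>17 * r\<close> is
    dominated by \<open>D\<close>, one spare factor \<open>x\<close> absorbing the constants. The
    critical use is \<open>i = 15 * a + 2\<close>.\<close>
  have big: "K * x ^ i \<le> \<beta> * D" if "K * real a ^ a / \<beta> \<le> x" "Suc i \<le> 17 * r" "0 < \<beta>" for K \<beta> i
  proof -
    have "K * real a ^ a \<le> \<beta> * x" using that(1,3) by (simp add: pos_divide_le_eq mult.commute)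
    then have "K \<le> \<beta> * x / real a ^ a" using aa by (simp add: pos_le_divide_eq)
    then have "K * x ^ i \<le> (\<beta> * x / real a ^ a) * x ^ i" using x0 by (intro mult_right_mono) auto
    also have "\<dots> = \<beta> * (x ^ Suc i / real a ^ a)" by simp
    also have "\<dots> \<le> \<beta> * (x ^ (17 * r) / real a ^ a)"
      using power_increasing[OF that(2) x1] that(3) aa by (intro mult_left_mono divide_right_mono) auto
    also have "\<dots> \<le> \<beta> * D" using D_ge that(3) by (intro mult_left_mono) auto
    finally show ?thesis .
  qed
  have c2: "(1 / (1 - 2 * \<sigma>)) ^ a * (x\<^sup>2 * (4 * real a * x ^ 15 / \<sigma>) ^ a) \<le> \<gamma> / 4 * D"
  proof -
    have "(1 / (1 - 2 * \<sigma>)) ^ a * (x\<^sup>2 * (4 * real a * x ^ 15 / \<sigma>) ^ a) =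
        (1 / (1 - 2 * \<sigma>)) ^ a * (4 * real a / \<sigma>) ^ a * x ^ (15 * a + 2)"
      by (simp add: power_mult_distrib power_divide power_add power_mult[symmetric] power2_eq_square mult_ac)
    also have "\<dots> \<le> \<gamma> / 4 * D"
      by (rule big) (use x(7) \<gamma> r in \<open>auto simp: a_def mult_ac\<close>)
    finally show ?thesis .
  qed
  have c3: "8 * real r / \<sigma> * x ^ 16 \<le> \<gamma> / 2 * D"
    by (rule big) (use x(8) \<gamma> r in \<open>auto simp: mult_ac\<close>)
  have c4: "16 * real r ^ 3 * x ^ 16 \<le> \<gamma> / 2 * D"
    by (rule big) (use x(9) \<gamma> r in \<open>auto simp: mult_ac\<close>)
  have deg': "((1 / 2) ^ a + \<gamma>) * D \<le> real (card {e \<in> H. v \<in> e})" if "v \<in> V" for v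
  proof -
    have "min_degree V H \<le> card {e \<in> H. v \<in> e}"
      unfolding min_degree_def using fV that by (intro Min_le) auto
    then show ?thesis using deg unfolding D_def cV V_def[symmetric] by (simp add: mult.assoc)
  qed
  have codeg': "card {e \<in> E. {u, v} \<subseteq> e} \<le> max_codegree V E" if "u \<in> V" "v \<in> V" "u \<noteq> v" for u v
  proof -
    have fin: "finite {P. P \<subseteq> V \<and> card P = 2}" using fV by simp
    have "{u, v} \<in> {P. P \<subseteq> V \<and> card P = 2}" using that by simp
    from Max_ge[OF finite_imageI[OF fin] imageI[OF this]] show ?thesis unfolding max_codegree_def .
  qed
  have lam: "0 \<le> lam" "lam \<le> x\<^sup>2"
  proof -
    have "lam \<le> x powr 2" unfolding lam_def using \<sigma> x1 by (intro powr_mono) auto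
    then show "lam \<le> x\<^sup>2" using x0 by simp
  qed (simp add: lam_def)
  have pr': "real (card {e \<in> E. card (e \<inter> T) = 1 \<and> card (e \<inter> U) = a})
          \<le> (1 + \<sigma>) * p * real (card T) * real (card U choose a) + real (card T) * lam"
    if "T \<subseteq> V" "U \<subseteq> V" "T \<inter> U = {}" "card U \<le> card T" for T U
    using pr that unfolding pseudorandom_def cross_edges_def a_def lam_def x(1) V_def[symmetric] cV by blast
  have HV: "e \<subseteq> V \<and> card e = r" if "e \<in> H" for e using EV H that by auto
  have V2: "2 \<le> card V" using xn x(2) by (simp add: cV)
  have "\<exists>\<phi>. \<forall>T W. T \<subseteq> W \<longrightarrow> W \<subseteq> V \<longrightarrow>
      4 * (real r)\<^sup>2 * x * (1 + real (card T) + real (card W)) \<le> real (card (F T W)) \<longrightarrow>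
      (\<exists>e\<in>H. \<exists>u\<in>T. \<exists>v. v \<notin> W \<and> {u, v} \<subseteq> e \<and> \<phi> e = {u, v})"
    unfolding F_def x(1) cV[symmetric] by (rule exists_pair_choice[OF fV V2 _ r2]) (rule HV)
  then obtain \<phi> where \<phi>: "\<forall>T W. T \<subseteq> W \<longrightarrow> W \<subseteq> V \<longrightarrow>
      4 * (real r)\<^sup>2 * x * (1 + real (card T) + real (card W)) \<le> real (card (F T W)) \<longrightarrow>
      (\<exists>e\<in>H. \<exists>u\<in>T. \<exists>v. v \<notin> W \<and> {u, v} \<subseteq> e \<and> \<phi> e = {u, v})" by (elim exE)
  define adj where "adj u v \<longleftrightarrow> u \<noteq> v \<and> (\<exists>e\<in>H. {u, v} \<subseteq> e \<and> \<phi> e = {u, v})" for u v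
  interpret G: fin_graph V adj
  proof
    show "adj v u" if "adj u v" for u v using that by (auto simp: adj_def insert_commute)
    show "v \<in> V" if "adj u v" for u v using that HV by (auto simp: adj_def)
  qed (rule fV)
  \<comment> \<open>All expansion comes from here. The edges leaving \<open>W\<close> number at
    least \<open>16 * r\<^sup>2 * x ^ 16 * card T\<close>, and this meets the threshold of
    \<open>\<phi>\<close> because \<open>card W\<close> is at most
    \<open>2 * x ^ 15 * card T\<close>.\<close>
  have key: "\<not> G.nb T \<subseteq> W"
    if T: "T \<noteq> {}" "T \<subseteq> W" "W \<subseteq> V" and W: "real (card W) \<le> (1 / 2 + 3 * \<sigma>) * real n"
      "real (card W) \<le> 2 * x ^ 15 * real (card T)" for T W
  proof -
    define t where "t = real (card T)"
    have "finite T" using T fV by (meson finite_subset)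
    then have t1: "1 \<le> t" using T(1) card_gt_0_iff[of T] by (auto simp: t_def Suc_le_eq)
    have "\<gamma> / 2 * D * t \<le> real r * real (card (F T W))"
      unfolding D_def a_def F_def t_def
    proof (rule many_leaving_edges[where \<sigma> = \<sigma> and lam = lam and x = x and \<Delta> = "max_codegree V E"],
        unfold a_def[symmetric] D_def[symmetric])
      show "real (card W) \<le> (1 / 2 + 3 * \<sigma>) * real (card V)" using W(1) by (simp only: cV)
      show "real (max_codegree V E) \<le> 2 * x" using codeg by (simp only: V_def)
    qed (assumption | rule fV EV r2 H T W(2) \<sigma> p0 lam x1 \<gamma> pr' codeg' deg' f c2 c3)+
    moreover have "16 * real r ^ 3 * x ^ 16 * t \<le> \<gamma> / 2 * D * t" using c4 t1 by (intro mult_right_mono) auto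
    ultimately have "real r * (16 * (real r)\<^sup>2 * x ^ 16 * t) \<le> real r * real (card (F T W))"
      by (simp add: power3_eq_cube power2_eq_square mult_ac)
    then have F_ge: "16 * (real r)\<^sup>2 * x ^ 16 * t \<le> real (card (F T W))"
      using r by (simp only: mult_le_cancel_left_pos of_nat_0_less_iff)
    have "1 * 1 \<le> x ^ 15 * t" "1 * t \<le> x ^ 15 * t" using x1 t1 by (intro mult_mono; simp)+
    then have "1 + t + real (card W) \<le> 4 * (x ^ 15 * t)" using W(2) by (simp add: t_def)
    then have "4 * (real r)\<^sup>2 * x * (1 + t + real (card W)) \<le> 4 * (real r)\<^sup>2 * x * (4 * (x ^ 15 * t))"
      using x0 by (intro mult_left_mono) auto
    also have "\<dots> = 16 * (real r)\<^sup>2 * x ^ 16 * t" by (simp add: power_numeral_reduce)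
    finally have "4 * (real r)\<^sup>2 * x * (1 + real (card T) + real (card W)) \<le> real (card (F T W))"
      using F_ge unfolding t_def by (rule order.trans)
    from \<phi>[rule_format, OF T(2,3) this] obtain e u v where e: "e \<in> H" "u \<in> T" "v \<notin> W" "{u, v} \<subseteq> e" "\<phi> e = {u, v}" by blast
    then have "adj u v" using T(2) by (auto simp: adj_def)
    then show ?thesis using e(2,3) by (auto simp: G.nb_def)
  qed
  have q1: "1 \<le> real n / x ^ 15" using n15 x0 by (simp add: pos_le_divide_eq)
  have m_le: "real m \<le> real n / x ^ 15" and m_gt: "real n / x ^ 15 < real m + 1"
    using q1 unfolding m_def by linarith+
  have m1: "1 \<le> m" using q1 by (simp add: m_def le_nat_floor)
  have small: "x ^ 14 * real (card T) \<le> real (card (G.nb T))" if T: "T \<subseteq> V" "card T \<le> m" for T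
  proof (cases "T = {}")
    case False
    show ?thesis
    proof (rule ccontr)
      assume "\<not> x ^ 14 * real (card T) \<le> real (card (G.nb T))"
      then have less: "real (card (G.nb T)) < x ^ 14 * real (card T)" by simp
      let ?W = "T \<union> G.nb T"
      have "real (card ?W) \<le> real (card T) + real (card (G.nb T))"
        using card_Un_le[of T "G.nb T"] by linarith
      also have "\<dots> \<le> x ^ 14 * real (card T) + x ^ 14 * real (card T)"
        using less mult_right_mono[OF one_le_power[OF x1, of 14], of "real (card T)"] by linarith
      finally have W: "real (card ?W) \<le> 2 * x ^ 14 * real (card T)" by linarith
      have "G.nb T \<subseteq> ?W" by auto
      moreover have "\<not> G.nb T \<subseteq> ?W"
      proof (rule key[OF False])
        show "?W \<subseteq> V" using T(1) G.nb_subset by auto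
        have "2 * x ^ 14 * real (card T) \<le> 2 * x ^ 15 * real (card T)"
          using power_increasing[of 14 15 x] x1 by (intro mult_right_mono) auto
        then show "real (card ?W) \<le> 2 * x ^ 15 * real (card T)" using W by linarith
        have "real (card T) \<le> real n / x ^ 15" using T(2) m_le by linarith
        then have "2 * x ^ 14 * real (card T) \<le> 2 * x ^ 14 * (real n / x ^ 15)"
          using x0 by (intro mult_left_mono) auto
        also have "\<dots> = 2 / x * real n" using x0 by (simp add: power_numeral_reduce field_simps)
        also have "\<dots> \<le> 1 / 2 * real n" using x(2) n0 by (intro mult_right_mono) (auto simp: field_simps)
        also have "\<dots> \<le> (1 / 2 + 3 * \<sigma>) * real n" using \<sigma> n0 by (intro mult_right_mono) auto
        finally show "real (card ?W) \<le> (1 / 2 + 3 * \<sigma>) * real n" using W by linarith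
      qed auto
      ultimately show False by simp
    qed
  qed simp
  have large: "(1 / 2 + 2 * \<sigma>) * real n \<le> real (card (G.nb T))" if T: "T \<subseteq> V" "m \<le> card T" for T
  proof -
    \<comment> \<open>For exactly \<open>m\<close> vertices both size conditions of
      \<open>key\<close> hold: \<open>m \<le> \<sigma> * n\<close> keeps \<open>?W\<close> below
      \<open>(1 / 2 + 3 * \<sigma>) * n\<close>, and \<open>n \<le> 2 * x ^ 15 * m\<close> bounds
      its ratio to \<open>T'\<close>.\<close>
    obtain T' where T': "T' \<subseteq> T" "card T' = m" using T(2) by (meson obtain_subset_with_card_n)
    have "(1 / 2 + 2 * \<sigma>) * real n \<le> real (card (G.nb T'))"
    proof (rule ccontr)
      assume "\<not> (1 / 2 + 2 * \<sigma>) * real n \<le> real (card (G.nb T'))"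
      then have less: "real (card (G.nb T')) < (1 / 2 + 2 * \<sigma>) * real n" by simp
      let ?W = "T' \<union> G.nb T'"
      have cW: "real (card ?W) \<le> real m + real (card (G.nb T'))"
        using card_Un_le[of T' "G.nb T'"] T'(2) by linarith
      have "\<not> G.nb T' \<subseteq> ?W"
      proof (rule key)
        show "T' \<noteq> {}" using T'(2) m1 by auto
        show WV: "?W \<subseteq> V" using T(1) T'(1) G.nb_subset by auto
        have "2 \<le> \<sigma> * x" using x(3) \<sigma>(1) by (simp add: pos_divide_le_eq mult.commute)
        also have "\<dots> \<le> \<sigma> * x ^ 15" using power_increasing[of 1 15 x] x1 \<sigma> by (intro mult_left_mono) auto
        finally have "1 / x ^ 15 \<le> \<sigma>" using x0 by (simp add: pos_divide_le_eq)
        then have "1 / x ^ 15 * real n \<le> \<sigma> * real n" using n0 by (intro mult_right_mono) auto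
        then have "real m \<le> \<sigma> * real n" using m_le by simp
        then show "real (card ?W) \<le> (1 / 2 + 3 * \<sigma>) * real n"
          using cW less by (simp add: algebra_simps)
        have "card ?W \<le> n" using card_mono[OF fV WV] cV by simp
        moreover have "real n / x ^ 15 \<le> 2 * real m" using m_gt m1 by linarith
        then have "real n \<le> 2 * x ^ 15 * real m" using x0 by (simp add: pos_divide_le_eq mult_ac)
        ultimately show "real (card ?W) \<le> 2 * x ^ 15 * real (card T')" unfolding T'(2) by linarith
      qed auto
      then show False by simp
    qed
    also have "\<dots> \<le> real (card (G.nb T))"
      using card_mono[OF G.finite_nb G.nb_mono[OF T'(1)]] by simp
    finally show ?thesis .
  qed
  have "\<exists>vs. vs \<noteq> [] \<and> distinct vs \<and> set vs = V \<and> successively adj vs \<and> adj (last vs) (hd vs)"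
    by (rule G.hamilton_cycle_of_expansion[where c = \<sigma> and g = g and x = x and m = m])
      (use \<sigma> g x n15 m1 m_le small large in \<open>simp_all add: cV\<close>)
  then obtain vs where vs: "vs \<noteq> []" "distinct vs" "set vs = V" "successively adj vs" "adj (last vs) (hd vs)"
    by blast
  have "length vs = n" using distinct_card[OF vs(2)] vs(3) cV by simp
  then have "3 \<le> length vs" using xn x(2) by linarith
  then have "\<exists>es. hamilton_berge_cycle V H vs es"
  proof (rule hamilton_berge_cycle_of_pairs[OF vs(2,3), where \<phi> = \<phi>])
    show "\<exists>e\<in>H. {vs ! i, vs ! (i + 1)} \<subseteq> e \<and> \<phi> e = {vs ! i, vs ! (i + 1)}" if "i + 1 < length vs" for i
      using vs(4) that by (simp add: successively_conv_nth adj_def)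
    show "\<exists>e\<in>H. {last vs, hd vs} \<subseteq> e \<and> \<phi> e = {last vs, hd vs}" using vs(5) by (simp add: adj_def)
  qed
  then show ?thesis unfolding V_def by blast
qed

theorem theorem6p1:
  fixes r :: nat and \<gamma> :: real
  assumes "r \<ge> 3" and "\<gamma> > 0"
  shows "\<exists>\<epsilon>::real. 0 < \<epsilon> \<and> \<epsilon> < 3 / 2 \<and>
    (\<exists>n0::nat. \<forall>n\<ge>n0. \<forall>(p::real) (E :: nat set set).
      p = ln (real n) ^ (17 * r) / real n ^ (r - 1) \<and>
      pseudorandom r \<epsilon> p {1..n} E \<and>
      real (max_codegree {1..n} E) \<le> 2 * ln (real n) \<longrightarrow>
      (\<forall>H. H \<subseteq> E \<and>
         real (min_degree {1..n} H) \<ge> (1 / 2 ^ (r - 1) + \<gamma>) * p * real (n choose (r - 1)) \<longrightarrow>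
         (\<exists>vs es. hamilton_berge_cycle {1..n} H vs es)))"
proof -
  define a where "a = r - 1"
  \<comment> \<open>\<open>\<sigma>\<close> serves as \<open>\<epsilon>\<close>. Only a quarter of
    \<open>\<gamma>\<close> is spent on it, since another quarter is reserved for the sampling error
    and half for the edges that leave.\<close>
  obtain \<sigma> where \<sigma>: "0 < \<sigma>" "\<sigma> \<le> 1 / 6"
    "(1 / (1 - 2 * \<sigma>)) ^ a * ((1 + \<sigma>) * (1 / 2 + 3 * \<sigma>) ^ a) \<le> (1 / 2) ^ a + \<gamma> / 4"
    using exists_slack[of "\<gamma> / 4" a] assms(2) by auto
  obtain g :: nat where "6 / \<sigma> < real g" using reals_Archimedean2 by blast
  then have g: "6 < real g * \<sigma>" using \<sigma>(1) by (simp add: pos_divide_less_eq)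
  define X where "X = Max {100, 2 / \<sigma>, 8 / (\<sigma> / 6), 2 * (18 * (real g + 6 + 648 * real g / \<sigma>)) / (\<sigma> / 6), 16 ^ 16,
      (1 / (1 - 2 * \<sigma>)) ^ a * (4 * real a / \<sigma>) ^ a * real a ^ a * (4 / \<gamma>),
      16 * real r / \<sigma> / \<gamma> * real a ^ a, 32 * real r ^ 3 * real a ^ a / \<gamma>, real a}"
  have X: "y \<le> ln (real n)" if "y \<in> {100, 2 / \<sigma>, 8 / (\<sigma> / 6),
      2 * (18 * (real g + 6 + 648 * real g / \<sigma>)) / (\<sigma> / 6), 16 ^ 16,
      (1 / (1 - 2 * \<sigma>)) ^ a * (4 * real a / \<sigma>) ^ a * real a ^ a * (4 / \<gamma>),
      16 * real r / \<sigma> / \<gamma> * real a ^ a, 32 * real r ^ 3 * real a ^ a / \<gamma>, real a}" and "nat \<lceil>exp X\<rceil> \<le> n" for y n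
  proof -
    have "y \<le> X" unfolding X_def by (rule Max_ge[OF _ that(1)]) simp
    have "exp X \<le> real (nat \<lceil>exp X\<rceil>)" by (rule real_nat_ceiling_ge)
    also have "\<dots> \<le> real n" using that(2) by (simp only: of_nat_le_iff)
    finally have eX: "exp X \<le> real n" .
    then have "0 < real n" using exp_gt_zero[of X] by linarith
    then have "X \<le> ln (real n)" using eX by (simp add: ln_ge_iff)
    then show ?thesis using \<open>y \<le> X\<close> by simp
  qed
  show ?thesis
  proof (intro exI[of _ \<sigma>] conjI exI[of _ "nat \<lceil>exp X\<rceil>"] allI impI)
    show "0 < \<sigma>" "\<sigma> < 3 / 2" using \<sigma> by auto
    fix n p E H
    assume n: "nat \<lceil>exp X\<rceil> \<le> n"
      and pE: "p = ln (real n) ^ (17 * r) / real n ^ (r - 1) \<and> pseudorandom r \<sigma> p {1..n} E \<and>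
        real (max_codegree {1..n} E) \<le> 2 * ln (real n)"
      and H: "H \<subseteq> E \<and> (1 / 2 ^ (r - 1) + \<gamma>) * p * real (n choose (r - 1)) \<le> real (min_degree {1..n} H)"
    show "\<exists>vs es. hamilton_berge_cycle {1..n} H vs es"
    proof (rule berge_cycle_of_pseudorandom[where r = r and \<gamma> = \<gamma> and \<sigma> = \<sigma> and g = g and p = p and E = E
          and x = "ln (real n)"], unfold a_def[symmetric])
      show "((1 / 2) ^ a + \<gamma>) * p * real (n choose a) \<le> real (min_degree {1..n} H)"
        using H by (simp add: a_def power_one_over)
      show "p = ln (real n) ^ (17 * r) / real n ^ a" using pE by (simp only: a_def)
      show "3 \<le> r" "0 < \<gamma>" by fact+
    qed (use \<sigma> g pE H in blast | rule refl | (rule X[OF _ n], simp only: insert_iff simp_thms))+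
  qed
qed

end
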